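(* Let $\Omega,\omega$, $\Omega_0$, $\mathbf F$, $\lambda_1^\Omega(\Phi)$ and $\lambda_1^{\Omega_0}(\Phi)$ be as in the context. Then, as $\Phi\to+\infty$, \[\lambda_1^\Omega(\Phi)=\lambda_1^{\Omega_0}(\Phi)+o(1).\]
   Context: Let $\Omega,\omega\subset\mathbb R^2$ be bounded simply connected domains with $\overline\omega\subset\Omega$ whose boundaries are simple smooth $C^1$ curves; put $\Omega_0=\Omega\setminus\overline\omega$. Let $\phi$ solve $-\Delta\phi=\frac{2\pi}{|\omega|}\mathbf 1_\omega$ in $\Omega$, $\phi=0$ on $\partial\Omega$, and $\mathbf F=(-\partial_2\phi,\partial_1\phi)$. Define \[\lambda_1^{\Omega}(\Phi)=\inf_{u\in H^1(\Omega;\mathbb C)\setminus\{0\}}\frac{\|(-\mathrm i\nabla-\Phi\mathbf F)u\|^2_{L^2(\Omega)}}{\|u\|^2_{L^2(\Omega)}}\] (lowest eigenvalue of the Neumann realization of $(-\mathrm i\nabla-\Phi\mathbf F)^2$ in $\Omega$), and, with $\mathcal X(\Omega_0)=\{u\in H^1(\Omega_0;\mathbb C):u=0\text{ on }\partial\omega\}$, \[\lambda_1^{\Omega_0}(\Phi)=\inf_{u\in\mathcal X(\Omega_0)\setminus\{0\}}\frac{\|(-\mathrm i\nabla-\Phi\mathbf F)u\|^2_{L^2(\Omega_0)}}{\|u\|^2_{L^2(\Omega_0)}}.\] *)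

theory Defs
  imports "HOL-Analysis.Analysis"
begin

definition pd :: "(real^2 \<Rightarrow> real) \<Rightarrow> 2 \<Rightarrow> real^2 \<Rightarrow> real" where
  "pd f k x = frechet_derivative f (at x) (axis k 1)"

definition C1_jordan_boundary :: "(real^2) set \<Rightarrow> bool" where
  "C1_jordan_boundary U \<longleftrightarrow>
     (\<exists>g D. simple_path g \<and> pathfinish g = pathstart g \<and> path_image g = frontier U \<and>
        (\<forall>t\<in>{0..1}. (g has_vector_derivative D t) (at t within {0..1})) \<and>
        continuous_on {0..1} D \<and> (\<forall>t\<in>{0..1}. D t \<noteq> 0) \<and> D 0 = D 1)"

definition smooth_domain :: "(real^2) set \<Rightarrow> bool" where
  "smooth_domain U \<longleftrightarrow> open U \<and> connected U \<and> bounded U \<and> U \<noteq> {} \<and>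
     simply_connected U \<and> C1_jordan_boundary U"

definition test_fun :: "(real^2) set \<Rightarrow> (real^2 \<Rightarrow> real) \<Rightarrow> bool" where
  "test_fun U \<psi> \<longleftrightarrow> (\<forall>x. \<psi> differentiable (at x)) \<and> (\<forall>k. continuous_on UNIV (pd \<psi> k)) \<and>
     compact (closure {x. \<psi> x \<noteq> 0}) \<and> closure {x. \<psi> x \<noteq> 0} \<subseteq> U"

definition L2 :: "(real^2) set \<Rightarrow> (real^2 \<Rightarrow> complex) \<Rightarrow> bool" where
  "L2 U f \<longleftrightarrow> set_borel_measurable lborel U f \<and>
     set_integrable lborel U (\<lambda>x. (cmod (f x))\<^sup>2)"

definition weak_grad :: "(real^2) set \<Rightarrow> (real^2 \<Rightarrow> complex) \<Rightarrow> (2 \<Rightarrow> real^2 \<Rightarrow> complex) \<Rightarrow> bool" where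
  "weak_grad U u G \<longleftrightarrow> (\<forall>\<psi> k. test_fun U \<psi> \<longrightarrow>
     (LINT x:U|lborel. complex_of_real (pd \<psi> k x) * u x) =
       - (LINT x:U|lborel. complex_of_real (\<psi> x) * G k x))"

definition H1grad :: "(real^2) set \<Rightarrow> (real^2 \<Rightarrow> complex) \<Rightarrow> (2 \<Rightarrow> real^2 \<Rightarrow> complex) \<Rightarrow> bool" where
  "H1grad U u G \<longleftrightarrow> L2 U u \<and> (\<forall>k. L2 U (G k)) \<and> weak_grad U u G"

definition L2norm2 :: "(real^2) set \<Rightarrow> (real^2 \<Rightarrow> complex) \<Rightarrow> real" where
  "L2norm2 U u = (LINT x:U|lborel. (cmod (u x))\<^sup>2)"

definition mag_energy :: "(real^2) set \<Rightarrow> real \<Rightarrow> (2 \<Rightarrow> real^2 \<Rightarrow> real) \<Rightarrow>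
    (real^2 \<Rightarrow> complex) \<Rightarrow> (2 \<Rightarrow> real^2 \<Rightarrow> complex) \<Rightarrow> real" where
  "mag_energy U \<Phi> F u G =
     (LINT x:U|lborel. (\<Sum>k\<in>UNIV. (cmod (- \<i> * G k x - complex_of_real (\<Phi> * F k x) * u x))\<^sup>2))"

definition potF :: "(real^2 \<Rightarrow> real) \<Rightarrow> 2 \<Rightarrow> real^2 \<Rightarrow> real" where
  "potF \<phi> k x = (if k = 1 then - pd \<phi> 2 x else pd \<phi> 1 x)"

definition lambda_N :: "(real^2) set \<Rightarrow> (2 \<Rightarrow> real^2 \<Rightarrow> real) \<Rightarrow> real \<Rightarrow> real" where
  "lambda_N \<Omega> F \<Phi> = Inf {mag_energy \<Omega> \<Phi> F u G / L2norm2 \<Omega> u | u G.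
      H1grad \<Omega> u G \<and> L2norm2 \<Omega> u > 0}"

text \<open>Ground state energy in Omega_0 = Omega - closure omega, with Dirichlet condition on
  the boundary of omega (zero trace), expressed as: the extension by zero into omega
  belongs to H^1(Omega).\<close>

definition lambda_D :: "(real^2) set \<Rightarrow> (real^2) set \<Rightarrow> (2 \<Rightarrow> real^2 \<Rightarrow> real) \<Rightarrow> real \<Rightarrow> real" where
  "lambda_D \<Omega> \<omega> F \<Phi> = Inf {mag_energy (\<Omega> - closure \<omega>) \<Phi> F u G / L2norm2 (\<Omega> - closure \<omega>) u | u G.
      H1grad (\<Omega> - closure \<omega>) u G \<and>
      (\<exists>G'. H1grad \<Omega> (\<lambda>x. if x \<in> \<Omega> - closure \<omega> then u x else 0) G') \<and>
      L2norm2 (\<Omega> - closure \<omega>) u > 0}"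

end

theory Submission
  imports Defs "HOL-Complex_Analysis.Cauchy_Integral_Formula"
begin

text \<open>
  Since test functions may be only \<open>C\<^sup>1\<close>, the equation for \<open>\<phi>\<close> can be tested with \<open>|v|\<^sup>2\<close>.
  With \<open>D = \<nabla> - \<i>\<Phi>F\<close> this gives
  \<open>(2\<pi>\<Phi>/|\<omega>|) \<integral>\<^sub>\<omega> |v|\<^sup>2 = - \<integral> 2 Im (cnj (D\<^sub>1 v) * D\<^sub>2 v) \<le> \<integral> |D v|\<^sup>2\<close>,
  so that a function of bounded energy has mass \<open>O(1/\<Phi>)\<close> in \<open>\<omega>\<close>.

  Near a boundary point of \<open>\<omega>\<close> let \<open>h\<close> be a height above the boundary along a transversal direction \<open>n\<close>.
  Integrating \<open>\<partial>\<^sub>n (\<zeta>\<^sup>2 P(h + s) |v|\<^sup>2)\<close> with \<open>P(t) = - (t\<^sup>2 + s\<^sup>2) powr (-1/2)\<close> yields a Hardy inequality: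
  outside \<open>\<omega>\<close>, the integral of \<open>|v|\<^sup>2 / (dist(x,\<omega>) + s)\<^sup>2\<close> is bounded by the energy, the mass, and \<open>s\<close>
  to the power \<open>-2\<close> times the mass in \<open>\<omega>\<close>, with a constant independent of \<open>s\<close> and of the magnetic potential.
  For \<open>\<Phi>\<close> large the last term is harmless, for any fixed \<open>s\<close>. By the pigeonhole principle, one of the dyadic layers
  \<open>t\<^sub>j / 2 < dist(x,\<omega>) < t\<^sub>j\<close>, \<open>n \<le> j < 2n\<close>, carries at most \<open>1/n\<close> of the Hardy integral, and cutting off
  inside this layer changes energy and mass only by a small fraction. The result vanishes near \<open>\<omega>\<close> and is a
  competitor for the Dirichlet problem.

  The energies that matter are bounded independently of \<open>\<Phi>\<close>: away from \<open>\<omega>\<close> the field \<open>F\<close> is locally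
  a gradient \<open>\<nabla>\<theta>\<close>, and a bump times \<open>exp(\<i>\<Phi>\<theta>)\<close> is a trial function.
\<close>

section \<open>Square-integrable functions\<close>

text \<open>A cutoff at distance \<open>t\<close> from \<omega> costs about
  \<open>1 / t\<^sup>2\<close> times the mass in its layer. The Hardy integral bounds exactly this
  quantity, so a single layer gives a cost that is bounded but not small, whatever \<open>t\<close>
  is; smallness comes only from disjoint layers sharing one Hardy integral. Taking the layers from
  \<open>j = n\<close> on, and not from \<open>0\<close>, also makes the mass removed in the collar
  small. The parameters are fixed in the order accuracy, \<open>n\<close>, then \<open>s\<close> as
  the width of the innermost layer, then \<Phi>: hence the Hardy constant must not depend on
  \<open>s\<close> or on the potential. It does not see the potential because
  \<open>Re (cnj v * D v)\<close> does not. Two obstacles shape the rest. The boundary of \<omega>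
  is only C1, so heights are merely Lipschitz and are differentiated in one direction only, where
  they have slope 1. The potential may be unbounded near the boundary of \<Omega>, so both
  inequalities are applied to a function cut off near \<omega>. The opposite comparison is an
  inclusion: extension by zero turns Dirichlet competitors into Neumann ones with the same
  quotient.\<close>

definition sq_int :: "('a::euclidean_space \<Rightarrow> complex) \<Rightarrow> bool" where
  "sq_int f \<longleftrightarrow> f \<in> borel_measurable borel \<and> integrable lborel (\<lambda>x. (cmod (f x))\<^sup>2)"

definition l2_lim :: "(nat \<Rightarrow> 'a::euclidean_space \<Rightarrow> complex) \<Rightarrow> ('a \<Rightarrow> complex) \<Rightarrow> bool" where
  "l2_lim F f \<longleftrightarrow> (\<forall>n. sq_int (F n)) \<and> sq_int f \<and>
     (\<lambda>n. LINT x|lborel. (cmod (F n x - f x))\<^sup>2) \<longlonglongrightarrow> 0"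

lemma cmod_add_sq_le: "(cmod (a + b))\<^sup>2 \<le> 2 * (cmod a)\<^sup>2 + 2 * (cmod b)\<^sup>2"
proof -
  have "(cmod (a + b))\<^sup>2 \<le> (cmod a + cmod b)\<^sup>2"
    by (intro power_mono norm_triangle_ineq) auto
  also have "\<dots> \<le> 2 * (cmod a)\<^sup>2 + 2 * (cmod b)\<^sup>2"
    using sum_squares_bound[of "cmod a" "cmod b"] by (simp add: power2_sum)
  finally show ?thesis .
qed

lemma cmod_diff_sq_le: "(cmod (a - b))\<^sup>2 \<le> 2 * (cmod a)\<^sup>2 + 2 * (cmod b)\<^sup>2"
  using cmod_add_sq_le[of a "-b"] by simp

lemma sq_intD:
  assumes "sq_int f"
  shows sq_int_measurable [measurable_dest, simp]: "f \<in> borel_measurable borel"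
    and sq_int_integrable_sq [simp]: "integrable lborel (\<lambda>x. (cmod (f x))\<^sup>2)"
  using assms by (auto simp: sq_int_def)

lemma sq_int_bound:
  assumes "g \<in> borel_measurable borel" "integrable lborel k" "\<And>x. (cmod (g x))\<^sup>2 \<le> k x"
  shows "sq_int g"
  unfolding sq_int_def
proof
  show "integrable lborel (\<lambda>x. (cmod (g x))\<^sup>2)"
  proof (rule Bochner_Integration.integrable_bound[OF assms(2)])
    show "AE x in lborel. norm ((cmod (g x))\<^sup>2) \<le> norm (k x)"
      using assms(3) by (intro AE_I2) (simp add: order_trans[OF assms(3) abs_ge_self])
  qed (use assms(1) in auto)
qed (use assms in auto)

lemma sq_int_add:
  assumes "sq_int f" "sq_int g"
  shows "sq_int (\<lambda>x. f x + g x)"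
proof (rule sq_int_bound)
  show "integrable lborel (\<lambda>x. 2 * (cmod (f x))\<^sup>2 + 2 * (cmod (g x))\<^sup>2)"
    using assms by auto
  show "(cmod (f x + g x))\<^sup>2 \<le> 2 * (cmod (f x))\<^sup>2 + 2 * (cmod (g x))\<^sup>2" for x
    by (rule cmod_add_sq_le)
qed (use assms in simp)

lemma sq_int_mult_bounded:
  assumes "sq_int f" "m \<in> borel_measurable borel" "\<And>x. cmod (m x) \<le> B"
  shows "sq_int (\<lambda>x. m x * f x)"
proof (rule sq_int_bound)
  show "integrable lborel (\<lambda>x. B\<^sup>2 * (cmod (f x))\<^sup>2)"
    using assms by auto
  show "(cmod (m x * f x))\<^sup>2 \<le> B\<^sup>2 * (cmod (f x))\<^sup>2" for x
    unfolding norm_mult power_mult_distrib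
    by (intro mult_right_mono power_mono assms) auto
qed (use assms in auto)

lemma sq_int_cmult: "sq_int f \<Longrightarrow> sq_int (\<lambda>x. c * f x)"
  by (rule sq_int_mult_bounded[where B = "cmod c"]) auto

lemma sq_int_diff: "sq_int f \<Longrightarrow> sq_int g \<Longrightarrow> sq_int (\<lambda>x. f x - g x)"
  using sq_int_add[of f "\<lambda>x. (-1) * g x"] sq_int_cmult[of g "-1"] by simp

lemma borel_measurable_cnj [measurable (raw)]:
  "f \<in> borel_measurable M \<Longrightarrow> (\<lambda>x. cnj (f x)) \<in> borel_measurable M"
  by (rule measurable_compose[OF _ borel_measurable_continuous_onI[OF continuous_on_cnj[OF continuous_on_id]]])

lemma sq_int_cnj: "sq_int f \<Longrightarrow> sq_int (\<lambda>x. cnj (f x))"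
  by (subst sq_int_def) auto

lemma sq_int_mult_integrable:
  assumes "sq_int f" "sq_int g"
  shows "integrable lborel (\<lambda>x. f x * g x)"
proof (rule Bochner_Integration.integrable_bound)
  show "integrable lborel (\<lambda>x. (cmod (f x))\<^sup>2 + (cmod (g x))\<^sup>2)"
    using assms by auto
  have "cmod (f x) * cmod (g x) \<le> (cmod (f x))\<^sup>2 + (cmod (g x))\<^sup>2" for x
  proof -
    have "0 \<le> (cmod (f x) - cmod (g x))\<^sup>2 + cmod (f x) * cmod (g x)" by simp
    then show ?thesis by (simp add: power2_diff)
  qed
  then show "AE x in lborel. norm (f x * g x) \<le> norm ((cmod (f x))\<^sup>2 + (cmod (g x))\<^sup>2)"
    by (auto simp: norm_mult)
qed (use assms in auto)

lemma integrable_bounded_mult: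
  fixes m :: "'a::euclidean_space \<Rightarrow> real" and f :: "'a \<Rightarrow> 'b::{banach,second_countable_topology}"
  assumes "integrable lborel f" "m \<in> borel_measurable borel" "\<And>x. \<bar>m x\<bar> \<le> B"
  shows "integrable lborel (\<lambda>x. m x *\<^sub>R f x)"
proof (rule Bochner_Integration.integrable_bound)
  show "integrable lborel (\<lambda>x. B *\<^sub>R norm (f x))" using assms by auto
  show "AE x in lborel. norm (m x *\<^sub>R f x) \<le> norm (B *\<^sub>R norm (f x))"
  proof (rule AE_I2)
    fix x
    have "\<bar>m x\<bar> * norm (f x) \<le> \<bar>B\<bar> * norm (f x)"
      using assms(3)[of x] by (intro mult_right_mono) auto
    then show "norm (m x *\<^sub>R f x) \<le> norm (B *\<^sub>R norm (f x))" by (simp add: abs_mult)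
  qed
  show "(\<lambda>x. m x *\<^sub>R f x) \<in> borel_measurable lborel"
    using borel_measurable_integrable[OF assms(1)] assms(2) by simp
qed

lemma sq_int_weight_integrable:
  fixes m :: "'a::euclidean_space \<Rightarrow> real"
  assumes "sq_int f" "m \<in> borel_measurable borel" "\<And>x. \<bar>m x\<bar> \<le> B"
  shows "integrable lborel (\<lambda>x. m x * (cmod (f x))\<^sup>2)"
  using integrable_bounded_mult[of "\<lambda>x. (cmod (f x))\<^sup>2" m B] assms by auto

section \<open>Convergence in the mean: linear operations, pairings and weighted squares\<close>

lemma l2_lim_bound:
  assumes "\<And>n. sq_int (F n)" "sq_int f"
    "\<And>n. (LINT x|lborel. (cmod (F n x - f x))\<^sup>2) \<le> a n" "a \<longlonglongrightarrow> 0"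
  shows "l2_lim F f"
  unfolding l2_lim_def
  using assms by (auto intro!: tendsto_sandwich[OF _ _ tendsto_const assms(4)])

lemma l2_lim_add:
  assumes "l2_lim F f" "l2_lim G g"
  shows "l2_lim (\<lambda>n x. F n x + G n x) (\<lambda>x. f x + g x)"
proof (rule l2_lim_bound)
  note a = assms[unfolded l2_lim_def]
  have i: "integrable lborel (\<lambda>x. (cmod (F n x - f x))\<^sup>2)" "integrable lborel (\<lambda>x. (cmod (G n x - g x))\<^sup>2)" for n
    using a sq_int_diff by (blast dest: sq_intD)+
  show "sq_int (\<lambda>x. F n x + G n x)" "sq_int (\<lambda>x. f x + g x)" for n
    using a by (auto intro!: sq_int_add)
  show "(LINT x|lborel. (cmod (F n x + G n x - (f x + g x)))\<^sup>2)
    \<le> 2 * (LINT x|lborel. (cmod (F n x - f x))\<^sup>2) + 2 * (LINT x|lborel. (cmod (G n x - g x))\<^sup>2)" for n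
  proof -
    have "(LINT x|lborel. (cmod (F n x + G n x - (f x + g x)))\<^sup>2) \<le>
      (LINT x|lborel. 2 * (cmod (F n x - f x))\<^sup>2 + 2 * (cmod (G n x - g x))\<^sup>2)"
    proof (rule integral_mono)
      have "integrable lborel (\<lambda>x. (cmod ((F n x + G n x) - (f x + g x)))\<^sup>2)"
        using a by (intro sq_intD sq_int_diff sq_int_add) auto
      then show "integrable lborel (\<lambda>x. (cmod (F n x + G n x - (f x + g x)))\<^sup>2)" .
      show "(cmod (F n x + G n x - (f x + g x)))\<^sup>2 \<le> 2 * (cmod (F n x - f x))\<^sup>2 + 2 * (cmod (G n x - g x))\<^sup>2" for x
        using cmod_add_sq_le[of "F n x - f x" "G n x - g x"] by (simp add: algebra_simps)
    qed (use i in auto)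
    then show ?thesis using i by simp
  qed
  show "(\<lambda>n. 2 * (LINT x|lborel. (cmod (F n x - f x))\<^sup>2) + 2 * (LINT x|lborel. (cmod (G n x - g x))\<^sup>2)) \<longlonglongrightarrow> 0"
    using a by (auto intro!: tendsto_eq_intros)
qed

lemma l2_lim_mult_bounded:
  assumes "l2_lim F f" "m \<in> borel_measurable borel" "\<And>x. cmod (m x) \<le> B"
  shows "l2_lim (\<lambda>n x. m x * F n x) (\<lambda>x. m x * f x)"
proof (rule l2_lim_bound)
  note a = assms(1)[unfolded l2_lim_def]
  have i: "integrable lborel (\<lambda>x. (cmod (F n x - f x))\<^sup>2)" for n
    using a sq_int_diff by (blast dest: sq_intD)
  show "sq_int (\<lambda>x. m x * F n x)" "sq_int (\<lambda>x. m x * f x)" for n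
    using a by (auto intro!: sq_int_mult_bounded[OF _ assms(2,3)])
  show "(LINT x|lborel. (cmod (m x * F n x - m x * f x))\<^sup>2)
    \<le> B\<^sup>2 * (LINT x|lborel. (cmod (F n x - f x))\<^sup>2)" for n
  proof -
    have "(LINT x|lborel. (cmod (m x * F n x - m x * f x))\<^sup>2) \<le> (LINT x|lborel. B\<^sup>2 * (cmod (F n x - f x))\<^sup>2)"
    proof (rule integral_mono)
      have "integrable lborel (\<lambda>x. (cmod (m x * F n x - m x * f x))\<^sup>2)"
        using a assms by (intro sq_intD sq_int_diff sq_int_mult_bounded[OF _ assms(2,3)]) auto
      then show "integrable lborel (\<lambda>x. (cmod (m x * F n x - m x * f x))\<^sup>2)" .
      show "(cmod (m x * F n x - m x * f x))\<^sup>2 \<le> B\<^sup>2 * (cmod (F n x - f x))\<^sup>2" for x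
        unfolding right_diff_distrib[symmetric] norm_mult power_mult_distrib
        by (intro mult_right_mono power_mono assms) auto
    qed (use i in auto)
    then show ?thesis by simp
  qed
  show "(\<lambda>n. B\<^sup>2 * (LINT x|lborel. (cmod (F n x - f x))\<^sup>2)) \<longlonglongrightarrow> 0"
    using a by (auto intro!: tendsto_eq_intros)
qed

lemma l2_lim_diff:
  assumes "l2_lim F f" "l2_lim G g"
  shows "l2_lim (\<lambda>n x. F n x - G n x) (\<lambda>x. f x - g x)"
  using l2_lim_add[OF assms(1) l2_lim_mult_bounded[OF assms(2), of "\<lambda>_. -1" 1]] by simp

lemma l2_lim_const: "sq_int f \<Longrightarrow> l2_lim (\<lambda>_. f) f"
  by (simp add: l2_lim_def)

text \<open>Stands in for Cauchy-Schwarz: Young's inequality bounds an integral of products by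
  \<open>b n / \<delta> + \<delta> * C\<close> for every \<delta>, and fixing \<delta> before
  \<open>n\<close> is enough for the limit.\<close>

lemma LIMSEQ_arb_bound:
  fixes a b :: "nat \<Rightarrow> real" and C :: real
  assumes "b \<longlonglongrightarrow> 0" "C \<ge> 0" "\<And>n \<delta>. \<delta> > 0 \<Longrightarrow> \<bar>a n\<bar> \<le> b n / \<delta> + \<delta> * C"
  shows "a \<longlonglongrightarrow> 0"
proof (rule LIMSEQ_I)
  fix e :: real assume e: "e > 0"
  define d where "d = e / (2 * (C + 1))"
  have d: "d > 0" using e assms(2) by (auto simp: d_def)
  have "eventually (\<lambda>n. \<bar>b n\<bar> < d * e / 2) sequentially"
    using assms(1) d e by (auto dest!: tendstoD[of _ _ _ "d * e / 2"] simp: dist_real_def)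
  then obtain N where N: "\<And>n. n \<ge> N \<Longrightarrow> \<bar>b n\<bar> < d * e / 2" by (auto simp: eventually_sequentially)
  have "norm (a n - 0) < e" if "n \<ge> N" for n
  proof -
    have "b n < d * e / 2" using N[OF that] by auto
    then have "b n / d < e / 2" using d by (simp add: field_simps)
    moreover have "d * C \<le> e / 2" using e assms(2) by (auto simp: d_def field_simps)
    ultimately have "\<bar>a n\<bar> < e" using assms(3)[OF d, of n] by linarith
    then show ?thesis by simp
  qed
  then show "\<exists>no. \<forall>n\<ge>no. norm (a n - 0) < e" by blast
qed

lemma young_ineq:
  fixes a b d :: real assumes "d > 0"
  shows "a * b \<le> a\<^sup>2 / d + d * b\<^sup>2"
proof -
  have "2 * (a / sqrt d) * (sqrt d * b) \<le> (a / sqrt d)\<^sup>2 + (sqrt d * b)\<^sup>2" by (rule sum_squares_bound)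
  then have "2 * (a * b) \<le> a\<^sup>2 / d + d * b\<^sup>2" using assms by (simp add: power_divide power_mult_distrib)
  moreover have "0 \<le> a\<^sup>2 / d + d * b\<^sup>2" using assms by auto
  ultimately show ?thesis by linarith
qed

lemma l2_lim_pair:
  assumes "l2_lim F f" "sq_int g"
  shows "(\<lambda>n. LINT x|lborel. F n x * g x) \<longlonglongrightarrow> (LINT x|lborel. f x * g x)"
proof (rule Lim_null[THEN iffD2], rule tendsto_norm_zero_cancel, rule LIMSEQ_arb_bound)
  note a = assms(1)[unfolded l2_lim_def]
  show "(\<lambda>n. LINT x|lborel. (cmod (F n x - f x))\<^sup>2) \<longlonglongrightarrow> 0" using a by simp
  show "0 \<le> (LINT x|lborel. (cmod (g x))\<^sup>2)" by simp
  fix n and d :: real assume d: "d > 0"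
  have s: "sq_int (\<lambda>x. F n x - f x)" using a by (auto intro: sq_int_diff)
  have "(LINT x|lborel. F n x * g x) - (LINT x|lborel. f x * g x) = (LINT x|lborel. (F n x - f x) * g x)"
    using a assms sq_int_mult_integrable by (subst Bochner_Integration.integral_diff[symmetric]) (auto simp: algebra_simps)
  then have "\<bar>cmod ((LINT x|lborel. F n x * g x) - (LINT x|lborel. f x * g x))\<bar> \<le> (LINT x|lborel. cmod ((F n x - f x) * g x))"
    by simp
  also have "\<dots> \<le> (LINT x|lborel. (cmod (F n x - f x))\<^sup>2 / d + d * (cmod (g x))\<^sup>2)"
    using s assms(2) young_ineq[OF d]
    by (intro integral_mono integrable_norm sq_int_mult_integrable Bochner_Integration.integrable_add
        integrable_divide integrable_mult_right) (auto simp: norm_mult)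
  also have "\<dots> = (LINT x|lborel. (cmod (F n x - f x))\<^sup>2) / d + d * (LINT x|lborel. (cmod (g x))\<^sup>2)"
    using s assms(2) by (subst Bochner_Integration.integral_add) auto
  finally show "\<bar>cmod ((LINT x|lborel. F n x * g x) - (LINT x|lborel. f x * g x))\<bar>
     \<le> (LINT x|lborel. (cmod (F n x - f x))\<^sup>2) / d + d * (LINT x|lborel. (cmod (g x))\<^sup>2)" .
qed

text \<open>With \<open>h n = F n - f\<close> the integrand splits into a quadratic part, at most
  \<open>B\<close> times the squared distance, a cross term that tends to 0 by
  \<open>l2_lim_pair\<close>, and the limit itself.\<close>

lemma l2_lim_weighted:
  fixes m :: "'a::euclidean_space \<Rightarrow> real"
  assumes "l2_lim F f" "m \<in> borel_measurable borel" "\<And>x. \<bar>m x\<bar> \<le> B"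
  shows "(\<lambda>n. LINT x|lborel. m x * (cmod (F n x))\<^sup>2) \<longlonglongrightarrow> (LINT x|lborel. m x * (cmod (f x))\<^sup>2)"
proof -
  note a = assms(1)[unfolded l2_lim_def]
  define h where "h n x = F n x - f x" for n x
  have B: "B \<ge> 0" using assms(3)[of undefined] by linarith
  have s: "sq_int (h n)" for n unfolding h_def using a by (intro sq_int_diff) auto
  have hl: "l2_lim h (\<lambda>_. 0)" unfolding h_def using l2_lim_diff[OF assms(1) l2_lim_const, of f] a by simp
  have mf: "sq_int (\<lambda>x. of_real (m x) * cnj (f x))"
    using assms a by (intro sq_int_mult_bounded[where B=B] sq_int_cnj) auto
  have 1: "(\<lambda>n. LINT x|lborel. m x * (cmod (h n x))\<^sup>2) \<longlonglongrightarrow> 0"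
  proof (rule tendsto_rabs_zero_cancel, rule tendsto_sandwich[OF _ _ tendsto_const])
    show "(\<lambda>n. B * (LINT x|lborel. (cmod (F n x - f x))\<^sup>2)) \<longlonglongrightarrow> 0"
      using a by (auto intro!: tendsto_eq_intros)
    have "\<bar>LINT x|lborel. m x * (cmod (h n x))\<^sup>2\<bar> \<le> (LINT x|lborel. B * (cmod (h n x))\<^sup>2)" for n
    proof -
      have "norm (LINT x|lborel. m x * (cmod (h n x))\<^sup>2) \<le> (LINT x|lborel. norm (m x * (cmod (h n x))\<^sup>2))"
        by (rule integral_norm_bound)
      also have "\<dots> \<le> (LINT x|lborel. B * (cmod (h n x))\<^sup>2)"
        using s assms(3) integrable_norm[OF sq_int_weight_integrable[OF s assms(2,3)]]
        by (intro integral_mono) (auto simp: abs_mult intro!: mult_right_mono)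
      finally show ?thesis by simp
    qed
    then show "\<forall>\<^sub>F n in sequentially. \<bar>LINT x|lborel. m x * (cmod (h n x))\<^sup>2\<bar> \<le> B * (LINT x|lborel. (cmod (F n x - f x))\<^sup>2)"
      by (simp add: h_def)
  qed auto
  have 2: "(\<lambda>n. LINT x|lborel. h n x * (of_real (m x) * cnj (f x))) \<longlonglongrightarrow> 0"
    using l2_lim_pair[OF hl mf] by simp
  have eq: "m x * (cmod (F n x))\<^sup>2 = m x * (cmod (h n x))\<^sup>2 + 2 * Re (h n x * (of_real (m x) * cnj (f x))) + m x * (cmod (f x))\<^sup>2" for n x
    unfolding h_def cmod_power2 by (simp add: power2_eq_square algebra_simps)
  have "(LINT x|lborel. m x * (cmod (F n x))\<^sup>2) = (LINT x|lborel. m x * (cmod (h n x))\<^sup>2)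
     + 2 * Re (LINT x|lborel. h n x * (of_real (m x) * cnj (f x))) + (LINT x|lborel. m x * (cmod (f x))\<^sup>2)" for n
  proof -
    have i: "integrable lborel (\<lambda>x. h n x * (of_real (m x) * cnj (f x)))"
      using s mf by (rule sq_int_mult_integrable)
    have i1: "integrable lborel (\<lambda>x. 2 * Re (h n x * (of_real (m x) * cnj (f x))))"
      by (intro integrable_mult_right integrable_Re i)
    have i2: "integrable lborel (\<lambda>x. m x * (cmod (h n x))\<^sup>2)" "integrable lborel (\<lambda>x. m x * (cmod (f x))\<^sup>2)"
      using sq_int_weight_integrable[OF s assms(2,3)] sq_int_weight_integrable[OF _ assms(2,3), of f] a by auto
    show ?thesis unfolding eq
      by (simp only: Bochner_Integration.integral_add[OF Bochner_Integration.integrable_add[OF i2(1) i1] i2(2)]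
         Bochner_Integration.integral_add[OF i2(1) i1] integral_mult_right_zero integral_Re[OF i])
  qed
  moreover have "(\<lambda>n. (LINT x|lborel. m x * (cmod (h n x))\<^sup>2)
     + 2 * Re (LINT x|lborel. h n x * (of_real (m x) * cnj (f x))) + (LINT x|lborel. m x * (cmod (f x))\<^sup>2))
    \<longlonglongrightarrow> 0 + 2 * Re 0 + (LINT x|lborel. m x * (cmod (f x))\<^sup>2)"
    by (intro tendsto_intros 1 2)
  ultimately show ?thesis by simp
qed

section \<open>Bounded support, and approximation by continuous functions\<close>

lemma continuous_compact_support_bounded:
  fixes f :: "'a::euclidean_space \<Rightarrow> 'b::real_normed_vector"
  assumes "continuous_on UNIV f" "\<And>x. norm x > R \<Longrightarrow> f x = 0"
  obtains B where "B \<ge> 0" "\<And>x. norm (f x) \<le> B"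
proof -
  have "compact (f ` cball 0 R)"
    using assms(1) continuous_on_subset by (intro compact_continuous_image) auto
  then obtain B where B: "\<And>x. x \<in> cball 0 R \<Longrightarrow> norm (f x) \<le> B"
    using compact_imp_bounded bounded_iff by (metis imageI)
  have "norm (f x) \<le> max B 0" for x
    using B[of x] assms(2)[of x] by (cases "norm x \<le> R") auto
  then show ?thesis using that[of "max B 0"] by auto
qed

lemma integrable_bounded_support:
  fixes f :: "'a::euclidean_space \<Rightarrow> 'b::{banach,second_countable_topology}"
  assumes "f \<in> borel_measurable borel" "\<And>x. norm (f x) \<le> B" "\<And>x. norm x > R \<Longrightarrow> f x = 0"
  shows "integrable lborel f"
proof (rule Bochner_Integration.integrable_bound)
  show "integrable lborel (\<lambda>x. B * indicator (cball (0::'a) R) x :: real)"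
    using emeasure_lborel_cball_finite[of 0 R]
    by (intro integrable_mult_right integrable_real_indicator) (auto simp: top.not_eq_extremum)
  have "0 \<le> B" using assms(2)[of undefined] norm_ge_zero order_trans by blast
  then show "AE x in lborel. norm (f x) \<le> norm (B * indicator (cball (0::'a) R) x :: real)"
    using assms(2,3) by (auto simp: indicator_def not_le)
qed (use assms in auto)

lemma continuous_compact_support_integrable:
  fixes f :: "'a::euclidean_space \<Rightarrow> 'b::{banach,second_countable_topology}"
  assumes "continuous_on UNIV f" "\<And>x. norm x > R \<Longrightarrow> f x = 0"
  shows "integrable lborel f"
proof -
  obtain B where "\<And>x. norm (f x) \<le> B" using continuous_compact_support_bounded[OF assms] by blast
  then show ?thesis
    using integrable_bounded_support[of f B R] assms borel_measurable_continuous_onI[OF assms(1)] by auto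
qed

lemma continuous_compact_support_sq_int:
  fixes f :: "'a::euclidean_space \<Rightarrow> complex"
  assumes "continuous_on UNIV f" "\<And>x. norm x > R \<Longrightarrow> f x = 0"
  shows "sq_int f"
  unfolding sq_int_def using borel_measurable_continuous_onI[OF assms(1)] assms
  by (auto intro!: continuous_compact_support_integrable[where R=R] continuous_intros)

lemma sq_int_integrable:
  assumes "sq_int f" "\<And>x. norm x > R \<Longrightarrow> f x = 0"
  shows "integrable lborel f"
proof (rule Bochner_Integration.integrable_bound)
  show "integrable lborel (\<lambda>x. (cmod (f x))\<^sup>2 + indicator (cball 0 R) x)"
    using assms emeasure_lborel_cball_finite[of 0 R]
    by (intro Bochner_Integration.integrable_add integrable_real_indicator) (auto simp: top.not_eq_extremum)
  have "cmod z \<le> (cmod z)\<^sup>2 + 1" for z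
    using sum_squares_bound[of "cmod z" "1/2"] by (simp add: power2_eq_square)
  then show "AE x in lborel. norm (f x) \<le> norm ((cmod (f x))\<^sup>2 + indicator (cball 0 R) x :: real)"
    using assms(2) by (intro AE_I2) (auto simp: indicator_def not_le)
qed (use assms in auto)

text \<open>\<open>p\<close> is the radial retraction onto the disc of radius \<open>M\<close>.
  Being the identity on the disc and moving no point by more than its modulus, it truncates a
  square-integrable function with an error dominated by the function.\<close>

lemma complex_clamp:
  fixes M :: real assumes "M > 0"
  defines "p \<equiv> \<lambda>z::complex. of_real (M / max M (cmod z)) * z"
  shows "continuous_on UNIV p" "cmod (p z) \<le> M" "cmod z \<le> M \<Longrightarrow> p z = z" "cmod (p z - z) \<le> cmod z"
proof -
  show "continuous_on UNIV p" unfolding p_def using assms by (intro continuous_intros) (auto simp: max_def)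
  have "M * cmod z \<le> M * max M (cmod z)" using assms by (intro mult_left_mono) auto
  then show "cmod (p z) \<le> M" unfolding p_def using assms by (simp add: norm_mult norm_divide divide_le_eq max_def)
  show "cmod z \<le> M \<Longrightarrow> p z = z" unfolding p_def using assms by (auto simp: max_def)
  have "p z - z = of_real (M / max M (cmod z) - 1) * z" by (simp add: p_def algebra_simps)
  moreover have "0 \<le> M / max M (cmod z)" "M / max M (cmod z) \<le> 1" using assms by auto
  then have "\<bar>M / max M (cmod z) - 1\<bar> \<le> 1" by linarith
  ultimately show "cmod (p z - z) \<le> cmod z"
    by (metis norm_mult norm_of_real mult_left_le_one_le norm_ge_zero abs_ge_zero)
qed

text \<open>Two applications of dominated convergence: the values are truncated at height
  \<open>M\<close>, then the truncation is approximated by continuous functions that are clamped at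
  the same height and cut off, so that a constant on a ball dominates the error.\<close>

lemma sq_int_approx_continuous:
  fixes f :: "'a::euclidean_space \<Rightarrow> complex"
  assumes f: "sq_int f" and supp: "\<And>x. norm x > R \<Longrightarrow> f x = 0" and e: "e > 0"
  obtains g where "continuous_on UNIV g" "\<And>x. norm x > R + 1 \<Longrightarrow> g x = 0"
    "(LINT x|lborel. (cmod (f x - g x))\<^sup>2) < e"
proof -
  define p where "p M z = of_real (M / max M (cmod z)) * z" for M z
  have p: "continuous_on UNIV (p M)" "cmod (p M z) \<le> M" "cmod z \<le> M \<Longrightarrow> p M z = z" "cmod (p M z - z) \<le> cmod z"
    if "M > 0" for M z
    using complex_clamp[OF that] unfolding p_def by auto
  have pM: "p M \<in> borel_measurable borel" if "M > 0" for M
    using p(1)[OF that] by (rule borel_measurable_continuous_onI)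
  have [measurable]: "f \<in> borel_measurable borel" using f by auto
  have pf: "(\<lambda>x. p M (f x)) \<in> borel_measurable borel" if "M > 0" for M
    by (rule measurable_compose[OF _ pM[OF that]]) simp
  have "(\<lambda>n. LINT x|lborel. (cmod (p (real (Suc n)) (f x) - f x))\<^sup>2) \<longlonglongrightarrow> (LINT x::'a|lborel. 0)"
  proof (rule integral_dominated_convergence[where w = "\<lambda>x. (cmod (f x))\<^sup>2"])
    show "AE x in lborel. (\<lambda>n. (cmod (p (real (Suc n)) (f x) - f x))\<^sup>2) \<longlonglongrightarrow> 0"
    proof (intro AE_I2 tendsto_eventually)
      fix x
      have "eventually (\<lambda>n. cmod (f x) \<le> real (Suc n)) sequentially"
        by (rule eventually_sequentiallyI[of "nat \<lceil>cmod (f x)\<rceil>"]) (auto simp: nat_le_iff ceiling_le_iff)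
      then show "\<forall>\<^sub>F n in sequentially. (cmod (p (real (Suc n)) (f x) - f x))\<^sup>2 = 0"
        by eventually_elim (simp add: p(3))
    qed
    show "AE x in lborel. norm ((cmod (p (real (Suc n)) (f x) - f x))\<^sup>2) \<le> (cmod (f x))\<^sup>2" for n
      using p(4)[of "real (Suc n)"] by (intro AE_I2) (auto intro!: power_mono)
    show "(\<lambda>x. (cmod (p (real (Suc n)) (f x) - f x))\<^sup>2) \<in> borel_measurable lborel" for n
      using pf[of "real (Suc n)"] by measurable
  qed (use f in auto)
  then have "eventually (\<lambda>n. (LINT x|lborel. (cmod (p (real (Suc n)) (f x) - f x))\<^sup>2) < e / 4) sequentially"
    using e by (intro order_tendstoD) auto
  then obtain n0 where n0: "(LINT x|lborel. (cmod (p (real (Suc n0)) (f x) - f x))\<^sup>2) < e / 4"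
    by (meson eventually_happens trivial_limit_sequentially)
  define M where "M = real (Suc n0)"
  have M: "M > 0" by (simp add: M_def)
  \<comment> \<open>\<open>measurable_on\<close> supplies continuous functions \<open>G n\<close>
    converging to \<open>f\<close> off a negligible set; no bound on them is known, which is why
    they are clamped below.\<close>
  have "f \<in> borel_measurable lebesgue" by (simp add: measurable_completion)
  then have "f measurable_on UNIV" by (intro lebesgue_measurable_imp_measurable_on) auto
  then obtain N G where N: "negligible N" and G: "\<And>n. continuous_on UNIV (G n)"
    and GL: "\<And>x. x \<notin> N \<Longrightarrow> (\<lambda>n. G n x) \<longlonglongrightarrow> f x"
    unfolding measurable_on_def by auto
  have AEN: "AE x in lborel. x \<notin> N"
    using N by (metis AE_not_in AE_completion_iff completion.AE_iff_null_sets negligible_iff_null_sets)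
  \<comment> \<open>The tent \<open>c\<close> is 1 for norm at most \<open>R\<close>, where
    \<open>f\<close> may be nonzero, and 0 beyond \<open>R + 1\<close>; this is the unit by which
    the support grows.\<close>
  define c where "c x = max 0 (min 1 (R + 1 - norm x))" for x :: 'a
  define g where "g n x = of_real (c x) * p M (G n x)" for n x
  have cg: "continuous_on UNIV (g n)" for n
    unfolding g_def c_def
    by (intro continuous_intros continuous_on_compose2[OF p(1)[OF M] G]) auto
  have c01: "0 \<le> c x" "c x \<le> 1" for x by (auto simp: c_def)
  have gb: "cmod (g n x) \<le> M" for n x
  proof -
    have "c x * cmod (p M (G n x)) \<le> 1 * M"
      using c01 p(2)[OF M] M by (intro mult_mono) auto
    then show ?thesis using c01 by (simp add: g_def norm_mult)
  qed
  have gs: "g n x = 0" if "norm x > R + 1" for n x using that by (simp add: g_def c_def)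
  have "(\<lambda>n. LINT x|lborel. (cmod (p M (f x) - g n x))\<^sup>2) \<longlonglongrightarrow> (LINT x::'a|lborel. 0)"
  proof (rule integral_dominated_convergence[where w = "\<lambda>x. (2 * M)\<^sup>2 * indicator (cball 0 (R + 1)) x"])
    show "integrable lborel (\<lambda>x::'a. (2 * M)\<^sup>2 * indicator (cball 0 (R + 1)) x :: real)"
      using emeasure_lborel_cball_finite[of 0 "R + 1"]
      by (intro integrable_mult_right integrable_real_indicator) (auto simp: top.not_eq_extremum)
    show "AE x in lborel. (\<lambda>n. (cmod (p M (f x) - g n x))\<^sup>2) \<longlonglongrightarrow> 0"
      using AEN
    proof eventually_elim
      fix x assume "x \<notin> N"
      then have "(\<lambda>n. p M (G n x)) \<longlonglongrightarrow> p M (f x)"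
        using continuous_on_tendsto_compose[OF p(1)[OF M] GL] by auto
      then have "(\<lambda>n. g n x) \<longlonglongrightarrow> of_real (c x) * p M (f x)" unfolding g_def by (intro tendsto_intros)
      moreover have "of_real (c x) * p M (f x) = p M (f x)"
        using supp[of x] by (cases "norm x > R") (auto simp: p_def c_def)
      ultimately have "(\<lambda>n. g n x) \<longlonglongrightarrow> p M (f x)" by simp
      then show "(\<lambda>n. (cmod (p M (f x) - g n x))\<^sup>2) \<longlonglongrightarrow> 0"
        by (auto intro!: tendsto_eq_intros)
    qed
    show "AE x in lborel. norm ((cmod (p M (f x) - g n x))\<^sup>2) \<le> (2 * M)\<^sup>2 * indicator (cball 0 (R + 1)) x" for n
    proof (rule AE_I2)
      fix x
      show "norm ((cmod (p M (f x) - g n x))\<^sup>2) \<le> (2 * M)\<^sup>2 * indicator (cball 0 (R + 1)) x"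
      proof (cases "norm x > R + 1")
        case True
        then show ?thesis using gs[OF True] supp[of x] by (auto simp: p_def)
      next
        case False
        have "cmod (p M (f x) - g n x) \<le> 2 * M"
          using norm_triangle_ineq4[of "p M (f x)" "g n x"] gb[of n x] p(2)[OF M, of "f x"] by linarith
        then have "(cmod (p M (f x) - g n x))\<^sup>2 \<le> (2 * M)\<^sup>2" by (intro power_mono) auto
        then show ?thesis using False by (auto simp: indicator_def)
      qed
    qed
    show "(\<lambda>x. (cmod (p M (f x) - g n x))\<^sup>2) \<in> borel_measurable lborel" for n
      using pf[OF M] borel_measurable_continuous_onI[OF cg[of n]] by measurable
  qed auto
  then have "eventually (\<lambda>n. (LINT x|lborel. (cmod (p M (f x) - g n x))\<^sup>2) < e / 4) sequentially"
    using e by (intro order_tendstoD) auto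
  then obtain n1 where n1: "(LINT x|lborel. (cmod (p M (f x) - g n1 x))\<^sup>2) < e / 4"
    by (meson eventually_happens trivial_limit_sequentially)
  have sg: "sq_int (g n1)" by (rule continuous_compact_support_sq_int[OF cg gs])
  have sp: "sq_int (\<lambda>x. p M (f x))"
  proof (rule sq_int_bound)
    show "integrable lborel (\<lambda>x. 4 * (cmod (f x))\<^sup>2)" using f by auto
    show "(cmod (p M (f x)))\<^sup>2 \<le> 4 * (cmod (f x))\<^sup>2" for x
      using p(4)[OF M, of "f x"] norm_triangle_ineq2[of "p M (f x)" "f x"]
        power_mono[of "cmod (p M (f x))" "2 * cmod (f x)" 2] by (simp add: power_mult_distrib)
  qed (rule pf[OF M])
  have "(LINT x|lborel. (cmod (f x - g n1 x))\<^sup>2) \<le>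
    (LINT x|lborel. 2 * (cmod (p M (f x) - f x))\<^sup>2 + 2 * (cmod (p M (f x) - g n1 x))\<^sup>2)"
  proof (rule integral_mono)
    show "integrable lborel (\<lambda>x. (cmod (f x - g n1 x))\<^sup>2)" using sq_int_diff[OF f sg] by auto
    show "integrable lborel (\<lambda>x. 2 * (cmod (p M (f x) - f x))\<^sup>2 + 2 * (cmod (p M (f x) - g n1 x))\<^sup>2)"
      using sq_int_diff[OF sp f] sq_int_diff[OF sp sg] by auto
    show "(cmod (f x - g n1 x))\<^sup>2 \<le> 2 * (cmod (p M (f x) - f x))\<^sup>2 + 2 * (cmod (p M (f x) - g n1 x))\<^sup>2" for x
      using cmod_diff_sq_le[of "p M (f x) - g n1 x" "p M (f x) - f x"] by simp
  qed
  also have "\<dots> = 2 * (LINT x|lborel. (cmod (p M (f x) - f x))\<^sup>2) + 2 * (LINT x|lborel. (cmod (p M (f x) - g n1 x))\<^sup>2)"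
    using sq_int_diff[OF sp f] sq_int_diff[OF sp sg] by (subst Bochner_Integration.integral_add) auto
  also have "\<dots> < e" using n0 n1 e by (simp add: M_def)
  finally show ?thesis using that cg gs by blast
qed

section \<open>Mollification\<close>

text \<open>A kernel that is only C1: test functions need no more regularity, and the squared
  positive part of a polynomial makes the remainder of its derivative an explicit estimate. It is
  not normalised; \<open>bump_mass\<close> does that.\<close>

definition bump :: "real \<Rightarrow> 'a::euclidean_space \<Rightarrow> real" where
  "bump r z = (max 0 (r\<^sup>2 - z \<bullet> z))\<^sup>2"

definition bump_deriv :: "real \<Rightarrow> 'a::euclidean_space \<Rightarrow> 'a \<Rightarrow> real" where
  "bump_deriv r z h = - 4 * max 0 (r\<^sup>2 - z \<bullet> z) * (z \<bullet> h)"

lemma inner_self_less_iff: "r > 0 \<Longrightarrow> z \<bullet> z < r\<^sup>2 \<longleftrightarrow> norm z < r"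
  unfolding dot_square_norm
  by (auto intro: power_strict_mono power2_less_imp_less)

lemma bump_nonneg [simp]: "0 \<le> bump r z"
  by (simp add: bump_def)

lemma bump_minus [simp]: "bump r (- z) = bump r z"
  by (simp add: bump_def)

lemma bump_commute: "bump r (x - y) = bump r (y - x)"
  by (metis bump_minus minus_diff_eq)

lemma bump_outside: "r > 0 \<Longrightarrow> norm z \<ge> r \<Longrightarrow> bump r z = 0"
  using inner_self_less_iff[of r z] by (simp add: bump_def max_def)

lemma bump_deriv_outside: "r > 0 \<Longrightarrow> norm z \<ge> r \<Longrightarrow> bump_deriv r z h = 0"
  using inner_self_less_iff[of r z] by (simp add: bump_deriv_def max_def)

lemma bump_le: "r > 0 \<Longrightarrow> bump r z \<le> r ^ 4"
proof -
  assume "r > 0"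
  have "(max 0 (r\<^sup>2 - z \<bullet> z))\<^sup>2 \<le> (r\<^sup>2)\<^sup>2" by (intro power_mono) auto
  then show ?thesis by (simp add: bump_def flip: power_mult)
qed

lemma bump_deriv_le: "r > 0 \<Longrightarrow> \<bar>bump_deriv r z h\<bar> \<le> 4 * r ^ 3 * norm h"
proof (cases "norm z < r")
  case True
  assume r: "r > 0"
  have "\<bar>max 0 (r\<^sup>2 - z \<bullet> z)\<bar> * \<bar>z \<bullet> h\<bar> \<le> r\<^sup>2 * (r * norm h)"
  proof (intro mult_mono)
    have "\<bar>z \<bullet> h\<bar> \<le> norm z * norm h" by (rule Cauchy_Schwarz_ineq2)
    also have "\<dots> \<le> r * norm h" using True by (intro mult_right_mono) auto
    finally show "\<bar>z \<bullet> h\<bar> \<le> r * norm h" .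
  qed auto
  then show ?thesis by (simp add: bump_deriv_def abs_mult power2_eq_square power3_eq_cube mult.assoc)
next
  case False
  assume r: "r > 0"
  then show ?thesis using bump_deriv_outside[of r z h] False by simp
qed

lemma continuous_bump [continuous_intros]:
  "continuous_on S f \<Longrightarrow> continuous_on S (\<lambda>x. bump r (f x))"
  unfolding bump_def by (intro continuous_intros)

lemma continuous_bump_deriv [continuous_intros]:
  "continuous_on S f \<Longrightarrow> continuous_on S g \<Longrightarrow> continuous_on S (\<lambda>x. bump_deriv r (f x) (g x))"
  unfolding bump_deriv_def by (intro continuous_intros)

lemma linear_bump_deriv: "bounded_linear (bump_deriv r z)"
  unfolding bump_deriv_def by (intro bounded_linear_const_mult bounded_linear_inner_right)

lemma bump_measurable [measurable]: "bump r \<in> borel_measurable borel"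
  by (intro borel_measurable_continuous_onI continuous_intros)

text \<open>The bound is quadratic in \<open>h\<close> and uniform in \<open>z\<close>, so it can be
  integrated against any integrable function; this is how mollification is differentiated.\<close>

lemma bump_remainder:
  fixes z h :: "'a::euclidean_space"
  assumes r: "r > 0" and h: "norm h \<le> 1"
  shows "\<bar>bump r (z + h) - bump r z - bump_deriv r z h\<bar> \<le> ((2 * r + 3)\<^sup>2 + 2 * r\<^sup>2) * (norm h)\<^sup>2"
proof (cases "norm z \<ge> r + 1")
  case True
  have "norm (z + h) \<ge> norm z - norm h" using norm_diff_ineq by auto
  then have "norm (z + h) \<ge> r" using True h by linarith
  then show ?thesis using True r by (simp add: bump_outside bump_deriv_outside)
next
  case False
  define t where "t = r\<^sup>2 - z \<bullet> z"
  define k where "k = - 2 * (z \<bullet> h) - h \<bullet> h"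
  \<comment> \<open>The function \<open>(max 0 t)\<^sup>2\<close> has derivative
    \<open>2 * max 0 t\<close>, which is Lipschitz with constant 2; hence a Taylor remainder of at
    most \<open>k\<^sup>2\<close>.\<close>
  have sq: "\<bar>(max 0 (t + k))\<^sup>2 - (max 0 t)\<^sup>2 - 2 * max 0 t * k\<bar> \<le> k\<^sup>2"
  proof -
    consider "0 \<le> t" "0 \<le> t + k" | "0 \<le> t" "t + k < 0" | "t < 0" "0 \<le> t + k" | "t < 0" "t + k < 0"
      by linarith
    then show ?thesis
    proof cases
      case 1
      then show ?thesis by (simp add: max_def power2_sum)
    next
      case 2
      then have "t * (2 * k + t) \<le> 0" by (intro mult_nonneg_nonpos) auto
      then have "t\<^sup>2 + 2 * t * k \<le> 0" by (simp add: algebra_simps power2_eq_square)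
      moreover have "0 \<le> (k + t)\<^sup>2" by simp
      then have "- t\<^sup>2 - 2 * t * k \<le> k\<^sup>2" by (simp add: power2_sum algebra_simps)
      moreover have "0 \<le> k\<^sup>2" by simp
      ultimately have "\<bar>0 - t\<^sup>2 - 2 * t * k\<bar> \<le> k\<^sup>2" by linarith
      then show ?thesis using 2 by (simp add: max_def)
    next
      case 3
      then have "(t + k)\<^sup>2 \<le> k\<^sup>2" by (intro power_mono) auto
      then show ?thesis using 3 by (simp add: max_def)
    qed (simp add: max_def)
  qed
  \<comment> \<open>\<open>2 * r + 3\<close> is \<open>2 * (r + 1) + 1\<close>, from
    \<open>norm z < r + 1\<close> and \<open>h \<bullet> h \<le> norm h\<close>.\<close>
  have kb: "\<bar>k\<bar> \<le> (2 * r + 3) * norm h"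
  proof -
    have "\<bar>z \<bullet> h\<bar> \<le> norm z * norm h" by (rule Cauchy_Schwarz_ineq2)
    also have "\<dots> \<le> (r + 1) * norm h" using False by (intro mult_right_mono) auto
    finally have 1: "\<bar>z \<bullet> h\<bar> \<le> (r + 1) * norm h" .
    have 2: "h \<bullet> h \<le> norm h" using h by (simp add: dot_square_norm power2_eq_square mult_left_le)
    have "0 \<le> h \<bullet> h" by simp
    then have "\<bar>k\<bar> \<le> 2 * \<bar>z \<bullet> h\<bar> + h \<bullet> h" unfolding k_def by linarith
    moreover have "(2 * r + 3) * norm h = 2 * ((r + 1) * norm h) + norm h" by (simp add: algebra_simps)
    ultimately show ?thesis using 1 2 by linarith
  qed
  have "bump r (z + h) - bump r z - bump_deriv r z h
      = ((max 0 (t + k))\<^sup>2 - (max 0 t)\<^sup>2 - 2 * max 0 t * k) - 2 * max 0 t * (h \<bullet> h)"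
    by (simp add: bump_def bump_deriv_def t_def k_def inner_add_left inner_add_right inner_commute algebra_simps)
  then have "\<bar>bump r (z + h) - bump r z - bump_deriv r z h\<bar> \<le> k\<^sup>2 + 2 * max 0 t * (h \<bullet> h)"
  proof -
    have "0 \<le> 2 * max 0 t * (h \<bullet> h)" by simp
    then show ?thesis using sq \<open>bump r (z + h) - bump r z - bump_deriv r z h = _\<close> by linarith
  qed
  also have "k\<^sup>2 \<le> ((2 * r + 3) * norm h)\<^sup>2" using kb by (metis abs_ge_zero power2_abs power_mono)
  also have "2 * max 0 t * (h \<bullet> h) \<le> 2 * r\<^sup>2 * (norm h)\<^sup>2"
    unfolding dot_square_norm by (intro mult_mono) (auto simp: t_def)
  finally show ?thesis unfolding power_mult_distrib distrib_right[of "(2 * r + 3)\<^sup>2"] by simp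
qed

lemma has_derivative_bump: "(bump r has_derivative bump_deriv r z) (at z)" if "r > 0"
  unfolding has_derivative_at
proof
  let ?C = "(2 * r + 3)\<^sup>2 + 2 * r\<^sup>2"
  show "(\<lambda>h. norm (bump r (z + h) - bump r z - bump_deriv r z h) / norm h) \<midarrow>0\<rightarrow> 0"
  proof (rule Lim_null_comparison)
    show "\<forall>\<^sub>F h in at 0. norm (norm (bump r (z + h) - bump r z - bump_deriv r z h) / norm h) \<le> ?C * norm h"
      unfolding eventually_at
    proof (intro exI[of _ 1] conjI ballI impI)
      fix h :: 'a assume h: "h \<noteq> 0 \<and> dist h 0 < 1"
      have "\<bar>bump r (z + h) - bump r z - bump_deriv r z h\<bar> \<le> ?C * (norm h)\<^sup>2"
        using h by (intro bump_remainder that) auto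
      then have "\<bar>bump r (z + h) - bump r z - bump_deriv r z h\<bar> / norm h \<le> ?C * norm h"
        using h by (simp add: divide_le_eq power2_eq_square mult.assoc)
      then show "norm (norm (bump r (z + h) - bump r z - bump_deriv r z h) / norm h) \<le> ?C * norm h" by simp
    qed simp
    show "((\<lambda>h. ?C * norm h) \<longlongrightarrow> 0) (at (0::'a))"
      by (intro tendsto_mult_right_zero tendsto_norm_zero tendsto_ident_at)
  qed
qed (rule linear_bump_deriv)

text \<open>Measurability of \<open>f\<close> is not assumed: integrability on either side implies
  it, and when both sides fail to be integrable both integrals have the default value 0.\<close>

lemma lborel_integral_shift:
  fixes f :: "'a::euclidean_space \<Rightarrow> 'b::{banach,second_countable_topology}"
  shows "(LINT y|lborel. f (y + a)) = (LINT y|lborel. f y)" (is ?A)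
    "integrable lborel (\<lambda>y. f (y + a)) \<longleftrightarrow> integrable lborel f" (is ?B)
proof -
  have 1: "integrable lborel (\<lambda>y. f (y + a)) = integrable lborel f"
    "(LINT y|lborel. f (y + a)) = (LINT y|lborel. f y)" if m: "f \<in> borel_measurable borel"
  proof -
    have "integrable (distr lborel borel ((+) a)) f = integrable lborel (\<lambda>y. f (a + y))"
      using m by (intro integrable_distr_eq) auto
    then show "integrable lborel (\<lambda>y. f (y + a)) = integrable lborel f"
      by (simp add: lborel_distr_plus add.commute)
    have "(LINT y|distr lborel borel ((+) a). f y) = (LINT y|lborel. f (a + y))"
      using m by (intro integral_distr) auto
    then show "(LINT y|lborel. f (y + a)) = (LINT y|lborel. f y)"
      by (simp add: lborel_distr_plus add.commute)
  qed
  have 2: "f \<in> borel_measurable borel" if "integrable lborel (\<lambda>y. f (y + a))"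
  proof -
    have "(\<lambda>y. f (y + a)) \<in> borel_measurable borel"
      using borel_measurable_integrable[OF that] by simp
    then have "(\<lambda>x. (\<lambda>y. f (y + a)) (x - a)) \<in> borel_measurable borel"
      by (rule measurable_compose[rotated]) simp
    then show ?thesis by simp
  qed
  have 3: "f \<in> borel_measurable borel" if "integrable lborel f"
    using borel_measurable_integrable[OF that] by simp
  show ?B using 1(1) 2 3 by blast
  then show ?A
    using 1(2) 3 by (cases "integrable lborel f") (blast, simp add: not_integrable_integral_eq)
qed

lemma bump_integrable [simp]:
  "r > 0 \<Longrightarrow> integrable lborel (bump r)"
  by (rule continuous_compact_support_integrable[of _ r]) (auto intro!: continuous_intros bump_outside)

text \<open>The type argument carries the dimension of the space, on which the mass depends.\<close>

definition bump_mass :: "real \<Rightarrow> 'a::euclidean_space itself \<Rightarrow> real" where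
  "bump_mass r _ = (LINT y::'a|lborel. bump r y)"

lemma bump_mass_pos: "r > 0 \<Longrightarrow> bump_mass r TYPE('a::euclidean_space) > 0"
proof -
  assume r: "r > 0"
  have "(LINT y::'a|lborel. bump r y) \<noteq> 0"
  proof
    assume "(LINT y::'a|lborel. bump r y) = 0"
    then have "AE y::'a in lborel. bump r y = 0"
      using r by (subst (asm) integral_nonneg_eq_0_iff_AE) auto
    moreover have "AE y::'a in lborel. y \<in> ball 0 r \<longrightarrow> bump r y \<noteq> 0"
      using iffD2[OF inner_self_less_iff[OF r]] by (intro AE_I2) (fastforce simp: bump_def max_def)
    ultimately have "AE y::'a in lborel. y \<notin> ball 0 r" by eventually_elim auto
    then have "emeasure lborel (ball (0::'a) r) = 0"
      by (subst (asm) AE_iff_null_sets[symmetric]) (auto simp: null_sets_def)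
    moreover have "emeasure lborel (ball (0::'a) r) > 0"
    proof -
      have "measure lborel (ball (0::'a) r) > 0" using content_ball_pos[OF r] by simp
      then show ?thesis by (auto simp: measure_def zero_less_iff_neq_zero)
    qed
    ultimately show False by simp
  qed
  then show ?thesis unfolding bump_mass_def by (simp add: less_le)
qed

section \<open>Mollification by the normalised bump\<close>

definition mollify :: "real \<Rightarrow> ('a::euclidean_space \<Rightarrow> 'b::{banach,second_countable_topology}) \<Rightarrow> 'a \<Rightarrow> 'b" where
  "mollify r f x = (LINT y|lborel. (bump r (x - y) / bump_mass r TYPE('a)) *\<^sub>R f y)"

definition mollify_deriv :: "real \<Rightarrow> ('a::euclidean_space \<Rightarrow> 'b::{banach,second_countable_topology}) \<Rightarrow> 'a \<Rightarrow> 'a \<Rightarrow> 'b" where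
  "mollify_deriv r f x h = (LINT y|lborel. (bump_deriv r (x - y) h / bump_mass r TYPE('a)) *\<^sub>R f y)"

lemma kernel_measurable [measurable]:
  "(\<lambda>y. bump r (x - y)) \<in> borel_measurable borel" "(\<lambda>y. bump_deriv r (x - y) h) \<in> borel_measurable borel"
  by (intro borel_measurable_continuous_onI continuous_intros)+

context
  fixes r :: real and f :: "'a::euclidean_space \<Rightarrow> 'b::{banach,second_countable_topology}"
  assumes r: "r > 0" and f: "integrable lborel f"
begin

private lemma mass: "bump_mass r TYPE('a) > 0" by (rule bump_mass_pos[OF r])

lemma mollify_integrable: "integrable lborel (\<lambda>y. (bump r (x - y) / bump_mass r TYPE('a)) *\<^sub>R f y)"
  using mass bump_le[OF r]
  by (intro integrable_bounded_mult[OF f, where B = "r ^ 4 / bump_mass r TYPE('a)"]) (auto intro!: divide_right_mono)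

lemma mollify_deriv_integrable: "integrable lborel (\<lambda>y. (bump_deriv r (x - y) h / bump_mass r TYPE('a)) *\<^sub>R f y)"
  using mass bump_deriv_le[OF r]
  by (intro integrable_bounded_mult[OF f, where B = "4 * r ^ 3 * norm h / bump_mass r TYPE('a)"]) (auto intro!: divide_right_mono)

text \<open>The quadratic remainder of the kernel is uniform in its argument, so integrating it
  against \<open>norm (f y)\<close> bounds the remainder of the mollification by a multiple of
  \<open>(norm h)\<^sup>2\<close>.\<close>

lemma has_derivative_mollify: "(mollify r f has_derivative mollify_deriv r f x) (at x)"
  unfolding has_derivative_at
proof
  let ?m = "bump_mass r TYPE('a)"
  let ?C = "((2 * r + 3)\<^sup>2 + 2 * r\<^sup>2) / ?m * (LINT y|lborel. norm (f y))"
  show "bounded_linear (mollify_deriv r f x)"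
  proof (rule bounded_linear_intro)
    fix h k :: 'a and c :: real
    interpret b: bounded_linear "bump_deriv r z" for z :: 'a by (rule linear_bump_deriv)
    show "mollify_deriv r f x (h + k) = mollify_deriv r f x h + mollify_deriv r f x k"
      unfolding mollify_deriv_def
      by (subst Bochner_Integration.integral_add[symmetric, OF mollify_deriv_integrable mollify_deriv_integrable])
         (simp add: b.add add_divide_distrib scaleR_add_left)
    show "mollify_deriv r f x (c *\<^sub>R h) = c *\<^sub>R mollify_deriv r f x h"
      unfolding mollify_deriv_def
      by (subst integral_scaleR_right[symmetric]) (simp add: b.scaleR)
    have "norm (mollify_deriv r f x h) \<le> (LINT y|lborel. norm ((bump_deriv r (x - y) h / ?m) *\<^sub>R f y))"
      unfolding mollify_deriv_def by (rule integral_norm_bound)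
    also have "\<dots> \<le> (LINT y|lborel. 4 * r ^ 3 * norm h / ?m * norm (f y))"
      using mollify_deriv_integrable f bump_deriv_le[OF r] mass
      by (intro integral_mono integrable_norm) (auto intro!: mult_right_mono divide_right_mono)
    finally show "norm (mollify_deriv r f x h) \<le> norm h * (4 * r ^ 3 / ?m * (LINT y|lborel. norm (f y)))"
      by (simp add: mult_ac)
  qed
  show "(\<lambda>h. norm (mollify r f (x + h) - mollify r f x - mollify_deriv r f x h) / norm h) \<midarrow>0\<rightarrow> 0"
  proof (rule Lim_null_comparison)
    have bnd: "norm (mollify r f (x + h) - mollify r f x - mollify_deriv r f x h) \<le> ?C * (norm h)\<^sup>2"
      if "norm h \<le> 1" for h
    proof -
      have i: "integrable lborel (\<lambda>y. ((bump r (x + h - y) - bump r (x - y) - bump_deriv r (x - y) h) / ?m) *\<^sub>R f y)"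
        using Bochner_Integration.integrable_diff[OF Bochner_Integration.integrable_diff[OF mollify_integrable[of "x + h"]
          mollify_integrable[of x]] mollify_deriv_integrable[of x h]]
        by (simp add: diff_divide_distrib scaleR_diff_left)
      have eq: "mollify r f (x + h) - mollify r f x - mollify_deriv r f x h =
        (LINT y|lborel. ((bump r (x + h - y) - bump r (x - y) - bump_deriv r (x - y) h) / ?m) *\<^sub>R f y)"
        unfolding mollify_def mollify_deriv_def
        using mollify_integrable mollify_deriv_integrable
        by (simp add: diff_divide_distrib scaleR_diff_left)
      have "norm (mollify r f (x + h) - mollify r f x - mollify_deriv r f x h) \<le> (LINT y|lborel. norm (((bump r (x + h - y) - bump r (x - y) - bump_deriv r (x - y) h) / ?m) *\<^sub>R f y))"
        unfolding eq by (rule integral_norm_bound)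
      also have "\<dots> \<le> (LINT y|lborel. ((2 * r + 3)\<^sup>2 + 2 * r\<^sup>2) * (norm h)\<^sup>2 / ?m * norm (f y))"
      proof (rule integral_mono)
        show "norm (((bump r (x + h - y) - bump r (x - y) - bump_deriv r (x - y) h) / ?m) *\<^sub>R f y)
          \<le> ((2 * r + 3)\<^sup>2 + 2 * r\<^sup>2) * (norm h)\<^sup>2 / ?m * norm (f y)" for y
        proof -
          have "\<bar>bump r (x + h - y) - bump r (x - y) - bump_deriv r (x - y) h\<bar> \<le> ((2 * r + 3)\<^sup>2 + 2 * r\<^sup>2) * (norm h)\<^sup>2"
            using bump_remainder[OF r that, of "x - y"] unfolding diff_add_eq .
          then show ?thesis unfolding norm_scaleR real_norm_def abs_divide
            using mass by (intro mult_right_mono frac_le) auto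
        qed
      qed (use integrable_norm[OF i] f in auto)
      finally show ?thesis by (simp add: mult_ac)
    qed
    show "\<forall>\<^sub>F h in at 0. norm (norm (mollify r f (x + h) - mollify r f x - mollify_deriv r f x h) / norm h) \<le> ?C * norm h"
      unfolding eventually_at
    proof (intro exI[of _ 1] conjI ballI impI)
      fix h :: 'a assume h: "h \<noteq> 0 \<and> dist h 0 < 1"
      have "norm (mollify r f (x + h) - mollify r f x - mollify_deriv r f x h) / norm h \<le> ?C * (norm h)\<^sup>2 / norm h"
        using h by (intro divide_right_mono bnd) auto
      also have "\<dots> = ?C * norm h" using h by (simp add: power2_eq_square)
      finally have "norm (mollify r f (x + h) - mollify r f x - mollify_deriv r f x h) / norm h \<le> ?C * norm h" .
      then show "norm (norm (mollify r f (x + h) - mollify r f x - mollify_deriv r f x h) / norm h) \<le> ?C * norm h" by simp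
    qed simp
    show "((\<lambda>h. ?C * norm h) \<longlongrightarrow> 0) (at (0::'a))"
      by (intro tendsto_mult_right_zero tendsto_norm_zero tendsto_ident_at)
  qed
qed

lemma continuous_mollify: "continuous_on S (mollify r f)"
  using has_derivative_mollify by (meson continuous_at_imp_continuous_on has_derivative_continuous)

lemma continuous_mollify_deriv: "continuous_on S (\<lambda>x. mollify_deriv r f x h)"
proof (rule continuous_at_imp_continuous_on, rule ballI, subst continuous_at_sequentially, intro allI impI)
  let ?m = "bump_mass r TYPE('a)"
  fix x X assume "X \<longlonglongrightarrow> (x::'a)"
  show "((\<lambda>x. mollify_deriv r f x h) \<circ> X) \<longlonglongrightarrow> mollify_deriv r f x h"
    unfolding comp_def mollify_deriv_def
  proof (rule integral_dominated_convergence[where w = "\<lambda>y. 4 * r ^ 3 * norm h / ?m * norm (f y)"])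
    have *: "(\<lambda>i. bump_deriv r (X i - y) h) \<longlonglongrightarrow> bump_deriv r (x - y) h" for y
      by (rule continuous_on_tendsto_compose[where s = UNIV and f = "\<lambda>x. bump_deriv r (x - y) h"])
        (auto intro!: continuous_intros \<open>X \<longlonglongrightarrow> x\<close>)
    show "AE y in lborel. (\<lambda>i. (bump_deriv r (X i - y) h / ?m) *\<^sub>R f y) \<longlonglongrightarrow> (bump_deriv r (x - y) h / ?m) *\<^sub>R f y"
      by (intro AE_I2 tendsto_intros *) (rule less_imp_neq[OF mass, symmetric])
    show "AE y in lborel. norm ((bump_deriv r (X i - y) h / ?m) *\<^sub>R f y) \<le> 4 * r ^ 3 * norm h / ?m * norm (f y)" for i
      using bump_deriv_le[OF r] mass by (intro AE_I2) (auto intro!: mult_right_mono divide_right_mono)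
  qed (use f mollify_deriv_integrable in \<open>auto dest!: borel_measurable_integrable\<close>)
qed

lemma mollify_eq_0: "mollify r f x = 0" if "\<And>y. dist x y < r \<Longrightarrow> f y = 0"
proof -
  have "(bump r (x - y) / bump_mass r TYPE('a)) *\<^sub>R f y = 0" for y
    using that[of y] bump_outside[OF r, of "x - y"] by (cases "dist x y < r") (auto simp: dist_norm)
  then have "(LINT y|lborel. (bump r (x - y) / bump_mass r TYPE('a)) *\<^sub>R f y) = (LINT y::'a|lborel. 0)"
    by (intro Bochner_Integration.integral_cong) auto
  then show ?thesis unfolding mollify_def by simp
qed

end

lemma kernel_integral:
  fixes x :: "'a::euclidean_space"
  assumes "r > 0"
  shows "(LINT y|lborel. bump r (x - y) / bump_mass r TYPE('a)) = 1"
    "integrable lborel (\<lambda>y. bump r (x - y) / bump_mass r TYPE('a))"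
    "(LINT z|lborel. bump r (z - x) / bump_mass r TYPE('a)) = 1"
    "integrable lborel (\<lambda>z. bump r (z - x) / bump_mass r TYPE('a))"
proof -
  have 1: "integrable lborel (\<lambda>z. bump r (z - x))" "(LINT z|lborel. bump r (z - x)) = bump_mass r TYPE('a)"
    using lborel_integral_shift[of "bump r" "- x"] assms by (auto simp: bump_mass_def)
  show "(LINT z|lborel. bump r (z - x) / bump_mass r TYPE('a)) = 1"
    "integrable lborel (\<lambda>z. bump r (z - x) / bump_mass r TYPE('a))"
    using 1 bump_mass_pos[OF assms, where 'a='a] by auto
  then show "(LINT y|lborel. bump r (x - y) / bump_mass r TYPE('a)) = 1"
    "integrable lborel (\<lambda>y. bump r (x - y) / bump_mass r TYPE('a))"
    by (simp_all add: bump_commute[of r x])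
qed

text \<open>An average over values within \<open>e\<close> of \<open>c\<close> stays within
  \<open>e\<close> of \<open>c\<close>. Continuity bounds, Lipschitz bounds and regions of constancy
  all pass to mollifications through this one statement.\<close>

lemma mollify_near:
  fixes f :: "'a::euclidean_space \<Rightarrow> 'b::{banach,second_countable_topology}"
  assumes r: "r > 0" and f: "integrable lborel f" and e: "\<And>y. dist x y < r \<Longrightarrow> norm (f y - c) \<le> e"
  shows "norm (mollify r f x - c) \<le> e"
proof -
  let ?k = "\<lambda>y. bump r (x - y) / bump_mass r TYPE('a)"
  note m = bump_mass_pos[OF r, where 'a='a]
  have i: "integrable lborel (\<lambda>y. ?k y *\<^sub>R f y)" by (rule mollify_integrable[OF r f])
  have j: "integrable lborel (\<lambda>y. ?k y *\<^sub>R c)" using kernel_integral(2)[OF r] by (intro integrable_scaleR_left) auto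
  have "mollify r f x - c = (LINT y|lborel. ?k y *\<^sub>R (f y - c))"
    unfolding mollify_def using i j kernel_integral[OF r, of x] by (simp add: scaleR_diff_right)
  also have "norm \<dots> \<le> (LINT y|lborel. norm (?k y *\<^sub>R (f y - c)))" by (rule integral_norm_bound)
  also have "\<dots> \<le> (LINT y|lborel. ?k y * e)"
  proof (rule integral_mono)
    show "integrable lborel (\<lambda>y. norm (?k y *\<^sub>R (f y - c)))"
      using Bochner_Integration.integrable_diff[OF i j] by (intro integrable_norm) (simp add: scaleR_diff_right)
    show "integrable lborel (\<lambda>y. ?k y * e)" using kernel_integral(2)[OF r] by (intro integrable_mult_left) auto
    show "norm (?k y *\<^sub>R (f y - c)) \<le> ?k y * e" for y
    proof -
      have k0: "0 \<le> ?k y" using m by simp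
      have "?k y * norm (f y - c) \<le> ?k y * e"
      proof (cases "dist x y < r")
        case True
        then show ?thesis using k0 e[of y] by (intro mult_left_mono) auto
      next
        case False
        then show ?thesis using bump_outside[OF r, of "x - y"] by (simp add: dist_norm)
      qed
      then show ?thesis by (simp only: norm_scaleR real_norm_def abs_of_nonneg[OF k0])
    qed
  qed
  also have "\<dots> = e" using kernel_integral[OF r, of x] by (simp only: integral_mult_left_zero mult_1)
  finally show ?thesis .
qed

lemma mollify_diff:
  assumes "r > 0" "integrable lborel f" "integrable lborel g"
  shows "mollify r (\<lambda>x. f x - g x) x = mollify r f x - mollify r g x"
  unfolding mollify_def using mollify_integrable[OF assms(1,2)] mollify_integrable[OF assms(1,3)]
  by (simp add: scaleR_diff_right)

lemma mollify_shift:
  fixes f :: "'a::euclidean_space \<Rightarrow> 'b::{banach,second_countable_topology}"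
  shows "mollify r f (x + a) = mollify r (\<lambda>y. f (y + a)) x"
  unfolding mollify_def
  using lborel_integral_shift(1)[of "\<lambda>y. (bump r (x + a - y) / bump_mass r TYPE('a)) *\<^sub>R f y" a]
  by simp

text \<open>Jensen's inequality for the probability kernel, obtained from the nonnegativity of the
  variance of \<open>f\<close> about its mean \<open>mollify r f x\<close>.\<close>

lemma mollify_sq_le:
  fixes f :: "'a::euclidean_space \<Rightarrow> complex"
  assumes r: "r > 0" and f: "sq_int f" "integrable lborel f"
  shows "(cmod (mollify r f x))\<^sup>2 \<le> (LINT y|lborel. bump r (x - y) / bump_mass r TYPE('a) * (cmod (f y))\<^sup>2)"
proof -
  let ?k = "\<lambda>y. bump r (x - y) / bump_mass r TYPE('a)"
  let ?m = "mollify r f x"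
  note m = bump_mass_pos[OF r, where 'a='a]
  have i: "integrable lborel (\<lambda>y. ?k y *\<^sub>R f y)" by (rule mollify_integrable[OF r f(2)])
  have j: "integrable lborel (\<lambda>y. ?k y * (cmod (f y))\<^sup>2)"
    using mollify_integrable[OF r, of "\<lambda>y. (cmod (f y))\<^sup>2"] f by simp
  have eq: "?k y * (cmod (f y - ?m))\<^sup>2 = ?k y * (cmod (f y))\<^sup>2 - 2 * Re (cnj ?m * (?k y *\<^sub>R f y)) + ?k y * (cmod ?m)\<^sup>2" for y
    unfolding cmod_power2 by (simp add: power2_eq_square algebra_simps scaleR_conv_of_real flip: of_real_divide)
  have "0 \<le> (LINT y|lborel. ?k y * (cmod (f y - ?m))\<^sup>2)"
    using m by (intro integral_nonneg_AE AE_I2) auto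
  also have "\<dots> = (LINT y|lborel. ?k y * (cmod (f y))\<^sup>2) - 2 * Re (cnj ?m * ?m) + (cmod ?m)\<^sup>2"
  proof -
    have 1: "integrable lborel (\<lambda>y. cnj ?m * (?k y *\<^sub>R f y))" using i by (intro integrable_mult_right)
    have 2: "(LINT y|lborel. cnj ?m * (?k y *\<^sub>R f y)) = cnj ?m * ?m"
      unfolding mollify_def by (rule integral_mult_right_zero)
    have 3: "integrable lborel (\<lambda>y. 2 * Re (cnj ?m * (?k y *\<^sub>R f y)))"
      by (rule integrable_mult_right[OF integrable_Re[OF 1]])
    have 4: "integrable lborel (\<lambda>y. ?k y * (cmod ?m)\<^sup>2)"
      using kernel_integral(2)[OF r] by (intro integrable_mult_left) auto
    have 5: "(LINT y|lborel. ?k y * (cmod ?m)\<^sup>2) = (cmod ?m)\<^sup>2"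
      using kernel_integral(1)[OF r, of x] by (simp only: integral_mult_left_zero mult_1)
    show ?thesis unfolding eq
      by (simp only: Bochner_Integration.integral_add[OF Bochner_Integration.integrable_diff[OF j 3] 4]
         Bochner_Integration.integral_diff[OF j 3] integral_mult_right_zero[where c="2::real"] integral_Re[OF 1] 2 5)
  qed
  also have "Re (cnj ?m * ?m) = (cmod ?m)\<^sup>2" unfolding cmod_power2 by (simp add: power2_eq_square)
  finally show ?thesis by simp
qed

text \<open>Jensen's inequality pointwise, then Tonelli: the kernel has integral 1 in either
  variable.\<close>

lemma mollify_contraction:
  fixes f :: "'a::euclidean_space \<Rightarrow> complex"
  assumes r: "r > 0" and f: "sq_int f" "integrable lborel f"
  shows "sq_int (mollify r f)" "(LINT x|lborel. (cmod (mollify r f x))\<^sup>2) \<le> (LINT x|lborel. (cmod (f x))\<^sup>2)"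
proof -
  let ?k = "\<lambda>x y. bump r (x - y) / bump_mass r TYPE('a)"
  note m = bump_mass_pos[OF r, where 'a='a]
  have [measurable]: "f \<in> borel_measurable borel" using f by simp
  have mm: "mollify r f \<in> borel_measurable borel"
    by (intro borel_measurable_continuous_onI continuous_mollify r f)
  have km: "(\<lambda>(x,y). ?k x y) \<in> borel_measurable (borel \<Otimes>\<^sub>M borel)"
    unfolding borel_prod
    using m by (intro borel_measurable_continuous_onI) (auto intro!: continuous_intros simp: case_prod_unfold)
  have [measurable]: "(\<lambda>(x,y). ennreal (?k x y) * ennreal ((cmod (f y))\<^sup>2)) \<in> borel_measurable (lborel \<Otimes>\<^sub>M lborel)"
    using km by (simp add: case_prod_unfold)
  have b: "ennreal ((cmod (mollify r f x))\<^sup>2) \<le> (\<integral>\<^sup>+ y. ennreal (?k x y) * ennreal ((cmod (f y))\<^sup>2) \<partial>lborel)" for x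
  proof -
    have j: "integrable lborel (\<lambda>y. ?k x y * (cmod (f y))\<^sup>2)"
      using mollify_integrable[OF r, of "\<lambda>y. (cmod (f y))\<^sup>2"] f by simp
    have "ennreal ((cmod (mollify r f x))\<^sup>2) \<le> ennreal (LINT y|lborel. ?k x y * (cmod (f y))\<^sup>2)"
      by (intro ennreal_leI mollify_sq_le assms)
    also have "\<dots> = (\<integral>\<^sup>+ y. ennreal (?k x y * (cmod (f y))\<^sup>2) \<partial>lborel)"
      using m by (intro nn_integral_eq_integral[OF j, symmetric] AE_I2) auto
    also have "\<dots> = (\<integral>\<^sup>+ y. ennreal (?k x y) * ennreal ((cmod (f y))\<^sup>2) \<partial>lborel)"
      using m by (intro nn_integral_cong ennreal_mult) auto
    finally show ?thesis .
  qed
  have "(\<integral>\<^sup>+ x. ennreal ((cmod (mollify r f x))\<^sup>2) \<partial>lborel) \<le>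
    (\<integral>\<^sup>+ x. (\<integral>\<^sup>+ y. ennreal (?k x y) * ennreal ((cmod (f y))\<^sup>2) \<partial>lborel) \<partial>lborel)"
    by (intro nn_integral_mono b)
  also have "\<dots> = (\<integral>\<^sup>+ y. (\<integral>\<^sup>+ x. ennreal (?k x y) * ennreal ((cmod (f y))\<^sup>2) \<partial>lborel) \<partial>lborel)"
    by (rule lborel_pair.Fubini'[symmetric]) simp
  also have "\<dots> = (\<integral>\<^sup>+ y. ennreal ((cmod (f y))\<^sup>2) \<partial>lborel)"
  proof (rule nn_integral_cong)
    fix y :: 'a
    have "(\<integral>\<^sup>+ x. ennreal (?k x y) \<partial>lborel) = ennreal (LINT x|lborel. ?k x y)"
      using m by (intro nn_integral_eq_integral kernel_integral(4)[OF r] AE_I2) auto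
    then have "(\<integral>\<^sup>+ x. ennreal (?k x y) \<partial>lborel) = 1"
      using kernel_integral(3)[OF r, of y] by simp
    then show "(\<integral>\<^sup>+ x. ennreal (?k x y) * ennreal ((cmod (f y))\<^sup>2) \<partial>lborel) = ennreal ((cmod (f y))\<^sup>2)"
      by (subst nn_integral_multc) auto
  qed
  also have "\<dots> = ennreal (LINT x|lborel. (cmod (f x))\<^sup>2)"
    using f by (intro nn_integral_eq_integral) auto
  finally have le: "(\<integral>\<^sup>+ x. ennreal ((cmod (mollify r f x))\<^sup>2) \<partial>lborel) \<le> ennreal (LINT x|lborel. (cmod (f x))\<^sup>2)" .
  have i: "integrable lborel (\<lambda>x. (cmod (mollify r f x))\<^sup>2)"
    using mm le by (intro integrableI_bounded) (auto simp: less_top[symmetric] top_unique)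
  show "sq_int (mollify r f)" unfolding sq_int_def using mm i by simp
  show "(LINT x|lborel. (cmod (mollify r f x))\<^sup>2) \<le> (LINT x|lborel. (cmod (f x))\<^sup>2)"
    using le nn_integral_eq_integral[OF i] by (simp add: integral_nonneg_AE)
qed

text \<open>The distance from \<open>mollify (r n) f\<close> to \<open>f\<close> is split through a
  continuous \<open>g\<close> of bounded support: the two pieces with \<open>f - g\<close> are
  controlled by contraction, the middle one by uniform continuity of \<open>g\<close>.\<close>

lemma l2_lim_mollify:
  fixes f :: "'a::euclidean_space \<Rightarrow> complex"
  assumes f: "sq_int f" and supp: "\<And>x. norm x > R \<Longrightarrow> f x = 0"
    and r: "\<And>n. r n > 0" "r \<longlonglongrightarrow> 0"
  shows "l2_lim (\<lambda>n. mollify (r n) f) f"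
  unfolding l2_lim_def
proof (intro conjI allI)
  have fi: "integrable lborel f" by (rule sq_int_integrable[OF f supp])
  have mf: "sq_int (mollify (r n) f)" for n by (rule mollify_contraction[OF r(1) f fi])
  then show "sq_int (mollify (r n) f)" for n .
  show "sq_int f" by fact
  show "(\<lambda>n. LINT x|lborel. (cmod (mollify (r n) f x - f x))\<^sup>2) \<longlonglongrightarrow> 0"
  proof (rule LIMSEQ_I)
    fix e :: real assume e: "e > 0"
    have "\<exists>g. continuous_on UNIV g \<and> (\<forall>x. norm x > R + 1 \<longrightarrow> g x = 0) \<and> (LINT x|lborel. (cmod (f x - g x))\<^sup>2) < e / 16"
    proof (rule sq_int_approx_continuous[OF f, where e = "e / 16" and R = R])
      show "f x = 0" if "norm x > R" for x using supp[OF that] .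
    qed (use e in auto)
    then obtain g where g: "continuous_on UNIV g" "\<And>x. norm x > R + 1 \<Longrightarrow> g x = 0"
      "(LINT x|lborel. (cmod (f x - g x))\<^sup>2) < e / 16"
      by blast
    have gi: "integrable lborel g" "sq_int g"
      using continuous_compact_support_integrable[OF g(1,2)] continuous_compact_support_sq_int[OF g(1,2)] by auto
    define V where "V = measure lborel (cball (0::'a) (R + 2))"
    \<comment> \<open>Chosen so that \<open>\<delta>\<^sup>2 * V \<le> e / 8\<close>. The three
      pieces then add up to less than \<open>4 * e / 16 + 4 * e / 8 + 2 * e / 16\<close>, which is
      \<open>7 / 8 * e\<close>.\<close>
    define \<delta> where "\<delta> = sqrt (e / (8 * (V + 1)))"
    have V: "V \<ge> 0" by (simp add: V_def)
    have d: "\<delta> > 0" using e V by (auto simp: \<delta>_def)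
    have "uniformly_continuous_on (cball 0 (R + 3)) g"
      using g(1) by (intro compact_uniformly_continuous) (auto intro: continuous_on_subset)
    then obtain \<eta> where \<eta>: "\<eta> > 0" "\<And>x y. x \<in> cball 0 (R + 3) \<Longrightarrow> y \<in> cball 0 (R + 3) \<Longrightarrow> dist y x < \<eta> \<Longrightarrow> dist (g y) (g x) < \<delta>"
      using d unfolding uniformly_continuous_on_def by meson
    have "eventually (\<lambda>n. r n < min \<eta> 1) sequentially"
      using r(2) \<eta>(1) by (intro order_tendstoD) auto
    then obtain N where N: "\<And>n. n \<ge> N \<Longrightarrow> r n < min \<eta> 1" by (auto simp: eventually_sequentially)
    have "norm ((LINT x|lborel. (cmod (mollify (r n) f x - f x))\<^sup>2) - 0) < e" if n: "n \<ge> N" for n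
    proof -
      have rn: "r n > 0" "r n < \<eta>" "r n < 1" using r(1)[of n] N[OF n] by auto
      have mg: "sq_int (mollify (r n) g)" by (rule mollify_contraction[OF r(1) gi(2,1)])
      have fg: "sq_int (\<lambda>x. f x - g x)" "integrable lborel (\<lambda>x. f x - g x)"
        using sq_int_diff[OF f gi(2)] fi gi(1) by auto
      have b1: "(LINT x|lborel. (cmod (mollify (r n) f x - mollify (r n) g x))\<^sup>2) < e / 16"
        using mollify_contraction(2)[OF r(1)[of n] fg] g(3) by (simp add: mollify_diff[OF r(1) fi gi(1)])
      have pt: "(cmod (mollify (r n) g x - g x))\<^sup>2 \<le> \<delta>\<^sup>2 * indicator (cball 0 (R + 2)) x" for x
      proof (cases "norm x \<le> R + 2")
        case True
        have "cmod (mollify (r n) g x - g x) \<le> \<delta>"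
        proof (rule mollify_near[OF rn(1) gi(1)])
          fix y assume y: "dist x y < r n"
          have "norm y \<le> norm x + dist x y" using norm_triangle_sub[of y x] by (simp add: dist_norm norm_minus_commute)
          then show "cmod (g y - g x) \<le> \<delta>"
            using \<eta>(2)[of x y] y True rn by (auto simp: dist_norm norm_minus_commute intro: less_imp_le)
        qed
        then show ?thesis using True by (auto intro: power_mono)
      next
        case False
        have "mollify (r n) g x = 0"
        proof (rule mollify_eq_0[OF rn(1) gi(1)])
          fix y assume y: "dist x y < r n"
          have "norm x \<le> norm y + dist x y" using norm_triangle_sub[of x y] by (simp add: dist_norm)
          then show "g y = 0" using g(2)[of y] False y rn by auto
        qed
        then show ?thesis using g(2)[of x] False by simp
      qed
      have ind: "integrable lborel (\<lambda>x. \<delta>\<^sup>2 * indicator (cball (0::'a) (R + 2)) x :: real)"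
        using emeasure_lborel_cball_finite[of 0 "R + 2"]
        by (intro integrable_mult_right integrable_real_indicator) (auto simp: top.not_eq_extremum)
      have b2: "(LINT x|lborel. (cmod (mollify (r n) g x - g x))\<^sup>2) \<le> e / 8"
      proof -
        have "(LINT x|lborel. (cmod (mollify (r n) g x - g x))\<^sup>2) \<le> (LINT x|lborel. \<delta>\<^sup>2 * indicator (cball (0::'a) (R + 2)) x)"
          using pt ind sq_int_diff[OF mg gi(2)] by (intro integral_mono) auto
        also have "\<dots> = \<delta>\<^sup>2 * V" by (simp add: V_def)
        also have "\<dots> \<le> e / 8" using e V by (simp add: \<delta>_def field_simps)
        finally show ?thesis .
      qed
      let ?a = "\<lambda>x. mollify (r n) f x - mollify (r n) g x" and ?b = "\<lambda>x. mollify (r n) g x - g x" and ?c = "\<lambda>x. g x - f x"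
      have s: "sq_int ?a" "sq_int ?b" "sq_int ?c" using mf mg gi f by (auto intro!: sq_int_diff)
      have "(LINT x|lborel. (cmod (mollify (r n) f x - f x))\<^sup>2) \<le>
        (LINT x|lborel. 4 * (cmod (?a x))\<^sup>2 + 4 * (cmod (?b x))\<^sup>2 + 2 * (cmod (?c x))\<^sup>2)"
      proof (rule integral_mono)
        show "(cmod (mollify (r n) f x - f x))\<^sup>2 \<le> 4 * (cmod (?a x))\<^sup>2 + 4 * (cmod (?b x))\<^sup>2 + 2 * (cmod (?c x))\<^sup>2" for x
          using cmod_add_sq_le[of "?a x + ?b x" "?c x"] cmod_add_sq_le[of "?a x" "?b x"] by simp
      qed (use s sq_int_diff[OF mf f] in auto)
      also have "\<dots> = 4 * (LINT x|lborel. (cmod (?a x))\<^sup>2) + 4 * (LINT x|lborel. (cmod (?b x))\<^sup>2) + 2 * (LINT x|lborel. (cmod (?c x))\<^sup>2)"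
        using s by simp
      also have "\<dots> < e"
        using b1 b2 g(3) e by (simp add: norm_minus_commute[of "g _" "f _"])
      finally show ?thesis by simp
    qed
    then show "\<exists>no. \<forall>n\<ge>no. norm ((LINT x|lborel. (cmod (mollify (r n) f x - f x))\<^sup>2) - 0) < e" by blast
  qed
qed

section \<open>Weak gradients\<close>

text \<open>The mean value theorem bounds every quotient by \<open>B\<close>, so dominated
  convergence applies. Differentiability is asked for in the direction \<open>e\<close> only,
  because the integrand of the Hardy argument is merely continuous in the others.\<close>

lemma integral_difference_quotient:
  fixes f f' g :: "'a::euclidean_space \<Rightarrow> real" and e :: 'a and t :: "nat \<Rightarrow> real"
  assumes deriv: "\<And>x. ((\<lambda>t. f (x + t *\<^sub>R e)) has_real_derivative f' x) (at 0)"
    and cont: "continuous_on UNIV f"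
    and bound: "\<And>x. \<bar>f' x\<bar> \<le> B"
    and supp: "\<And>x. norm x > R \<Longrightarrow> f x = 0"
    and t: "t \<longlonglongrightarrow> 0" "\<And>n. t n \<noteq> 0" "\<And>n. \<bar>t n\<bar> \<le> 1"
    and g: "g \<in> borel_measurable borel" "\<And>x. \<bar>g x\<bar> \<le> C"
  shows "integrable lborel (\<lambda>x. f' x * g x)"
    "(\<lambda>n. LINT x|lborel. (f (x + t n *\<^sub>R e) - f x) / t n * g x) \<longlonglongrightarrow> (LINT x|lborel. f' x * g x)"
proof -
  define s where "s n x = (f (x + t n *\<^sub>R e) - f x) / t n" for n x
  have [measurable]: "f \<in> borel_measurable borel" by (rule borel_measurable_continuous_onI[OF cont])
  have [measurable]: "g \<in> borel_measurable borel" by (rule g)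
  have lim: "(\<lambda>n. s n x) \<longlonglongrightarrow> f' x" for x
  proof -
    have "((\<lambda>h. (f (x + h *\<^sub>R e) - f x) / h) \<longlongrightarrow> f' x) (at 0)"
      using deriv[of x] unfolding DERIV_def by simp
    moreover have "filterlim t (at 0) sequentially"
      unfolding filterlim_at using t by (auto intro!: always_eventually)
    ultimately show ?thesis unfolding s_def by (rule filterlim_compose)
  qed
  have sb: "\<bar>s n x\<bar> \<le> B" for n x
  proof -
    have d: "((\<lambda>t. f (x + t *\<^sub>R e)) has_real_derivative f' (x + t *\<^sub>R e)) (at t)" for t
    proof -
      have "((\<lambda>u. f ((x + t *\<^sub>R e) + u *\<^sub>R e)) has_real_derivative f' (x + t *\<^sub>R e)) (at (t - t))"
        using deriv[of "x + t *\<^sub>R e"] by simp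
      then have "((\<lambda>u. f ((x + t *\<^sub>R e) + (u - t) *\<^sub>R e)) has_real_derivative f' (x + t *\<^sub>R e)) (at t)"
        using DERIV_shift[of "\<lambda>u. f ((x + t *\<^sub>R e) + u *\<^sub>R e)" _ t "- t"] by simp
      then show ?thesis by (simp add: algebra_simps)
    qed
    have "norm (f (x + t n *\<^sub>R e) - f (x + 0 *\<^sub>R e)) \<le> B * norm (t n - 0)"
      by (rule field_differentiable_bound[where S = UNIV and f' = "\<lambda>t. f' (x + t *\<^sub>R e)"]) (use d bound in auto)
    then show ?thesis using t(2)[of n] by (simp add: s_def divide_le_eq)
  qed
  have s0: "s n x = 0" if "norm x > R + norm e" for n x
  proof -
    have "norm (t n *\<^sub>R e) \<le> norm e"
      using t(3)[of n] by (simp add: mult_left_le_one_le)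
    then have "norm (x + t n *\<^sub>R e) > R"
      using norm_diff_ineq[of x "t n *\<^sub>R e"] that by linarith
    moreover have "norm x > R" using that norm_ge_zero[of e] by linarith
    ultimately show ?thesis using supp by (simp add: s_def)
  qed
  have B: "B \<ge> 0" using bound[of 0] by linarith
  have int: "integrable lborel (\<lambda>x. B * C * indicator (cball (0::'a) (R + norm e)) x :: real)"
    using emeasure_lborel_cball_finite[of 0 "R + norm e"]
    by (intro integrable_mult_right integrable_real_indicator) (auto simp: top.not_eq_extremum)
  have sm: "s n \<in> borel_measurable lborel" for n unfolding s_def by measurable
  have [measurable]: "f' \<in> borel_measurable borel"
    using borel_measurable_LIMSEQ_real[OF lim sm] by simp
  have [measurable]: "s n \<in> borel_measurable borel" for n using sm by simp
  have dom: "AE x in lborel. norm (s n x * g x) \<le> B * C * indicator (cball 0 (R + norm e)) x" for n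
  proof (rule AE_I2)
    fix x :: 'a
    have "\<bar>s n x * g x\<bar> \<le> B * C" unfolding abs_mult using sb g(2) B by (intro mult_mono) auto
    then show "norm (s n x * g x) \<le> B * C * indicator (cball 0 (R + norm e)) x"
      using s0[of x n] by (auto simp: indicator_def not_le)
  qed
  have limAE: "AE x in lborel. (\<lambda>n. s n x * g x) \<longlonglongrightarrow> f' x * g x" using lim by (auto intro!: tendsto_intros)
  have m: "(\<lambda>x. f' x * g x) \<in> borel_measurable lborel" "(\<lambda>x. s n x * g x) \<in> borel_measurable lborel" for n
    by measurable
  show "integrable lborel (\<lambda>x. f' x * g x)"
    by (rule integrable_dominated_convergence[OF m int limAE dom])
  show "(\<lambda>n. LINT x|lborel. (f (x + t n *\<^sub>R e) - f x) / t n * g x) \<longlonglongrightarrow> (LINT x|lborel. f' x * g x)"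
    using integral_dominated_convergence[OF m int limAE dom] unfolding s_def .
qed

lemma inverse_Suc_null_sequence:
  "(\<lambda>n. inverse (real (Suc n))) \<longlonglongrightarrow> 0" "inverse (real (Suc n)) \<noteq> 0" "\<bar>inverse (real (Suc n))\<bar> \<le> 1"
  using LIMSEQ_inverse_real_of_nat by (auto simp: inverse_le_1_iff)

text \<open>Translation invariance makes the integral of each difference quotient vanish, and the
  limit inherits this. It is the form of the divergence theorem on which all integrations by parts
  rest.\<close>

lemma integral_directional_derivative_eq_0:
  fixes f f' :: "'a::euclidean_space \<Rightarrow> real" and e :: 'a
  assumes deriv: "\<And>x. ((\<lambda>t. f (x + t *\<^sub>R e)) has_real_derivative f' x) (at 0)"
    and cont: "continuous_on UNIV f"
    and bound: "\<And>x. \<bar>f' x\<bar> \<le> B"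
    and supp: "\<And>x. norm x > R \<Longrightarrow> f x = 0"
  shows "integrable lborel f'" "(LINT x|lborel. f' x) = 0"
proof -
  have one: "(\<lambda>_::'a. 1::real) \<in> borel_measurable borel" "\<And>x::'a. \<bar>1::real\<bar> \<le> 1" by auto
  note q = integral_difference_quotient[OF deriv cont bound supp inverse_Suc_null_sequence one]
  show "integrable lborel f'" using q(1) by simp
  have fi: "integrable lborel f" by (rule continuous_compact_support_integrable[OF cont supp])
  have "(LINT x|lborel. (f (x + inverse (real (Suc n)) *\<^sub>R e) - f x) / inverse (real (Suc n))) = 0" for n
    using fi lborel_integral_shift[of f "inverse (real (Suc n)) *\<^sub>R e"] by simp
  with q(2) have "(\<lambda>n. 0) \<longlonglongrightarrow> (LINT x|lborel. f' x)" by (simp only: mult_1_right)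
  then show "(LINT x|lborel. f' x) = 0" by (rule LIMSEQ_unique[OF tendsto_const, symmetric])
qed

lemma continuous_compact_support_bounded_ex:
  fixes f :: "'a::euclidean_space \<Rightarrow> 'b::real_normed_vector"
  assumes "continuous_on UNIV f" "\<And>x. norm x > R \<Longrightarrow> f x = 0"
  shows "\<exists>B. \<forall>x. norm (f x) \<le> B"
  by (rule continuous_compact_support_bounded[OF assms(1), of R]) (use assms(2) in auto)

section \<open>Partial derivatives, C1 functions and test functions\<close>

lemma pd_eqI: "(f has_derivative L) (at x) \<Longrightarrow> pd f k x = L (axis k 1)"
  unfolding pd_def using frechet_derivative_at by fastforce

lemma vec2_axis_sum: "(\<Sum>k\<in>UNIV. (h $ k) *\<^sub>R axis k 1) = (h :: real^2)"
  by (simp add: vec_eq_iff axis_def if_distrib cong: if_cong)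

lemma has_derivative_pd:
  assumes "f differentiable (at x)"
  shows "(f has_derivative (\<lambda>h. \<Sum>k\<in>UNIV. h $ k * pd f k x)) (at x)"
proof -
  have d: "(f has_derivative frechet_derivative f (at x)) (at x)"
    using assms by (simp add: frechet_derivative_works)
  interpret b: bounded_linear "frechet_derivative f (at x)" using d by (rule has_derivative_bounded_linear)
  have "frechet_derivative f (at x) h = (\<Sum>k\<in>UNIV. h $ k * pd f k x)" for h
    by (subst vec2_axis_sum[of h, symmetric]) (simp only: b.sum b.scaleR pd_def real_scaleR_def)
  then show ?thesis using d by presburger
qed

lemma axis_sum:
  fixes g :: "2 \<Rightarrow> 'a::real_algebra_1"
  shows "(\<Sum>j\<in>UNIV. of_real ((axis k 1 :: real^2) $ j) * g j) = g k"
proof -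
  have "of_real ((axis k 1 :: real^2) $ j) * g j = (if k = j then g j else 0)" for j
    by (simp add: axis_def)
  then show ?thesis by simp
qed

lemmas axis_sum_real = axis_sum[where 'a = real, simplified]

lemma pd_mult:
  assumes "f differentiable (at x)" "g differentiable (at x)"
  shows "pd (\<lambda>x. f x * g x) k x = pd f k x * g x + f x * pd g k x"
proof -
  have "((\<lambda>x. f x * g x) has_derivative (\<lambda>h. f x * (\<Sum>k\<in>UNIV. h $ k * pd g k x) + (\<Sum>k\<in>UNIV. h $ k * pd f k x) * g x)) (at x)"
    by (intro has_derivative_mult has_derivative_pd assms)
  from pd_eqI[OF this, of k] show ?thesis by (simp add: axis_sum_real)
qed

lemma pd_local_const:
  assumes "open S" "x \<in> S" "\<And>y. y \<in> S \<Longrightarrow> f y = c"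
  shows "pd f k x = 0" "f differentiable (at x)"
proof -
  have "((\<lambda>_. c) has_derivative (\<lambda>_. 0)) (at x)" by simp
  then have "(f has_derivative (\<lambda>_. 0)) (at x)"
    by (rule has_derivative_transform_within_open[OF _ assms(1,2)]) (simp add: assms(3))
  then show "pd f k x = 0" "f differentiable (at x)" by (auto simp: pd_eqI differentiable_def)
qed

definition C1_fun :: "(real^2 \<Rightarrow> real) \<Rightarrow> bool" where
  "C1_fun \<eta> \<longleftrightarrow> (\<forall>x. \<eta> differentiable (at x)) \<and> (\<forall>k. continuous_on UNIV (pd \<eta> k))"

lemma C1_fun_continuous: "C1_fun \<eta> \<Longrightarrow> continuous_on S \<eta>"
  by (meson C1_fun_def continuous_at_imp_continuous_on differentiable_imp_continuous_within)

lemma C1_fun_mult: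
  assumes "C1_fun f" "C1_fun g"
  shows "C1_fun (\<lambda>x. f x * g x)"
proof -
  have "pd (\<lambda>x. f x * g x) k = (\<lambda>x. pd f k x * g x + f x * pd g k x)" for k
    using assms by (auto simp: C1_fun_def pd_mult)
  then show ?thesis using assms C1_fun_continuous[OF assms(1)] C1_fun_continuous[OF assms(2)]
    by (auto simp: C1_fun_def intro!: continuous_intros differentiable_mult)
qed

lemma C1_funI:
  assumes "\<And>x. (f has_derivative L x) (at x)" "\<And>k. continuous_on UNIV (\<lambda>x. L x (axis k 1))"
  shows "C1_fun f" "pd f k x = L x (axis k 1)"
proof -
  have "pd f k = (\<lambda>x. L x (axis k 1))" for k using pd_eqI[OF assms(1)] by auto
  then show "C1_fun f" "pd f k x = L x (axis k 1)" using assms by (auto simp: C1_fun_def differentiable_def)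
qed

lemma C1_fun_one_minus:
  assumes "C1_fun f"
  shows "C1_fun (\<lambda>x. 1 - f x)" "pd (\<lambda>x. 1 - f x) k x = - pd f k x"
proof -
  have d: "((\<lambda>x. 1 - f x) has_derivative (\<lambda>h. - (\<Sum>k\<in>UNIV. h $ k * pd f k x))) (at x)" for x
  proof -
    have "(f has_derivative (\<lambda>h. \<Sum>k\<in>UNIV. h $ k * pd f k x)) (at x)"
      using assms by (intro has_derivative_pd) (simp add: C1_fun_def)
    from has_derivative_diff[OF has_derivative_const this, of 1] show ?thesis by simp
  qed
  have c: "continuous_on UNIV (\<lambda>x. - (\<Sum>j\<in>UNIV. (axis k 1 :: real^2) $ j * pd f j x))" for k
    unfolding axis_sum_real using assms by (intro continuous_intros) (simp add: C1_fun_def)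
  show "C1_fun (\<lambda>x. 1 - f x)" "pd (\<lambda>x. 1 - f x) k x = - pd f k x"
    using C1_funI[OF d c] by (simp_all add: axis_sum_real)
qed

text \<open>Any compact set off which the function vanishes may replace the closure of its nonzero
  set; such a set is usually at hand where the closure is not.\<close>

lemma test_fun_iff: "test_fun U \<psi> \<longleftrightarrow> C1_fun \<psi> \<and> (\<exists>K. compact K \<and> K \<subseteq> U \<and> (\<forall>x. x \<notin> K \<longrightarrow> \<psi> x = 0))"
proof
  assume "test_fun U \<psi>"
  then show "C1_fun \<psi> \<and> (\<exists>K. compact K \<and> K \<subseteq> U \<and> (\<forall>x. x \<notin> K \<longrightarrow> \<psi> x = 0))"
    unfolding test_fun_def C1_fun_def
    using closure_subset[of "{x. \<psi> x \<noteq> 0}"]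
    by (intro conjI exI[of _ "closure {x. \<psi> x \<noteq> 0}"] allI impI) blast+
next
  assume "C1_fun \<psi> \<and> (\<exists>K. compact K \<and> K \<subseteq> U \<and> (\<forall>x. x \<notin> K \<longrightarrow> \<psi> x = 0))"
  then obtain K where K: "C1_fun \<psi>" "compact K" "K \<subseteq> U" "\<And>x. x \<notin> K \<Longrightarrow> \<psi> x = 0" by blast
  have "closure {x. \<psi> x \<noteq> 0} \<subseteq> K" using K(2,4) by (intro closure_minimal compact_imp_closed) auto
  moreover have "bounded {x. \<psi> x \<noteq> 0}"
    by (rule bounded_subset[OF compact_imp_bounded[OF K(2)]]) (use K(4) in blast)
  ultimately show "test_fun U \<psi>" using K(1,3) unfolding test_fun_def C1_fun_def
    by (simp add: compact_closure)
qed

lemma pd_eq_0_outside: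
  assumes "compact K" "\<And>y. y \<notin> K \<Longrightarrow> \<psi> y = 0" "x \<notin> K"
  shows "pd \<psi> k x = 0"
  using assms by (intro pd_local_const(1)[of "- K"]) (auto simp: compact_imp_closed open_Compl)

lemma test_funD:
  assumes "test_fun U \<psi>"
  shows "continuous_on UNIV \<psi>" "continuous_on UNIV (pd \<psi> k)" "\<And>x. \<psi> differentiable (at x)"
    "x \<notin> U \<Longrightarrow> \<psi> x = 0" "x \<notin> U \<Longrightarrow> pd \<psi> k x = 0"
    "\<exists>R. \<forall>x k. norm x > R \<longrightarrow> \<psi> x = 0 \<and> pd \<psi> k x = 0"
    "\<exists>B. \<forall>x k. \<bar>\<psi> x\<bar> \<le> B \<and> \<bar>pd \<psi> k x\<bar> \<le> B"
proof -
  obtain K where K: "C1_fun \<psi>" "compact K" "K \<subseteq> U" "\<And>x. x \<notin> K \<Longrightarrow> \<psi> x = 0"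
    using assms unfolding test_fun_iff by blast
  have pd0: "x \<notin> K \<Longrightarrow> pd \<psi> k x = 0" for x k by (rule pd_eq_0_outside[OF K(2,4)])
  show c: "continuous_on UNIV \<psi>" "continuous_on UNIV (pd \<psi> k)" "\<And>x. \<psi> differentiable (at x)" for k
    using K(1) C1_fun_continuous by (auto simp: C1_fun_def)
  show "x \<notin> U \<Longrightarrow> \<psi> x = 0" "x \<notin> U \<Longrightarrow> pd \<psi> k x = 0" using K pd0 by auto
  obtain R where R: "\<And>x. x \<in> K \<Longrightarrow> norm x \<le> R" using K(2) compact_imp_bounded bounded_iff by metis
  then have R': "norm x > R \<Longrightarrow> \<psi> x = 0 \<and> pd \<psi> k x = 0" for x k
    using K(4) pd0 by (meson not_le)
  then show "\<exists>R. \<forall>x k. norm x > R \<longrightarrow> \<psi> x = 0 \<and> pd \<psi> k x = 0" by blast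
  obtain B0 where "\<And>x. \<bar>\<psi> x\<bar> \<le> B0"
    using continuous_compact_support_bounded_ex[OF c(1), of R] R' by auto
  moreover obtain B1 where "\<And>x. \<bar>pd \<psi> 1 x\<bar> \<le> B1"
    using continuous_compact_support_bounded_ex[OF c(2)[of 1], of R] R' by auto
  moreover obtain B2 where "\<And>x. \<bar>pd \<psi> 2 x\<bar> \<le> B2"
    using continuous_compact_support_bounded_ex[OF c(2)[of 2], of R] R' by auto
  ultimately have "\<bar>\<psi> x\<bar> \<le> max B0 (max B1 B2) \<and> \<bar>pd \<psi> k x\<bar> \<le> max B0 (max B1 B2)" for x k
    using exhaust_2[of k] by (auto simp: le_max_iff_disj)
  then show "\<exists>B. \<forall>x k. \<bar>\<psi> x\<bar> \<le> B \<and> \<bar>pd \<psi> k x\<bar> \<le> B" by blast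
qed

section \<open>Extension by zero, and multiplication of Sobolev functions by C1 functions\<close>

definition zext :: "(real^2) set \<Rightarrow> (real^2 \<Rightarrow> complex) \<Rightarrow> real^2 \<Rightarrow> complex" where
  "zext U f x = (if x \<in> U then f x else 0)"

lemma L2_iff: "L2 U f \<longleftrightarrow> sq_int (zext U f)"
proof -
  have "(\<lambda>x. indicator U x *\<^sub>R f x) = zext U f" "(\<lambda>x. indicator U x *\<^sub>R (cmod (f x))\<^sup>2) = (\<lambda>x. (cmod (zext U f x))\<^sup>2)"
    by (auto simp: zext_def indicator_def fun_eq_iff)
  then show ?thesis unfolding L2_def sq_int_def set_borel_measurable_def set_integrable_def by simp
qed

lemma set_integral_zext:
  "(LINT x:U|lborel. a x * u x) = (LINT x|lborel. a x * zext U u x)" for u :: "real^2 \<Rightarrow> complex"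
  unfolding set_lebesgue_integral_def by (intro Bochner_Integration.integral_cong) (auto simp: zext_def)

lemma L2norm2_zext: "L2norm2 U u = (LINT x|lborel. (cmod (zext U u x))\<^sup>2)"
  unfolding L2norm2_def set_lebesgue_integral_def by (intro Bochner_Integration.integral_cong) (auto simp: zext_def)

lemma weak_grad_zext: "weak_grad U u G \<longleftrightarrow> (\<forall>\<psi> k. test_fun U \<psi> \<longrightarrow>
     (LINT x|lborel. complex_of_real (pd \<psi> k x) * zext U u x) =
       - (LINT x|lborel. complex_of_real (\<psi> x) * zext U (G k) x))"
  unfolding weak_grad_def set_integral_zext ..

lemma zext_UNIV [simp]: "zext UNIV f = f"
  by (auto simp: zext_def)

lemma zext_mult: "zext U (\<lambda>x. f x * g x) = (\<lambda>x. f x * zext U g x)"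
  by (auto simp: zext_def)

lemma zext_add: "zext U (\<lambda>x. f x + g x) = (\<lambda>x. zext U f x + zext U g x)"
  by (auto simp: zext_def)

lemma of_real_cont_measurable: "continuous_on UNIV f \<Longrightarrow> (\<lambda>x::real^2. complex_of_real (f x)) \<in> borel_measurable borel"
  by (intro borel_measurable_continuous_onI continuous_intros)

lemma test_fun_sq_int:
  assumes "test_fun U \<psi>"
  shows "sq_int (\<lambda>x. complex_of_real (\<psi> x))" "sq_int (\<lambda>x. complex_of_real (pd \<psi> k x))"
proof -
  obtain R where R: "\<And>x k. norm x > R \<Longrightarrow> \<psi> x = 0 \<and> pd \<psi> k x = 0" using test_funD(6)[OF assms] by blast
  show "sq_int (\<lambda>x. complex_of_real (\<psi> x))" "sq_int (\<lambda>x. complex_of_real (pd \<psi> k x))"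
    using R test_funD(1,2)[OF assms] by (auto intro!: continuous_compact_support_sq_int[where R = R] continuous_intros)
qed

text \<open>The weak identity for \<open>u\<close> is tested with \<psi> times \<eta>. The two
  domains are kept apart so that one statement yields multiplication on a domain, restriction to a
  subdomain (\<open>\<eta> = 1\<close>) and, for \<eta> of compact support in \<open>U\<close>,
  extension to the whole plane; \<open>test\<close> is what these cases have in common.\<close>

lemma H1grad_mult:
  fixes u :: "real^2 \<Rightarrow> complex" and G :: "2 \<Rightarrow> real^2 \<Rightarrow> complex"
  assumes u: "H1grad U u G" and eta: "C1_fun \<eta>"
    and bnd: "\<And>x. \<bar>\<eta> x\<bar> \<le> B" "\<And>x k. \<bar>pd \<eta> k x\<bar> \<le> B"
    and V: "V \<in> sets lborel"
    and test: "\<And>\<psi>. test_fun V \<psi> \<Longrightarrow> test_fun U (\<lambda>x. \<psi> x * \<eta> x)"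
  shows "H1grad V (zext U (\<lambda>x. \<eta> x * u x)) (\<lambda>k. zext U (\<lambda>x. \<eta> x * G k x + pd \<eta> k x * u x))"
proof -
  have su: "sq_int (zext U u)" and sG: "sq_int (zext U (G k))" for k
    using u unfolding H1grad_def L2_iff by auto
  have [measurable]: "(\<lambda>x. complex_of_real (\<eta> x)) \<in> borel_measurable borel"
    "(\<lambda>x. complex_of_real (pd \<eta> k x)) \<in> borel_measurable borel" for k
    using eta C1_fun_continuous by (auto intro!: of_real_cont_measurable simp: C1_fun_def)
  have a: "sq_int (\<lambda>x. complex_of_real (\<eta> x) * zext U u x)" "sq_int (\<lambda>x. complex_of_real (\<eta> x) * zext U (G k) x)"
    "sq_int (\<lambda>x. complex_of_real (pd \<eta> k x) * zext U u x)" for k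
    using su sG bnd by (auto intro!: sq_int_mult_bounded[where B = B])
  have b: "sq_int (\<lambda>x. complex_of_real (\<eta> x) * zext U (G k) x + complex_of_real (pd \<eta> k x) * zext U u x)" for k
    by (intro sq_int_add a)
  have cut: "sq_int (zext V f)" if "sq_int f" for f
  proof -
    have [measurable]: "V \<in> sets borel" using V by simp
    have "sq_int (\<lambda>x. indicator V x * f x)"
      using that by (intro sq_int_mult_bounded[where B = 1]) (auto simp: indicator_def)
    moreover have "(\<lambda>x. indicator V x * f x) = zext V f" by (auto simp: zext_def indicator_def)
    ultimately show ?thesis by simp
  qed
  have wg: "weak_grad V (zext U (\<lambda>x. \<eta> x * u x)) (\<lambda>k. zext U (\<lambda>x. \<eta> x * G k x + pd \<eta> k x * u x))"
    unfolding weak_grad_zext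
  proof (intro allI impI)
    fix \<psi> k assume psi: "test_fun V \<psi>"
    have d: "\<psi> differentiable (at x)" "\<eta> differentiable (at x)" for x
      using psi eta by (auto simp: test_fun_def C1_fun_def)
    have "(LINT x|lborel. complex_of_real (pd (\<lambda>x. \<psi> x * \<eta> x) k x) * zext U u x) =
       - (LINT x|lborel. complex_of_real (\<psi> x * \<eta> x) * zext U (G k) x)"
      using u test[OF psi] unfolding H1grad_def weak_grad_zext by blast
    then have 1: "(LINT x|lborel. complex_of_real (pd \<psi> k x) * (complex_of_real (\<eta> x) * zext U u x) +
        complex_of_real (\<psi> x) * (complex_of_real (pd \<eta> k x) * zext U u x)) =
       - (LINT x|lborel. complex_of_real (\<psi> x) * (complex_of_real (\<eta> x) * zext U (G k) x))"
      unfolding pd_mult[OF d] by (simp add: algebra_simps)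
    have i: "integrable lborel (\<lambda>x. complex_of_real (pd \<psi> k x) * (complex_of_real (\<eta> x) * zext U u x))"
      "integrable lborel (\<lambda>x. complex_of_real (\<psi> x) * (complex_of_real (pd \<eta> k x) * zext U u x))"
      "integrable lborel (\<lambda>x. complex_of_real (\<psi> x) * (complex_of_real (\<eta> x) * zext U (G k) x))"
      using test_fun_sq_int[OF psi] a by (intro sq_int_mult_integrable; blast)+
    have "(LINT x|lborel. complex_of_real (pd \<psi> k x) * zext V (zext U (\<lambda>x. \<eta> x * u x)) x)
       = (LINT x|lborel. complex_of_real (pd \<psi> k x) * (complex_of_real (\<eta> x) * zext U u x))"
      using test_funD(5)[OF psi] by (intro Bochner_Integration.integral_cong) (auto simp: zext_def)
    also have "\<dots> = - ((LINT x|lborel. complex_of_real (\<psi> x) * (complex_of_real (\<eta> x) * zext U (G k) x))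
         + (LINT x|lborel. complex_of_real (\<psi> x) * (complex_of_real (pd \<eta> k x) * zext U u x)))"
      using 1 i by (simp add: eq_neg_iff_add_eq_0 algebra_simps)
    also have "\<dots> = - (LINT x|lborel. complex_of_real (\<psi> x) * (complex_of_real (\<eta> x) * zext U (G k) x)
         + complex_of_real (\<psi> x) * (complex_of_real (pd \<eta> k x) * zext U u x))"
      using i by simp
    also have "\<dots> = - (LINT x|lborel. complex_of_real (\<psi> x) * zext V (zext U (\<lambda>x. \<eta> x * G k x + pd \<eta> k x * u x)) x)"
      using test_funD(4)[OF psi]
      by (intro arg_cong[where f = uminus] Bochner_Integration.integral_cong) (auto simp: zext_def algebra_simps)
    finally show "(LINT x|lborel. complex_of_real (pd \<psi> k x) * zext V (zext U (\<lambda>x. \<eta> x * u x)) x) =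
       - (LINT x|lborel. complex_of_real (\<psi> x) * zext V (zext U (\<lambda>x. \<eta> x * G k x + pd \<eta> k x * u x)) x)" .
  qed
  show ?thesis unfolding H1grad_def L2_iff
    using wg cut[OF a(1)] cut[OF b] by (simp add: zext_mult zext_add)
qed

section \<open>Complex C1 functions of compact support, the class in which identities are proved
  before passing to limits\<close>

definition C1c :: "(real^2 \<Rightarrow> complex) \<Rightarrow> (2 \<Rightarrow> real^2 \<Rightarrow> complex) \<Rightarrow> bool" where
  "C1c v G \<longleftrightarrow> (\<forall>x. (v has_derivative (\<lambda>h. \<Sum>k\<in>UNIV. complex_of_real (h $ k) * G k x)) (at x)) \<and>
     (\<forall>k. continuous_on UNIV (G k)) \<and> (\<exists>R. \<forall>x. norm x > R \<longrightarrow> v x = 0)"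

lemma C1c_continuous: "C1c v G \<Longrightarrow> continuous_on S v"
  unfolding C1c_def by (meson continuous_at_imp_continuous_on has_derivative_continuous)

lemma C1c_grad_outside:
  assumes "C1c v G" "compact K" "\<And>y. y \<notin> K \<Longrightarrow> v y = 0" "x \<notin> K"
  shows "G k x = 0"
proof -
  have d: "(v has_derivative (\<lambda>h. \<Sum>k\<in>UNIV. complex_of_real (h $ k) * G k x)) (at x)"
    using assms(1) by (simp add: C1c_def)
  have "((\<lambda>_. 0) has_derivative (\<lambda>_. 0 :: complex)) (at x)" by simp
  then have "(v has_derivative (\<lambda>_. 0)) (at x)"
    by (rule has_derivative_transform_within_open[of _ _ _ _ "- K"])
      (use assms in \<open>auto simp: compact_imp_closed open_Compl\<close>)
  from fun_cong[OF has_derivative_unique[OF d this], of "axis k 1"] show ?thesis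
    by (simp add: axis_sum)
qed

lemma C1c_support:
  assumes "C1c v G"
  obtains R where "\<And>x. norm x > R \<Longrightarrow> v x = 0" "\<And>x k. norm x > R \<Longrightarrow> G k x = 0"
proof -
  obtain R where R: "\<And>x. norm x > R \<Longrightarrow> v x = 0" using assms by (auto simp: C1c_def)
  then have "norm x > R \<Longrightarrow> G k x = 0" for x k
    using C1c_grad_outside[OF assms, of "cball 0 R" x k] by (auto simp: not_le)
  then show ?thesis using that R by blast
qed

lemma C1c_sq_int:
  assumes "C1c v G"
  shows "sq_int v" "sq_int (G k)"
proof -
  obtain R where R: "\<And>x. norm x > R \<Longrightarrow> v x = 0" "\<And>x k. norm x > R \<Longrightarrow> G k x = 0"
    using C1c_support[OF assms] by blast
  show "sq_int v" by (rule continuous_compact_support_sq_int[OF C1c_continuous[OF assms] R(1)])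
  show "sq_int (G k)" using assms by (intro continuous_compact_support_sq_int[OF _ R(2)]) (auto simp: C1c_def)
qed

lemma C1c_Re:
  assumes "C1c v G"
  shows "C1_fun (\<lambda>x. Re (v x))" "pd (\<lambda>x. Re (v x)) k x = Re (G k x)"
    "C1_fun (\<lambda>x. Im (v x))" "pd (\<lambda>x. Im (v x)) k x = Im (G k x)"
proof -
  have d: "(v has_derivative (\<lambda>h. \<Sum>k\<in>UNIV. complex_of_real (h $ k) * G k x)) (at x)"
    and c: "continuous_on UNIV (G k)" for x k
    using assms by (auto simp: C1c_def)
  have r: "((\<lambda>x. Re (v x)) has_derivative (\<lambda>h. \<Sum>k\<in>UNIV. h $ k * Re (G k x))) (at x)" for x
    using bounded_linear.has_derivative[OF bounded_linear_Re d] by simp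
  have i: "((\<lambda>x. Im (v x)) has_derivative (\<lambda>h. \<Sum>k\<in>UNIV. h $ k * Im (G k x))) (at x)" for x
    using bounded_linear.has_derivative[OF bounded_linear_Im d] by simp
  have s: "(\<Sum>j\<in>UNIV. (axis k 1 :: real^2) $ j * g j) = g k" for g :: "2 \<Rightarrow> real" and k
    by (rule axis_sum_real)
  have cr: "continuous_on UNIV (\<lambda>x. \<Sum>j\<in>UNIV. (axis k 1 :: real^2) $ j * Re (G j x))"
    "continuous_on UNIV (\<lambda>x. \<Sum>j\<in>UNIV. (axis k 1 :: real^2) $ j * Im (G j x))" for k
    unfolding s using c by (auto intro!: continuous_intros)
  show "C1_fun (\<lambda>x. Re (v x))" "pd (\<lambda>x. Re (v x)) k x = Re (G k x)"
    using C1_funI[OF r cr(1)] by (auto simp: s)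
  show "C1_fun (\<lambda>x. Im (v x))" "pd (\<lambda>x. Im (v x)) k x = Im (G k x)"
    using C1_funI[OF i cr(2)] by (auto simp: s)
qed

lemma C1_fun_add:
  assumes "C1_fun f" "C1_fun g"
  shows "C1_fun (\<lambda>x. f x + g x)" "pd (\<lambda>x. f x + g x) k x = pd f k x + pd g k x"
proof -
  have e: "pd (\<lambda>x. f x + g x) k x = pd f k x + pd g k x" for k x
  proof -
    have "((\<lambda>x. f x + g x) has_derivative (\<lambda>h. (\<Sum>k\<in>UNIV. h $ k * pd f k x) + (\<Sum>k\<in>UNIV. h $ k * pd g k x))) (at x)"
      using assms by (intro has_derivative_add has_derivative_pd) (auto simp: C1_fun_def)
    from pd_eqI[OF this, of k] show ?thesis by (simp add: axis_sum_real)
  qed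
  then have "pd (\<lambda>x. f x + g x) k = (\<lambda>x. pd f k x + pd g k x)" for k by auto
  then show "C1_fun (\<lambda>x. f x + g x)" using assms by (auto simp: C1_fun_def intro!: continuous_intros)
  show "pd (\<lambda>x. f x + g x) k x = pd f k x + pd g k x" by (rule e)
qed

lemma C1c_cmod_sq:
  assumes "C1c v G"
  shows "C1_fun (\<lambda>x. (cmod (v x))\<^sup>2)" "pd (\<lambda>x. (cmod (v x))\<^sup>2) k x = 2 * Re (cnj (v x) * G k x)"
proof -
  note r = C1c_Re[OF assms]
  have e: "(\<lambda>x. (cmod (v x))\<^sup>2) = (\<lambda>x. Re (v x) * Re (v x) + Im (v x) * Im (v x))"
    unfolding cmod_power2 by (simp add: power2_eq_square)
  have m: "C1_fun (\<lambda>x. Re (v x) * Re (v x))" "C1_fun (\<lambda>x. Im (v x) * Im (v x))"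
    using r by (auto intro!: C1_fun_mult)
  show "C1_fun (\<lambda>x. (cmod (v x))\<^sup>2)" unfolding e using C1_fun_add[OF m] by simp
  have dr: "(\<lambda>x. Re (v x)) differentiable at x" and di: "(\<lambda>x. Im (v x)) differentiable at x" for x
    using r(1,3) unfolding C1_fun_def by blast+
  have "pd (\<lambda>x. Re (v x) * Re (v x)) k x = 2 * (Re (v x) * Re (G k x))"
    by (simp add: pd_mult[OF dr dr] r)
  moreover have "pd (\<lambda>x. Im (v x) * Im (v x)) k x = 2 * (Im (v x) * Im (G k x))"
    by (simp add: pd_mult[OF di di] r)
  ultimately show "pd (\<lambda>x. (cmod (v x))\<^sup>2) k x = 2 * Re (cnj (v x) * G k x)"
    unfolding e C1_fun_add(2)[OF m] by simp
qed

lemma test_fun_bump: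
  fixes x :: "real^2"
  assumes r: "r > 0"
  shows "test_fun UNIV (\<lambda>y. bump r (x - y) / c)" "pd (\<lambda>y. bump r (x - y) / c) k y = - bump_deriv r (x - y) (axis k 1) / c"
proof -
  have d: "((\<lambda>y. bump r (x - y) / c) has_derivative (\<lambda>h. bump_deriv r (x - y) (- h) / c)) (at y)" for y
  proof -
    have "((\<lambda>y. x - y) has_derivative (\<lambda>h. - h)) (at y)" by (auto intro!: derivative_eq_intros)
    from has_derivative_compose[OF this has_derivative_bump[OF r]]
    show ?thesis by (intro bounded_linear.has_derivative[OF bounded_linear_divide])
  qed
  have m: "bump_deriv r z (- h) = - bump_deriv r z h" for z h :: "real^2" by (simp add: bump_deriv_def)
  have "continuous_on UNIV (\<lambda>y. bump_deriv r (x - y) (- axis k 1) / c)" for k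
    unfolding divide_inverse by (intro continuous_intros)
  then have c: "C1_fun (\<lambda>y. bump r (x - y) / c)" and p: "pd (\<lambda>y. bump r (x - y) / c) k y = bump_deriv r (x - y) (- axis k 1) / c" for k y
    using C1_funI[OF d] by auto
  show "pd (\<lambda>y. bump r (x - y) / c) k y = - bump_deriv r (x - y) (axis k 1) / c" unfolding p m ..
  have "bump r (x - y) / c = 0" if "y \<notin> cball x r" for y
    using that r by (simp add: bump_outside dist_norm)
  then show "test_fun UNIV (\<lambda>y. bump r (x - y) / c)"
    unfolding test_fun_iff using c by (intro conjI exI[of _ "cball x r"]) auto
qed

text \<open>The kernel centred at \<open>x\<close> is itself a test function, so the definition of
  the weak gradient moves the derivative from the kernel to \<open>G\<close>. Mollifying
  \<open>v\<close> and \<open>G\<close> separately thus gives a function together with its classical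
  gradient.\<close>

lemma mollify_weak_grad:
  assumes v: "H1grad UNIV v G" and supp: "\<And>x. norm x > R \<Longrightarrow> v x = 0" "\<And>x k. norm x > R \<Longrightarrow> G k x = 0"
    and r: "r > 0"
  shows "C1c (mollify r v) (\<lambda>k. mollify r (G k))"
proof -
  have sv: "sq_int v" and sG: "sq_int (G k)" for k using v by (auto simp: H1grad_def L2_iff)
  have vi: "integrable lborel v" and Gi: "integrable lborel (G k)" for k
    using sq_int_integrable[OF sv supp(1)] sq_int_integrable[OF sG supp(2)] by auto
  let ?m = "bump_mass r TYPE(real^2)"
  have k: "mollify_deriv r v x (axis k 1) = mollify r (G k) x" for x k
  proof -
    have "(LINT y|lborel. complex_of_real (- bump_deriv r (x - y) (axis k 1) / ?m) * v y) =
      - (LINT y|lborel. complex_of_real (bump r (x - y) / ?m) * G k y)"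
    proof -
      have "(LINT y|lborel. complex_of_real (pd (\<lambda>y. bump r (x - y) / ?m) k y) * v y) =
        - (LINT y|lborel. complex_of_real (bump r (x - y) / ?m) * G k y)"
        using v test_fun_bump(1)[OF r, of x ?m] unfolding H1grad_def weak_grad_zext zext_UNIV by blast
      then show ?thesis unfolding test_fun_bump(2)[OF r] .
    qed
    then show ?thesis unfolding mollify_def mollify_deriv_def
      by (simp add: scaleR_conv_of_real)
  qed
  have d: "(mollify r v has_derivative (\<lambda>h. \<Sum>k\<in>UNIV. complex_of_real (h $ k) * mollify r (G k) x)) (at x)" for x
  proof -
    have D: "(mollify r v has_derivative mollify_deriv r v x) (at x)" by (rule has_derivative_mollify[OF r vi])
    interpret b: bounded_linear "mollify_deriv r v x" using D by (rule has_derivative_bounded_linear)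
    have "mollify_deriv r v x h = (\<Sum>k\<in>UNIV. complex_of_real (h $ k) * mollify r (G k) x)" for h
      by (subst vec2_axis_sum[of h, symmetric]) (simp only: b.sum b.scaleR k scaleR_conv_of_real[where 'a = complex])
    then show ?thesis using D by presburger
  qed
  have "mollify r v x = 0" if "norm x > R + r" for x
  proof (rule mollify_eq_0[OF r vi])
    fix y assume "dist x y < r"
    then show "v y = 0" using supp(1)[of y] that norm_triangle_sub[of x y] by (auto simp: dist_norm)
  qed
  then show ?thesis unfolding C1c_def using d continuous_mollify[OF r Gi] by blast
qed

section \<open>The magnetic lower bound\<close>

lemma C1_fun_directional:
  assumes "C1_fun f"
  shows "((\<lambda>t. f (x + t *\<^sub>R axis k 1)) has_real_derivative pd f k x) (at 0)"
proof -
  have d: "(f has_derivative (\<lambda>h. \<Sum>k\<in>UNIV. h $ k * pd f k x)) (at (x + 0 *\<^sub>R axis k 1))"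
    using assms by (intro has_derivative_pd[THEN has_derivative_eq_rhs]) (auto simp: C1_fun_def)
  have "((\<lambda>t. x + t *\<^sub>R axis k 1) has_derivative (\<lambda>t. t *\<^sub>R axis k 1)) (at 0)"
    by (auto intro!: derivative_eq_intros)
  from has_derivative_compose[OF this d]
  have "((\<lambda>t. f (x + t *\<^sub>R axis k 1)) has_derivative (\<lambda>t. t * (\<Sum>j\<in>UNIV. (axis k 1 :: real^2) $ j * pd f j x))) (at 0)"
    by (simp add: sum_distrib_left mult.assoc)
  then show ?thesis unfolding axis_sum_real has_field_derivative_def
    by (rule has_derivative_eq_rhs) (simp add: fun_eq_iff mult.commute)
qed

lemma C1_fun_pd_outside:
  assumes "\<And>x. norm x > R \<Longrightarrow> f x = 0" "norm x > R"
  shows "pd f k x = 0"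
  using assms by (intro pd_eq_0_outside[of "cball 0 R"]) (auto simp: not_le)

lemma C1_fun_pd_bounded:
  assumes "C1_fun f" "\<And>x. norm x > R \<Longrightarrow> f x = 0"
  shows "\<exists>B. \<forall>x. \<bar>pd f k x\<bar> \<le> B"
  using continuous_compact_support_bounded_ex[of "pd f k" R] assms C1_fun_pd_outside[of R f] by (auto simp: C1_fun_def)

text \<open>For \<open>C\<^sup>2\<close> functions this is two integrations by parts; with only \<open>C\<^sup>1\<close> regularity the first one is replaced by a summation by parts
  of difference quotients.\<close>

lemma integral_pd_symmetric:
  assumes a: "C1_fun a" "\<And>x. norm x > R \<Longrightarrow> a x = 0" and b: "C1_fun b" "\<And>x. norm x > R \<Longrightarrow> b x = 0"
  shows "(LINT x|lborel. pd a j x * pd b k x) = (LINT x|lborel. pd a k x * pd b j x)"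
proof -
  define t where "t n = inverse (real (Suc n))" for n
  have t: "t \<longlonglongrightarrow> 0" "t n \<noteq> 0" "\<bar>t n\<bar> \<le> 1" for n unfolding t_def using inverse_Suc_null_sequence by auto
  have mt: "(\<lambda>n. - t n) \<longlonglongrightarrow> 0" "- t n \<noteq> 0" "\<bar>- t n\<bar> \<le> 1" for n using tendsto_minus[OF t(1)] t(2,3)[of n] by auto
  obtain Ba where Ba: "\<And>x. \<bar>pd a j x\<bar> \<le> Ba" using C1_fun_pd_bounded[OF a] by blast
  obtain Ba' where Ba': "\<And>x. \<bar>pd a k x\<bar> \<le> Ba'" using C1_fun_pd_bounded[OF a] by blast
  obtain Bb where Bb: "\<And>x. \<bar>pd b j x\<bar> \<le> Bb" using C1_fun_pd_bounded[OF b] by blast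
  obtain Bb' where Bb': "\<And>x. \<bar>pd b k x\<bar> \<le> Bb'" using C1_fun_pd_bounded[OF b] by blast
  have cpd: "continuous_on UNIV (pd a i)" "continuous_on UNIV (pd b i)" for i using a(1) b(1) by (auto simp: C1_fun_def)
  have mpd: "pd a i \<in> borel_measurable borel" "pd b i \<in> borel_measurable borel" for i
    using cpd by (auto intro: borel_measurable_continuous_onI)
  have ca: "continuous_on UNIV a" and cb: "continuous_on UNIV b" using a b C1_fun_continuous by auto
  let ?e = "axis j 1 :: real^2"
  have L1: "(\<lambda>n. LINT x|lborel. (a (x + t n *\<^sub>R ?e) - a x) / t n * pd b k x) \<longlonglongrightarrow> (LINT x|lborel. pd a j x * pd b k x)"
    by (rule integral_difference_quotient[OF C1_fun_directional[OF a(1)] ca Ba a(2) t mpd(2) Bb'])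
  have L2: "(\<lambda>n. LINT x|lborel. (b (x + - t n *\<^sub>R ?e) - b x) / - t n * pd a k x) \<longlonglongrightarrow> (LINT x|lborel. pd b j x * pd a k x)"
    by (rule integral_difference_quotient[OF C1_fun_directional[OF b(1)] cb Bb b(2) mt mpd(1) Ba'])
  \<comment> \<open>The product rule in direction \<open>k\<close>, integrated, moves
    \<open>pd\<close> from \<open>b\<close> to \<open>a\<close> and its translate. The translation
    is then moved from \<open>a\<close> to \<open>b\<close>, which turns the step \<open>t n\<close>
    into \<open>- t n\<close>.\<close>
  have eq: "(LINT x|lborel. (a (x + t n *\<^sub>R ?e) - a x) / t n * pd b k x)
      = (LINT x|lborel. (b (x + - t n *\<^sub>R ?e) - b x) / - t n * pd a k x)" for n
  proof -
    let ?h = "t n *\<^sub>R ?e"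
    define as where "as x = a (x + ?h)" for x
    have h1: "norm ?h \<le> 1" using t(3)[of n] by (simp add: norm_axis_1)
    have as_d: "C1_fun as" "pd as k x = pd a k (x + ?h)" for x
    proof -
      have "(as has_derivative (\<lambda>v. \<Sum>k\<in>UNIV. v $ k * pd a k (x + ?h))) (at x)" for x
      proof -
        have "((\<lambda>x. x + ?h) has_derivative (\<lambda>v. v)) (at x)" by (auto intro!: derivative_eq_intros)
        from has_derivative_compose[OF this has_derivative_pd] show ?thesis
          using a(1) unfolding as_def by (simp add: C1_fun_def)
      qed
      note d = this
      have "continuous_on UNIV (\<lambda>x. pd a k (x + ?h))" for k
        by (intro continuous_on_compose2[OF cpd(1)] continuous_intros) auto
      from C1_funI[OF d, unfolded axis_sum_real, OF this]
      show "C1_fun as" "pd as k x = pd a k (x + ?h)" for x by auto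
    qed
    have as0: "as x = 0" if "norm x > R + 1" for x
      using a(2)[of "x + ?h"] norm_diff_ineq[of x ?h] h1 that by (auto simp: as_def)
    define f where "f x = (as x - a x) * b x" for x
    have fC: "C1_fun (\<lambda>x. as x * b x)" "C1_fun (\<lambda>x. a x * b x)" using as_d a b C1_fun_mult by auto
    have d: "as differentiable (at x)" "a differentiable (at x)" "b differentiable (at x)" for x
      using as_d a b by (auto simp: C1_fun_def)
    have R1: "as x * b x = 0" "a x * b x = 0" if "norm x > R" for x using b(2)[OF that] by auto
    obtain B1 where B1: "\<And>x. \<bar>pd (\<lambda>x. as x * b x) k x\<bar> \<le> B1" using C1_fun_pd_bounded[OF fC(1) R1(1)] by blast
    obtain B2 where B2: "\<And>x. \<bar>pd (\<lambda>x. a x * b x) k x\<bar> \<le> B2" using C1_fun_pd_bounded[OF fC(2) R1(2)] by blast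
    have z: "(LINT x|lborel. pd (\<lambda>x. as x * b x) k x) = 0" "(LINT x|lborel. pd (\<lambda>x. a x * b x) k x) = 0"
      using integral_directional_derivative_eq_0(2)[OF C1_fun_directional[OF fC(1)] C1_fun_continuous[OF fC(1)] B1 R1(1)]
        integral_directional_derivative_eq_0(2)[OF C1_fun_directional[OF fC(2)] C1_fun_continuous[OF fC(2)] B2 R1(2)] by auto
    have cs: "continuous_on UNIV as" "continuous_on UNIV (pd as k)"
      using C1_fun_continuous[OF as_d(1)] as_d(1) unfolding C1_fun_def by blast+
    have i: "integrable lborel (\<lambda>x. pd as k x * b x)" "integrable lborel (\<lambda>x. as x * pd b k x)"
      "integrable lborel (\<lambda>x. pd a k x * b x)" "integrable lborel (\<lambda>x. a x * pd b k x)"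
      "integrable lborel (\<lambda>x. pd a k x * b (x - ?h))"
      using cs ca cb cpd b(2) C1_fun_pd_outside[OF b(2)] C1_fun_pd_outside[OF a(2)]
      by (auto intro!: continuous_compact_support_integrable[where R = R] continuous_intros continuous_on_compose2[OF cb])
    have p: "(LINT x|lborel. as x * pd b k x) = - (LINT x|lborel. pd as k x * b x)"
      "(LINT x|lborel. a x * pd b k x) = - (LINT x|lborel. pd a k x * b x)"
      using z i by (auto simp: pd_mult d)
    have s: "(LINT x|lborel. pd as k x * b x) = (LINT x|lborel. pd a k x * b (x - ?h))"
      using lborel_integral_shift(1)[of "\<lambda>x. pd a k x * b (x - ?h)" ?h] by (simp add: as_d)
    have "(LINT x|lborel. (a (x + ?h) - a x) / t n * pd b k x) = (LINT x|lborel. (as x * pd b k x - a x * pd b k x) / t n)"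
      by (intro Bochner_Integration.integral_cong) (auto simp: as_def algebra_simps diff_divide_distrib)
    also have "\<dots> = ((LINT x|lborel. as x * pd b k x) - (LINT x|lborel. a x * pd b k x)) / t n"
      using i by simp
    also have "\<dots> = ((LINT x|lborel. pd a k x * b x) - (LINT x|lborel. pd a k x * b (x - ?h))) / t n"
      using p s by simp
    also have "\<dots> = (LINT x|lborel. (pd a k x * b x - pd a k x * b (x - ?h)) / t n)"
      using i by simp
    also have "\<dots> = (LINT x|lborel. (b (x + - t n *\<^sub>R ?e) - b x) / - t n * pd a k x)"
      using t(2)[of n] by (intro Bochner_Integration.integral_cong) (auto simp: field_simps)
    finally show ?thesis .
  qed
  from L1[unfolded eq] L2 have "(LINT x|lborel. pd a j x * pd b k x) = (LINT x|lborel. pd b j x * pd a k x)"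
    by (rule LIMSEQ_unique)
  then show ?thesis by (simp add: mult.commute)
qed

text \<open>The integrand is the Jacobian determinant of the map with components \<open>Re v\<close>
  and \<open>Im v\<close>, a null Lagrangian.\<close>

lemma Im_cnj_gradient_integral_eq_0:
  assumes "C1c v G"
  shows "integrable lborel (\<lambda>x. Im (cnj (G 1 x) * G 2 x))" "(LINT x|lborel. Im (cnj (G 1 x) * G 2 x)) = 0"
proof -
  note r = C1c_Re[OF assms]
  obtain R where R: "\<And>x. norm x > R \<Longrightarrow> v x = 0" "\<And>x k. norm x > R \<Longrightarrow> G k x = 0"
    using C1c_support[OF assms] by blast
  have c: "continuous_on UNIV (G k)" for k using assms by (auto simp: C1c_def)
  have i: "integrable lborel (\<lambda>x. Re (G j x) * Im (G k x))" for j k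
    using c R by (auto intro!: continuous_compact_support_integrable[where R = R] continuous_intros)
  have e: "Im (cnj (G 1 x) * G 2 x) = Re (G 1 x) * Im (G 2 x) - Re (G 2 x) * Im (G 1 x)" for x by simp
  show "integrable lborel (\<lambda>x. Im (cnj (G 1 x) * G 2 x))" unfolding e using i by auto
  have "(LINT x|lborel. pd (\<lambda>x. Re (v x)) 1 x * pd (\<lambda>x. Im (v x)) 2 x) =
    (LINT x|lborel. pd (\<lambda>x. Re (v x)) 2 x * pd (\<lambda>x. Im (v x)) 1 x)"
    using R by (intro integral_pd_symmetric[where R = R] r) auto
  then show "(LINT x|lborel. Im (cnj (G 1 x) * G 2 x)) = 0" unfolding e r using i by simp
qed

section \<open>The truncated magnetic potential and the field it generates\<close>

locale flux =
  fixes \<Omega> \<omega> :: "(real^2) set" and \<phi> :: "real^2 \<Rightarrow> real"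
  assumes openO: "open \<Omega>" and openw: "open \<omega>" and bounded_O: "bounded \<Omega>" and w_ne: "\<omega> \<noteq> {}"
    and w_O: "closure \<omega> \<subseteq> \<Omega>"
    and phi_diff: "\<And>x. x \<in> \<Omega> \<Longrightarrow> \<phi> differentiable (at x)"
    and phi_cont: "\<And>k. continuous_on \<Omega> (pd \<phi> k)"
    and phi_eq: "\<And>\<psi>. test_fun \<Omega> \<psi> \<Longrightarrow>
        (LINT x:\<Omega>|lborel. (\<Sum>k\<in>UNIV. pd \<phi> k x * pd \<psi> k x)) =
        2 * pi / measure lborel \<omega> * (LINT x:\<omega>|lborel. \<psi> x)"
begin

text \<open>The potential is truncated to a set \<open>K\<close>: on compact \<open>K \<subseteq> \<Omega>\<close> it is bounded, whereas nothing bounds \<open>pd \<phi>\<close> near \<open>frontier \<Omega>\<close>.\<close>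

definition A :: "(real^2) set \<Rightarrow> real \<Rightarrow> 2 \<Rightarrow> real^2 \<Rightarrow> real" where
  "A K \<Phi> k x = (if x \<in> K then \<Phi> * potF \<phi> k x else 0)"

lemma potF_continuous: "continuous_on \<Omega> (potF \<phi> k)"
  by (cases "k = 1") (auto simp: potF_def intro!: continuous_intros phi_cont)

lemma A_bounded:
  assumes "compact K" "K \<subseteq> \<Omega>"
  shows "A K \<Phi> k \<in> borel_measurable borel" "\<exists>B. \<forall>x. \<bar>A K \<Phi> k x\<bar> \<le> B"
proof -
  have c: "continuous_on K (\<lambda>x. \<Phi> * potF \<phi> k x)"
    using potF_continuous continuous_on_subset assms by (intro continuous_intros) blast
  have "(\<lambda>x. if x \<in> K then \<Phi> * potF \<phi> k x else 0) \<in> borel_measurable borel"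
    by (rule borel_measurable_continuous_on_if[OF _ c]) (use assms in \<open>auto simp: compact_imp_closed\<close>)
  then show "A K \<Phi> k \<in> borel_measurable borel" by (simp add: A_def[abs_def])
  have "compact ((\<lambda>x. \<Phi> * potF \<phi> k x) ` K)" using c assms by (intro compact_continuous_image)
  then obtain B where B: "\<And>x. x \<in> K \<Longrightarrow> \<bar>\<Phi> * potF \<phi> k x\<bar> \<le> B"
    using compact_imp_bounded bounded_iff by (metis imageI real_norm_def)
  then have "\<bar>A K \<Phi> k x\<bar> \<le> max B 0" for x by (auto simp: A_def le_max_iff_disj)
  then show "\<exists>B. \<forall>x. \<bar>A K \<Phi> k x\<bar> \<le> B" by blast
qed

text \<open>The strength of the field per unit of \<Phi>: the curl of \<open>potF \<phi>\<close> is,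
  in the weak sense and up to sign, this constant on \<omega> and 0 elsewhere, with total flux
  \<open>2 * pi\<close>.\<close>

definition beta :: real where "beta = 2 * pi / measure lborel \<omega>"

lemma beta_pos: "beta > 0"
proof -
  obtain x where "x \<in> \<omega>" using w_ne by blast
  then obtain e where e: "e > 0" "ball x e \<subseteq> \<omega>" using openw open_contains_ball by metis
  have "bounded \<omega>"
    by (rule bounded_subset[OF bounded_O]) (use w_O closure_subset in blast)
  then have fm: "\<omega> \<in> fmeasurable lborel"
    using emeasure_bounded_finite openw by (intro fmeasurableI) auto
  have "0 < measure lborel (ball x e)" using content_ball_pos[OF e(1)] .
  also have "\<dots> \<le> measure lborel \<omega>" using fm e(2) by (intro measure_mono_fmeasurable) auto
  finally show ?thesis unfolding beta_def by simp
qed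

lemma magnetic_C1c:
  assumes v: "C1c v G" and K: "compact K" "K \<subseteq> \<Omega>" "\<And>x. x \<notin> K \<Longrightarrow> v x = 0" and Phi: "\<Phi> \<ge> 0"
  shows "\<Phi> * beta * (LINT x|lborel. indicator \<omega> x * (cmod (v x))\<^sup>2) \<le>
    (LINT x|lborel. (\<Sum>k\<in>UNIV. (cmod (G k x - \<i> * (A K \<Phi> k x) * v x))\<^sup>2))"
proof -
  define D where "D k x = G k x - \<i> * (A K \<Phi> k x) * v x" for k x
  have G0: "x \<notin> K \<Longrightarrow> G k x = 0" for k x by (rule C1c_grad_outside[OF v K(1,3)])
  have sv: "sq_int v" "sq_int (G k)" for k using C1c_sq_int[OF v] by auto
  have sD: "sq_int (D k)" for k
  proof -
    obtain B where B: "\<And>x. \<bar>A K \<Phi> k x\<bar> \<le> B" using A_bounded[OF K(1,2)] by blast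
    have "sq_int (\<lambda>x. \<i> * (A K \<Phi> k x) * v x)"
      using A_bounded(1)[OF K(1,2)] B by (intro sq_int_mult_bounded[OF sv(1), where B = B]) (auto simp: norm_mult)
    then show ?thesis unfolding D_def by (intro sq_int_diff sv)
  qed
  let ?q = "\<lambda>x. (cmod (v x))\<^sup>2"
  have tf: "test_fun \<Omega> ?q" unfolding test_fun_iff using C1c_cmod_sq(1)[OF v] K by (intro conjI exI[of _ K]) auto
  have pq: "pd ?q k x = 2 * Re (cnj (v x) * G k x)" for k x by (rule C1c_cmod_sq(2)[OF v])
  \<comment> \<open>The terms quadratic in the potential are real and drop out of the imaginary
    part; the mixed terms assemble to the scalar product of the gradients of \<phi> and of
    \<open>?q\<close>, which is what the equation for \<phi> evaluates.\<close>
  have point: "2 * Im (cnj (D 1 x) * D 2 x) = 2 * Im (cnj (G 1 x) * G 2 x)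
      - \<Phi> * (indicator \<Omega> x * (\<Sum>k\<in>UNIV. pd \<phi> k x * pd ?q k x))" for x
  proof (cases "x \<in> K")
    case True
    then have "x \<in> \<Omega>" using K by auto
    then show ?thesis using True
      unfolding D_def A_def potF_def pq UNIV_2 by (simp add: algebra_simps)
  next
    case False
    then show ?thesis unfolding D_def pq using G0 K by simp
  qed
  have i1: "integrable lborel (\<lambda>x. Im (cnj (D 1 x) * D 2 x))"
    using sD by (intro integrable_Im sq_int_mult_integrable sq_int_cnj)
  note i2 = Im_cnj_gradient_integral_eq_0[OF v]
  have i3: "integrable lborel (\<lambda>x. \<Phi> * (indicator \<Omega> x * (\<Sum>k\<in>UNIV. pd \<phi> k x * pd ?q k x)))"
  proof -
    have "(\<lambda>x. \<Phi> * (indicator \<Omega> x * (\<Sum>k\<in>UNIV. pd \<phi> k x * pd ?q k x))) =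
      (\<lambda>x. 2 * Im (cnj (G 1 x) * G 2 x) - 2 * Im (cnj (D 1 x) * D 2 x))"
      using point by (auto simp: fun_eq_iff)
    then show ?thesis using i1 i2(1) by (simp only: Bochner_Integration.integrable_diff integrable_mult_right)
  qed
  have "(LINT x|lborel. 2 * Im (cnj (D 1 x) * D 2 x)) = - \<Phi> * (LINT x|lborel. indicator \<Omega> x * (\<Sum>k\<in>UNIV. pd \<phi> k x * pd ?q k x))"
    unfolding point Bochner_Integration.integral_diff[OF integrable_mult_right[OF i2(1)] i3]
    by (simp only: integral_mult_right_zero i2(2))
  also have "(LINT x|lborel. indicator \<Omega> x * (\<Sum>k\<in>UNIV. pd \<phi> k x * pd ?q k x)) = beta * (LINT x|lborel. indicator \<omega> x * ?q x)"
    using phi_eq[OF tf] by (simp add: set_lebesgue_integral_def beta_def)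
  finally have "\<Phi> * beta * (LINT x|lborel. indicator \<omega> x * ?q x) = - (LINT x|lborel. 2 * Im (cnj (D 1 x) * D 2 x))"
    by simp
  also have "\<dots> = (LINT x|lborel. - 2 * Im (cnj (D 1 x) * D 2 x))"
    unfolding integral_minus[symmetric] by (simp only: mult_minus_left)
  also have "\<dots> \<le> (LINT x|lborel. (\<Sum>k\<in>UNIV. (cmod (D k x))\<^sup>2))"
  proof (rule integral_mono)
    show "integrable lborel (\<lambda>x. - 2 * Im (cnj (D 1 x) * D 2 x))" using i1 by (rule integrable_mult_right)
    show "integrable lborel (\<lambda>x. \<Sum>k\<in>UNIV. (cmod (D k x))\<^sup>2)" using sD by auto
    show "- 2 * Im (cnj (D 1 x) * D 2 x) \<le> (\<Sum>k\<in>UNIV. (cmod (D k x))\<^sup>2)" for x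
    proof -
      have "\<bar>Im (cnj (D 1 x) * D 2 x)\<bar> \<le> cmod (D 1 x) * cmod (D 2 x)"
        using abs_Im_le_cmod[of "cnj (D 1 x) * D 2 x"] by (simp add: norm_mult)
      then show ?thesis using sum_squares_bound[of "cmod (D 1 x)" "cmod (D 2 x)"] unfolding UNIV_2 by simp
    qed
  qed
  finally show ?thesis unfolding D_def .
qed

end

text \<open>The room between a compact set and an open set containing it, into which mollification
  may spread a support.\<close>

lemma compact_neighbourhood:
  fixes K0 :: "'a::euclidean_space set"
  assumes "compact K0" "open U" "K0 \<subseteq> U"
  obtains e K where "e > 0" "compact K" "K0 \<subseteq> K" "K \<subseteq> U" "\<And>x y. y \<in> K0 \<Longrightarrow> dist y x \<le> e \<Longrightarrow> x \<in> K"
proof -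
  obtain e where e: "e > 0" "(\<Union>x\<in>K0. cball x e) \<subseteq> U"
    using compact_subset_open_imp_cball_epsilon_subset[OF assms] by blast
  have eq: "(\<Union>x\<in>K0. cball x e) = {x + y | x y. x \<in> K0 \<and> y \<in> cball 0 e}"
  proof (intro set_eqI iffI)
    fix z assume "z \<in> (\<Union>x\<in>K0. cball x e)"
    then obtain x where "x \<in> K0" "dist x z \<le> e" by auto
    then show "z \<in> {x + y | x y. x \<in> K0 \<and> y \<in> cball 0 e}"
      by (intro CollectI exI[of _ x] exI[of _ "z - x"]) (auto simp: dist_norm norm_minus_commute)
  next
    fix z assume "z \<in> {x + y | x y. x \<in> K0 \<and> y \<in> cball 0 e}"
    then obtain x y where "x \<in> K0" "norm y \<le> e" "z = x + y" by auto
    then show "z \<in> (\<Union>x\<in>K0. cball x e)" by (intro UN_I[of x]) (auto simp: dist_norm)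
  qed
  have "compact (\<Union>x\<in>K0. cball x e)" unfolding eq by (intro compact_sums assms compact_cball)
  then show ?thesis using that[OF e(1), of "\<Union>x\<in>K0. cball x e"] e by (force simp: less_imp_le)
qed

text \<open>Mollification with radii at most \<open>e\<close> keeps all approximants inside one
  compact \<open>K\<close> in \<open>U\<close>. A common compact set matters because the truncated
  potential must be bounded along the whole sequence.\<close>

lemma H1_approx:
  assumes v: "H1grad UNIV v G" and K0: "compact K0" "K0 \<subseteq> U" "open U"
    and supp: "\<And>x. x \<notin> K0 \<Longrightarrow> v x = 0" "\<And>x k. x \<notin> K0 \<Longrightarrow> G k x = 0"
  obtains K V W where "compact K" "K0 \<subseteq> K" "K \<subseteq> U" "\<And>n. C1c (V n) (W n)" "\<And>n x. x \<notin> K \<Longrightarrow> V n x = 0"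
    "l2_lim V v" "\<And>k. l2_lim (\<lambda>n. W n k) (G k)"
proof -
  obtain e K where e: "e > 0" and K: "compact K" "K0 \<subseteq> K" "K \<subseteq> U"
    and near: "\<And>x y. y \<in> K0 \<Longrightarrow> dist y x \<le> e \<Longrightarrow> x \<in> K"
    using compact_neighbourhood[OF K0(1,3,2)] by metis
  obtain R where R: "\<And>x. x \<in> K0 \<Longrightarrow> norm x \<le> R" using K0(1) compact_imp_bounded bounded_iff by metis
  have R0: "\<And>x. norm x > R \<Longrightarrow> v x = 0" "\<And>x k. norm x > R \<Longrightarrow> G k x = 0" using R supp by (metis not_le)+
  define r where "r n = e * inverse (real (Suc n))" for n
  have r: "r n > 0" "r n \<le> e" for n
    using e inverse_Suc_null_sequence(3)[of n] by (auto simp: r_def mult_left_le)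
  have rl: "r \<longlonglongrightarrow> 0" unfolding r_def by (rule tendsto_mult_right_zero[OF inverse_Suc_null_sequence(1)])
  have s: "sq_int v" "sq_int (G k)" for k using v by (auto simp: H1grad_def L2_iff)
  have vi: "integrable lborel v" by (rule sq_int_integrable[OF s(1) R0(1)])
  show ?thesis
  proof (rule that[OF K, of "\<lambda>n. mollify (r n) v" "\<lambda>n k. mollify (r n) (G k)"])
    show "C1c (mollify (r n) v) (\<lambda>k. mollify (r n) (G k))" for n
      by (rule mollify_weak_grad[OF v R0 r(1)])
    show "l2_lim (\<lambda>n. mollify (r n) v) v" by (rule l2_lim_mollify[OF s(1) R0(1) r(1) rl])
    show "l2_lim (\<lambda>n. mollify (r n) (G k)) (G k)" for k by (rule l2_lim_mollify[OF s(2) R0(2) r(1) rl])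
    show "mollify (r n) v x = 0" if "x \<notin> K" for n x
    proof (rule mollify_eq_0[OF r(1) vi])
      fix y assume "dist x y < r n"
      then have "dist y x \<le> e" using r(2)[of n] by (simp add: dist_commute)
      then show "v y = 0" using near that supp(1) by blast
    qed
  qed
qed

text \<open>This is \<i> times the magnetic gradient formed with \<open>- \<i> * G k x\<close> in
  \<open>mag_energy\<close>; the moduli agree, and the real part of
  \<open>cnj (v x) * mgrad a v G k x\<close> is that of \<open>cnj (v x) * G k x\<close>.\<close>

definition mgrad :: "(2 \<Rightarrow> real^2 \<Rightarrow> real) \<Rightarrow> (real^2 \<Rightarrow> complex) \<Rightarrow> (2 \<Rightarrow> real^2 \<Rightarrow> complex) \<Rightarrow> 2 \<Rightarrow> real^2 \<Rightarrow> complex" where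
  "mgrad a v G k x = G k x - \<i> * a k x * v x"

definition mdens :: "(2 \<Rightarrow> real^2 \<Rightarrow> real) \<Rightarrow> (real^2 \<Rightarrow> complex) \<Rightarrow> (2 \<Rightarrow> real^2 \<Rightarrow> complex) \<Rightarrow> real^2 \<Rightarrow> real" where
  "mdens a v G x = (\<Sum>k\<in>UNIV. (cmod (mgrad a v G k x))\<^sup>2)"

lemma sq_int_mgrad:
  assumes "sq_int v" "\<And>k. sq_int (G k)" "\<And>k. a k \<in> borel_measurable borel" "\<And>k x. \<bar>a k x\<bar> \<le> B"
  shows "sq_int (mgrad a v G k)"
proof -
  have "sq_int (\<lambda>x. \<i> * (a k x) * v x)"
    using assms by (intro sq_int_mult_bounded[OF assms(1), where B = B]) (auto simp: norm_mult)
  then show ?thesis unfolding mgrad_def[abs_def] by (intro sq_int_diff assms)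
qed

lemma mdens_integrable:
  assumes "\<And>k. sq_int (mgrad a v G k)"
  shows "integrable lborel (mdens a v G)"
  unfolding mdens_def[abs_def] using assms by auto

text \<open>Multiplication by a bounded potential is continuous in the mean, so energies converge
  along approximations of \<open>v\<close> and \<open>G\<close>.\<close>

lemma mdens_limit:
  assumes "l2_lim V v" "\<And>k. l2_lim (\<lambda>n. W n k) (G k)"
    "\<And>k. a k \<in> borel_measurable borel" "\<And>k x. \<bar>a k x\<bar> \<le> B"
  shows "(\<lambda>n. LINT x|lborel. mdens a (V n) (W n) x) \<longlonglongrightarrow> (LINT x|lborel. mdens a v G x)"
proof -
  have sV: "sq_int (V n)" "sq_int v" "sq_int (W n k)" "sq_int (G k)" for n k
    using assms(1) assms(2)[of k] by (auto simp: l2_lim_def)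
  have l: "l2_lim (\<lambda>n. mgrad a (V n) (W n) k) (mgrad a v G k)" for k
    unfolding mgrad_def[abs_def]
    using assms(3,4) by (intro l2_lim_diff assms(2) l2_lim_mult_bounded[OF assms(1), where B = B]) (auto simp: norm_mult)
  have i: "integrable lborel (\<lambda>x. (cmod (mgrad a (V n) (W n) k x))\<^sup>2)" "integrable lborel (\<lambda>x. (cmod (mgrad a v G k x))\<^sup>2)" for n k
    using l[of k] by (auto simp: l2_lim_def)
  have "(\<lambda>n. \<Sum>k\<in>UNIV. LINT x|lborel. (cmod (mgrad a (V n) (W n) k x))\<^sup>2) \<longlonglongrightarrow> (\<Sum>k\<in>UNIV. LINT x|lborel. (cmod (mgrad a v G k x))\<^sup>2)"
  proof (intro tendsto_sum)
    fix k
    have "(\<lambda>n. LINT x|lborel. 1 * (cmod (mgrad a (V n) (W n) k x))\<^sup>2) \<longlonglongrightarrow> (LINT x|lborel. 1 * (cmod (mgrad a v G k x))\<^sup>2)"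
      by (rule l2_lim_weighted[OF l, where B = 1]) auto
    then show "(\<lambda>n. LINT x|lborel. (cmod (mgrad a (V n) (W n) k x))\<^sup>2) \<longlonglongrightarrow> (LINT x|lborel. (cmod (mgrad a v G k x))\<^sup>2)"
      by (simp only: mult_1)
  qed
  then show ?thesis unfolding mdens_def[abs_def] using i by (simp add: Bochner_Integration.integral_sum)
qed

context flux
begin

lemma A_bound_uniform:
  assumes "compact K" "K \<subseteq> \<Omega>"
  shows "\<exists>B. \<forall>k x. \<bar>A K \<Phi> k x\<bar> \<le> B"
proof -
  obtain B1 B2 where "\<forall>x. \<bar>A K \<Phi> 1 x\<bar> \<le> B1" "\<forall>x. \<bar>A K \<Phi> 2 x\<bar> \<le> B2" using A_bounded(2)[OF assms] by meson
  then have "\<bar>A K \<Phi> k x\<bar> \<le> max B1 B2" for k x using exhaust_2[of k] by (auto simp: le_max_iff_disj)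
  then show ?thesis by blast
qed

lemma magnetic_H1:
  assumes v: "H1grad UNIV v G" and K: "compact K" "K \<subseteq> \<Omega>"
    and supp: "\<And>x. x \<notin> K \<Longrightarrow> v x = 0" "\<And>x k. x \<notin> K \<Longrightarrow> G k x = 0" and Phi: "\<Phi> \<ge> 0"
  shows "\<Phi> * beta * (LINT x|lborel. indicator \<omega> x * (cmod (v x))\<^sup>2) \<le> (LINT x|lborel. mdens (A K \<Phi>) v G x)"
proof -
  obtain K' V W where K': "compact K'" "K \<subseteq> K'" "K' \<subseteq> \<Omega>"
    and V: "\<And>n. C1c (V n) (W n)" "\<And>n x. x \<notin> K' \<Longrightarrow> V n x = 0"
    and lim: "l2_lim V v" "\<And>k. l2_lim (\<lambda>n. W n k) (G k)"
    using H1_approx[OF v K openO supp] by metis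
  obtain B where B: "\<And>k x. \<bar>A K' \<Phi> k x\<bar> \<le> B" using A_bound_uniform[OF K'(1,3)] by blast
  have "(\<lambda>n. \<Phi> * beta * (LINT x|lborel. indicator \<omega> x * (cmod (V n x))\<^sup>2)) \<longlonglongrightarrow>
      \<Phi> * beta * (LINT x|lborel. indicator \<omega> x * (cmod (v x))\<^sup>2)"
    using openw by (intro tendsto_mult tendsto_const l2_lim_weighted[OF lim(1), where B = 1] borel_measurable_indicator)
      (auto split: split_indicator)
  moreover have "(\<lambda>n. LINT x|lborel. mdens (A K' \<Phi>) (V n) (W n) x) \<longlonglongrightarrow> (LINT x|lborel. mdens (A K' \<Phi>) v G x)"
    by (rule mdens_limit[OF lim A_bounded(1)[OF K'(1,3)] B])
  moreover have "\<Phi> * beta * (LINT x|lborel. indicator \<omega> x * (cmod (V n x))\<^sup>2) \<le> (LINT x|lborel. mdens (A K' \<Phi>) (V n) (W n) x)" for n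
    unfolding mdens_def mgrad_def by (rule magnetic_C1c[OF V(1) K'(1,3) V(2) Phi])
  ultimately have "\<Phi> * beta * (LINT x|lborel. indicator \<omega> x * (cmod (v x))\<^sup>2) \<le> (LINT x|lborel. mdens (A K' \<Phi>) v G x)"
    by (intro LIMSEQ_le) auto
  also have "mdens (A K' \<Phi>) v G = mdens (A K \<Phi>) v G"
  proof
    fix x
    show "mdens (A K' \<Phi>) v G x = mdens (A K \<Phi>) v G x"
      using K'(2) supp(1)[of x] by (cases "x \<in> K") (auto simp: mdens_def mgrad_def A_def)
  qed
  finally show ?thesis .
qed

end

section \<open>The Hardy inequality\<close>

text \<open>\<open>X / (Q * sqrt Q)\<close> is the derivative of \<open>- 1 / sqrt Q\<close> in
  \<open>X\<close>, and \<open>1 / Q\<close> is the square of that function. For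
  \<open>s \<le> X\<close> one has \<open>Q \<le> 2 * X\<^sup>2\<close>, and \<open>2 / 3\<close> is
  a rational lower bound for \<open>1 / sqrt 2\<close>; for other \<open>X\<close> the derivative
  may be negative, but never below \<open>- 1 / s\<^sup>2\<close>.\<close>

lemma hardy_weight:
  fixes X s :: real assumes s: "s > 0"
  defines "Q \<equiv> X\<^sup>2 + s\<^sup>2"
  shows "Q > 0" "\<bar>X / (Q * sqrt Q)\<bar> \<le> 1 / Q" "1 / Q \<le> 1 / s\<^sup>2"
    "s \<le> X \<Longrightarrow> X / (Q * sqrt Q) \<ge> 2 / 3 * (1 / Q)" "s \<le> X \<Longrightarrow> 1 / Q \<ge> 1 / (2 * X\<^sup>2)"
proof -
  show Q: "Q > 0" unfolding Q_def using s by (intro add_nonneg_pos) auto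
  have "\<bar>X\<bar> \<le> sqrt Q" unfolding Q_def by (rule real_le_rsqrt) simp
  then have "\<bar>X\<bar> / (Q * sqrt Q) \<le> sqrt Q / (Q * sqrt Q)" using Q by (intro divide_right_mono) auto
  then show "\<bar>X / (Q * sqrt Q)\<bar> \<le> 1 / Q" using Q by (simp add: abs_mult)
  show "1 / Q \<le> 1 / s\<^sup>2" unfolding Q_def using s by (intro frac_le) auto
  assume sX: "s \<le> X"
  then have Q2: "Q \<le> 2 * X\<^sup>2" unfolding Q_def using s power_mono[of s X 2] by simp
  then show "1 / Q \<ge> 1 / (2 * X\<^sup>2)" using Q by (intro frac_le) auto
  have "sqrt Q \<le> 3 / 2 * X"
  proof (rule real_le_lsqrt)
    have "Q \<le> 9 / 4 * X\<^sup>2" using Q2 by (rule order_trans) (simp add: mult_right_mono)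
    then show "Q \<le> (3 / 2 * X)\<^sup>2" by (simp add: power_mult_distrib power2_eq_square)
  qed (use sX s Q in auto)
  then have "2 / 3 * sqrt Q / (Q * sqrt Q) \<le> X / (Q * sqrt Q)" using Q by (intro divide_right_mono) auto
  then show "X / (Q * sqrt Q) \<ge> 2 / 3 * (1 / Q)" using Q by simp
qed

lemma hardy_weight_derivative:
  fixes X s :: real assumes s: "s > 0"
  shows "((\<lambda>t. - inverse (sqrt ((X + t)\<^sup>2 + s\<^sup>2))) has_real_derivative X / ((X\<^sup>2 + s\<^sup>2) * sqrt (X\<^sup>2 + s\<^sup>2))) (at 0)"
proof -
  have Q: "X\<^sup>2 + s\<^sup>2 > 0" using hardy_weight(1)[OF s] .
  have 1: "((\<lambda>t. (X + t)\<^sup>2 + s\<^sup>2) has_real_derivative 2 * X) (at 0)"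
    by (auto intro!: derivative_eq_intros)
  have 2: "((\<lambda>t. sqrt ((X + t)\<^sup>2 + s\<^sup>2)) has_real_derivative inverse (sqrt (X\<^sup>2 + s\<^sup>2)) / 2 * (2 * X)) (at 0)"
    using DERIV_chain2[OF _ 1, of sqrt "inverse (sqrt (X\<^sup>2 + s\<^sup>2)) / 2"] DERIV_real_sqrt[OF Q] by simp
  have ne: "sqrt ((X + 0)\<^sup>2 + s\<^sup>2) \<noteq> 0" using Q s by simp
  have "((\<lambda>t. - inverse (sqrt ((X + t)\<^sup>2 + s\<^sup>2))) has_real_derivative
      - (- (inverse (sqrt (X\<^sup>2 + s\<^sup>2)) * (inverse (sqrt (X\<^sup>2 + s\<^sup>2)) / 2 * (2 * X)) * inverse (sqrt (X\<^sup>2 + s\<^sup>2))))) (at 0)"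
    using DERIV_minus[OF DERIV_inverse'[OF 2 ne]] by simp
  moreover have "- (- (inverse (sqrt (X\<^sup>2 + s\<^sup>2)) * (inverse (sqrt (X\<^sup>2 + s\<^sup>2)) / 2 * (2 * X)) * inverse (sqrt (X\<^sup>2 + s\<^sup>2))))
     = X / ((X\<^sup>2 + s\<^sup>2) * sqrt (X\<^sup>2 + s\<^sup>2))"
    using Q by (simp add: field_simps)
  ultimately show ?thesis by simp
qed

text \<open>\<open>f\<close> is the derivative of \<open>Z\<^sup>2 * P * a\<^sup>2\<close>, where
  \<open>d\<close> is the derivative of \<open>Z\<close> and \<open>q\<close> that of
  \<open>a\<^sup>2\<close>. Young's inequality absorbs each of the two mixed terms into a sixth of
  \<open>Z\<^sup>2 * a\<^sup>2 * P\<^sup>2\<close>. Together they take one third of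
  \<open>1 / Q\<close> out of the two thirds that the weight provides for \<open>s \<le> X\<close>,
  and the remaining third is at least \<open>1 / (6 * X\<^sup>2)\<close>.\<close>

lemma hardy_pointwise:
  fixes Z d X s a b q :: real
  assumes s: "s > 0" and ab: "a \<ge> 0" "b \<ge> 0" "\<bar>q\<bar> \<le> 2 * a * b"
  defines "Q \<equiv> X\<^sup>2 + s\<^sup>2"
  defines "P \<equiv> - inverse (sqrt Q)"
  defines "f \<equiv> 2 * Z * d * P * a\<^sup>2 + Z\<^sup>2 * (X / (Q * sqrt Q)) * a\<^sup>2 + Z\<^sup>2 * P * q"
  shows "s \<le> X \<Longrightarrow> f \<ge> Z\<^sup>2 * a\<^sup>2 * (1 / (6 * X\<^sup>2)) - 6 * d\<^sup>2 * a\<^sup>2 - 6 * Z\<^sup>2 * b\<^sup>2"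
    "f \<ge> - (Z\<^sup>2 * a\<^sup>2 * (2 / s\<^sup>2)) - 6 * d\<^sup>2 * a\<^sup>2 - 6 * Z\<^sup>2 * b\<^sup>2"
proof -
  note w = hardy_weight[OF s, of X, folded Q_def]
  have P2: "P\<^sup>2 = 1 / Q"
    unfolding P_def power2_minus power_inverse real_sqrt_pow2[OF less_imp_le[OF w(1)]] by (rule inverse_eq_divide)
  have y: "2 * x * y \<ge> - (x\<^sup>2 / 6 + 6 * y\<^sup>2)" for x y :: real
  proof -
    have "0 \<le> (x / sqrt 6 + sqrt 6 * y)\<^sup>2" by simp
    then show ?thesis by (simp add: power2_sum power_mult_distrib power_divide)
  qed
  have 1: "2 * Z * d * P * a\<^sup>2 \<ge> - (Z\<^sup>2 * a\<^sup>2 * P\<^sup>2 / 6) - 6 * d\<^sup>2 * a\<^sup>2"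
    using y[of "Z * P * a" "d * a"] by (simp add: power_mult_distrib power2_eq_square mult_ac)
  have 2: "Z\<^sup>2 * P * q \<ge> - (Z\<^sup>2 * a\<^sup>2 * P\<^sup>2 / 6) - 6 * Z\<^sup>2 * b\<^sup>2"
  proof -
    have "\<bar>Z\<^sup>2 * P * q\<bar> \<le> Z\<^sup>2 * \<bar>P\<bar> * (2 * a * b)"
      using ab by (simp add: abs_mult mult_left_mono mult.assoc)
    moreover have "Z\<^sup>2 * \<bar>P\<bar> * (2 * a * b) \<le> Z\<^sup>2 * a\<^sup>2 * P\<^sup>2 / 6 + 6 * Z\<^sup>2 * b\<^sup>2"
      using y[of "Z * \<bar>P\<bar> * a" "- Z * b"] by (simp add: power_mult_distrib power2_eq_square mult_ac)
    ultimately show ?thesis by linarith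
  qed
  have 3: "f \<ge> Z\<^sup>2 * a\<^sup>2 * (X / (Q * sqrt Q) - 1 / Q / 3) - 6 * d\<^sup>2 * a\<^sup>2 - 6 * Z\<^sup>2 * b\<^sup>2"
    using 1 2 unfolding f_def P2 by (simp add: algebra_simps)
  have za: "0 \<le> Z\<^sup>2 * a\<^sup>2" by simp
  show "f \<ge> Z\<^sup>2 * a\<^sup>2 * (1 / (6 * X\<^sup>2)) - 6 * d\<^sup>2 * a\<^sup>2 - 6 * Z\<^sup>2 * b\<^sup>2" if "s \<le> X"
  proof -
    have "j / 3 \<le> x - i / 3" if "2 / 3 * i \<le> x" "j \<le> i" for i j x :: real using that by linarith
    from this[OF w(4,5)[OF that]] have "1 / (6 * X\<^sup>2) \<le> X / (Q * sqrt Q) - 1 / Q / 3" by simp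
    from mult_left_mono[OF this za] show ?thesis using 3 by linarith
  qed
  have "- (2 / s\<^sup>2) \<le> X / (Q * sqrt Q) - 1 / Q / 3"
  proof -
    have "- (2 * j) \<le> x - i / 3" if "\<bar>x\<bar> \<le> i" "i \<le> j" "0 \<le> j" for i j x :: real using that by linarith
    from this[OF w(2,3)] show ?thesis by simp
  qed
  from mult_left_mono[OF this za] show "f \<ge> - (Z\<^sup>2 * a\<^sup>2 * (2 / s\<^sup>2)) - 6 * d\<^sup>2 * a\<^sup>2 - 6 * Z\<^sup>2 * b\<^sup>2" using 3 by linarith
qed

lemma hardy_weight_measurable:
  fixes h :: "real^2 \<Rightarrow> real" and p :: "real^2" and r :: real
  assumes h: "continuous_on UNIV h" and s: "s > 0"
  defines "m \<equiv> \<lambda>z. indicator {z \<in> ball p (r / 2). 0 \<le> h z} z / (h z + s)\<^sup>2"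
  shows "m \<in> borel_measurable borel" "\<bar>m z\<bar> \<le> 1 / s\<^sup>2"
proof -
  have e: "{z \<in> ball p (r / 2). 0 \<le> h z} = ball p (r / 2) \<inter> {z. 0 \<le> h z}" by auto
  have "closed {z. 0 \<le> h z}" using h by (intro closed_Collect_le continuous_intros)
  then have "{z \<in> ball p (r / 2). 0 \<le> h z} \<in> sets borel" unfolding e by auto
  then show "m \<in> borel_measurable borel" unfolding m_def
    by (intro borel_measurable_divide borel_measurable_indicator borel_measurable_continuous_onI continuous_intros h)
  show "\<bar>m z\<bar> \<le> 1 / s\<^sup>2" using s unfolding m_def by (auto simp: indicator_def intro!: frac_le power_mono)
qed

text \<open>On the ball of radius \<open>r/2\<close> the localising weight \<open>bump r\<close> is at least \<open>9/16 r\<^sup>4\<close>, and \<open>27/512 = (9/16)\<^sup>2 / 6\<close>;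
  its derivative is at most \<open>8 r\<^sup>3\<close>, and \<open>384 = 6 * 8\<^sup>2\<close>.\<close>

definition hardy_const :: "real \<Rightarrow> real" where
  "hardy_const r = (384 * r ^ 6 + 14 * r ^ 8) / (27 / 512 * r ^ 8)"

text \<open>All differentiation is along \<open>n\<close>, where \<open>h\<close> grows at unit
  speed; in this direction the weight is smooth although \<open>h\<close> is only continuous. Where
  \<open>h\<close> is negative the weight can have the wrong sign, but these points lie in
  \<open>W\<close>, and the loss is charged to the mass there with the factor
  \<open>1 / s\<^sup>2\<close>.\<close>

lemma hardy_C1c:
  fixes n p :: "real^2" and h :: "real^2 \<Rightarrow> real"
  assumes v: "C1c v G" and a: "\<And>k. a k \<in> borel_measurable borel" "\<And>k x. \<bar>a k x\<bar> \<le> B"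
    and n: "\<And>k. \<bar>n $ k\<bar> \<le> 1" and h: "continuous_on UNIV h" "\<And>z t. h (z + t *\<^sub>R n) = h z + t"
    and r: "r > 0" and s: "s > 0" and W: "W \<in> sets borel" "\<And>z. z \<in> ball p r \<Longrightarrow> h z < 0 \<Longrightarrow> z \<in> W"
  shows "(LINT z|lborel. indicator {z \<in> ball p (r / 2). 0 \<le> h z} z / (h z + s)\<^sup>2 * (cmod (v z))\<^sup>2) \<le>
    hardy_const r * ((LINT z|lborel. mdens a v G z) + (LINT z|lborel. (cmod (v z))\<^sup>2)
      + 1 / s\<^sup>2 * (LINT z|lborel. indicator W z * (cmod (v z))\<^sup>2))"
proof -
  define Z where "Z z = bump r (z - p)" for z
  define d where "d z = bump_deriv r (z - p) n" for z
  define X where "X z = h z + s" for z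
  define Q where "Q z = (X z)\<^sup>2 + s\<^sup>2" for z
  define P where "P z = - inverse (sqrt (Q z))" for z
  define q where "q z = (\<Sum>k\<in>UNIV. n $ k * (2 * Re (cnj (v z) * G k z)))" for z
  define f where "f z = (Z z)\<^sup>2 * P z * (cmod (v z))\<^sup>2" for z
  define f' where "f' z = 2 * Z z * d z * P z * (cmod (v z))\<^sup>2 + (Z z)\<^sup>2 * (X z / (Q z * sqrt (Q z))) * (cmod (v z))\<^sup>2 + (Z z)\<^sup>2 * P z * q z" for z
  have Q: "Q z > 0" for z unfolding Q_def by (rule hardy_weight(1)[OF s])
  have sv: "sq_int v" "sq_int (G k)" for k using C1c_sq_int[OF v] by auto
  have sD: "sq_int (mgrad a v G k)" for k by (rule sq_int_mgrad[OF sv a])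
  have mi: "integrable lborel (mdens a v G)" by (rule mdens_integrable[OF sD])
  have cv: "continuous_on UNIV v" "continuous_on UNIV (G k)" for k using v C1c_continuous by (auto simp: C1c_def)
  have cX: "continuous_on UNIV X" unfolding X_def using h by (intro continuous_intros)
  have cQ: "continuous_on UNIV Q" unfolding Q_def using cX by (intro continuous_intros)
  have cP: "continuous_on UNIV P" unfolding P_def using cQ Q by (intro continuous_intros) (auto simp: less_imp_neq[symmetric])
  have cZ: "continuous_on UNIV Z" "continuous_on UNIV d" unfolding Z_def d_def by (intro continuous_intros)+
  have cq: "continuous_on UNIV q" unfolding q_def using cv by (intro continuous_intros)
  have cf: "continuous_on UNIV f" unfolding f_def using cZ cP cv by (intro continuous_intros)
  have cf': "continuous_on UNIV f'" unfolding f'_def using cZ cP cv cq cX cQ Q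
    by (intro continuous_intros) (auto simp: less_imp_neq[symmetric])
  have Z0: "Z z = 0" "d z = 0" if "z \<notin> ball p r" for z
    using that r by (auto simp: Z_def d_def dist_norm norm_minus_commute intro!: bump_outside bump_deriv_outside)
  have far: "z \<notin> ball p r" if "norm z > norm p + r" for z
    using that norm_triangle_sub[of z p] by (auto simp: dist_norm norm_minus_commute)
  have f0: "f z = 0" "f' z = 0" if "norm z > norm p + r" for z
    using Z0[OF far[OF that]] by (auto simp: f_def f'_def)
  obtain B' where B': "\<And>z. \<bar>f' z\<bar> \<le> B'"
    using continuous_compact_support_bounded_ex[OF cf' f0(2)] by auto
  have deriv: "((\<lambda>t. f (z + t *\<^sub>R n)) has_real_derivative f' z) (at 0)" for z
  proof -
    have dl: "((\<lambda>t. z + t *\<^sub>R n) has_derivative (\<lambda>t. t *\<^sub>R n)) (at 0)" by (auto intro!: derivative_eq_intros)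
    have dl': "((\<lambda>t. z + t *\<^sub>R n - p) has_derivative (\<lambda>t. t *\<^sub>R n)) (at 0)" by (auto intro!: derivative_eq_intros)
    interpret bl: bounded_linear "bump_deriv r w" for w :: "real^2" by (rule linear_bump_deriv)
    have "((\<lambda>t. bump r (z + t *\<^sub>R n - p)) has_derivative (\<lambda>t. t * d z)) (at 0)"
      using has_derivative_compose[OF dl' has_derivative_bump[OF r]] by (simp add: bl.scaleR d_def)
    then have D1: "((\<lambda>t. Z (z + t *\<^sub>R n)) has_real_derivative d z) (at 0)"
      unfolding has_field_derivative_def Z_def by (rule has_derivative_eq_rhs) (simp add: fun_eq_iff mult.commute)
    have D2: "((\<lambda>t. P (z + t *\<^sub>R n)) has_real_derivative X z / (Q z * sqrt (Q z))) (at 0)"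
      using hardy_weight_derivative[OF s, of "X z"] unfolding P_def Q_def X_def h(2) by (simp add: add_ac)
    have "((\<lambda>z. (cmod (v z))\<^sup>2) has_derivative (\<lambda>h. \<Sum>k\<in>UNIV. h $ k * (2 * Re (cnj (v z) * G k z)))) (at (z + 0 *\<^sub>R n))"
      using has_derivative_pd[of "\<lambda>z. (cmod (v z))\<^sup>2" z] C1c_cmod_sq[OF v] by (simp add: C1_fun_def)
    from has_derivative_compose[OF dl this]
    have "((\<lambda>t. (cmod (v (z + t *\<^sub>R n)))\<^sup>2) has_derivative (\<lambda>t. t * q z)) (at 0)"
      by (simp add: q_def sum_distrib_left mult.assoc)
    then have D3: "((\<lambda>t. (cmod (v (z + t *\<^sub>R n)))\<^sup>2) has_real_derivative q z) (at 0)"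
      unfolding has_field_derivative_def by (rule has_derivative_eq_rhs) (simp add: fun_eq_iff mult.commute)
    show ?thesis unfolding f_def
      by (rule DERIV_cong[OF DERIV_mult[OF DERIV_mult[OF DERIV_power[OF D1, of 2] D2] D3]])
        (simp add: f'_def algebra_simps)
  qed
  have z: "integrable lborel f'" "(LINT z|lborel. f' z) = 0"
    using integral_directional_derivative_eq_0[OF deriv cf B' f0(1)] by auto
  let ?m = "\<lambda>z. indicator {z \<in> ball p (r / 2). 0 \<le> h z} z / (h z + s)\<^sup>2"
  let ?c = "27 / 512 * r ^ 8"
  let ?C = "384 * r ^ 6 + 14 * r ^ 8"
  have point: "?c * (?m z * (cmod (v z))\<^sup>2) \<le> f' z + ?C * (mdens a v G z + (cmod (v z))\<^sup>2 + 1 / s\<^sup>2 * (indicator W z * (cmod (v z))\<^sup>2))" for z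
  proof (cases "z \<in> ball p r")
    case False
    then have "z \<notin> ball p (r / 2)" using r by auto
    moreover have "f' z = 0" using Z0[OF False] by (simp add: f'_def)
    moreover have "0 \<le> mdens a v G z" by (simp add: mdens_def sum_nonneg)
    ultimately show ?thesis using r by (simp add: mult_nonneg_nonneg add_nonneg_nonneg)
  next
    case True
    define b where "b = (\<Sum>k\<in>UNIV. cmod (mgrad a v G k z))"
    have b0: "b \<ge> 0" by (simp add: b_def sum_nonneg)
    have b2: "b\<^sup>2 \<le> 2 * mdens a v G z"
      unfolding b_def mdens_def UNIV_2
      using sum_squares_bound[of "cmod (mgrad a v G 1 z)" "cmod (mgrad a v G 2 z)"] by (simp add: power2_sum)
    \<comment> \<open>After multiplication by \<open>cnj (v z)\<close> the contribution of the
      potential is purely imaginary, so the plain gradient may be exchanged for the magnetic one.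
      This is why no bound on \<open>a\<close> enters the constant.\<close>
    have qb: "\<bar>q z\<bar> \<le> 2 * cmod (v z) * b"
    proof -
      have "Re (cnj (v z) * G k z) = Re (cnj (v z) * mgrad a v G k z)" for k
        by (simp add: mgrad_def algebra_simps)
      then have "q z = (\<Sum>k\<in>UNIV. n $ k * (2 * Re (cnj (v z) * mgrad a v G k z)))" by (simp add: q_def)
      also have "\<bar>\<dots>\<bar> \<le> (\<Sum>k\<in>UNIV. \<bar>n $ k * (2 * Re (cnj (v z) * mgrad a v G k z))\<bar>)" by (rule sum_abs)
      also have "\<dots> \<le> (\<Sum>k\<in>UNIV. 2 * cmod (v z) * cmod (mgrad a v G k z))"
      proof (rule sum_mono)
        fix k
        have "\<bar>n $ k\<bar> * \<bar>Re (cnj (v z) * mgrad a v G k z)\<bar> \<le> 1 * cmod (cnj (v z) * mgrad a v G k z)"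
          by (intro mult_mono n abs_Re_le_cmod) auto
        moreover have "\<bar>c * (2 * x)\<bar> \<le> 2 * y" if "\<bar>c\<bar> * \<bar>x\<bar> \<le> 1 * y" for c x y :: real
          using that by (simp add: abs_mult)
        ultimately have "\<bar>n $ k * (2 * Re (cnj (v z) * mgrad a v G k z))\<bar> \<le> 2 * cmod (cnj (v z) * mgrad a v G k z)" by blast
        then show "\<bar>n $ k * (2 * Re (cnj (v z) * mgrad a v G k z))\<bar> \<le> 2 * cmod (v z) * cmod (mgrad a v G k z)"
          by (simp only: norm_mult complex_mod_cnj mult.assoc)
      qed
      finally show ?thesis by (simp add: b_def sum_distrib_left)
    qed
    note hp = hardy_pointwise[OF s norm_ge_zero b0 qb, where Z = "Z z" and d = "d z" and X = "X z",
        folded Q_def, folded P_def, folded f'_def]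
    have Zb: "0 \<le> Z z" "Z z \<le> r ^ 4" using bump_le[OF r] by (auto simp: Z_def)
    then have Z2: "(Z z)\<^sup>2 \<le> r ^ 8" using power_mono[of "Z z" "r ^ 4" 2] by (simp flip: power_mult)
    have nn: "norm n \<le> 2" using norm_le_l1_cart[of n] n[of 1] n[of 2] by (simp add: UNIV_2)
    have "\<bar>d z\<bar> \<le> 4 * r ^ 3 * norm n" unfolding d_def by (rule bump_deriv_le[OF r])
    also have "\<dots> \<le> 4 * r ^ 3 * 2" using nn r by (intro mult_left_mono) auto
    finally have "\<bar>d z\<bar>\<^sup>2 \<le> (4 * r ^ 3 * 2)\<^sup>2" by (intro power_mono) auto
    then have d2: "(d z)\<^sup>2 \<le> 64 * r ^ 6" by (simp add: power_mult_distrib flip: power_mult)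
    let ?a = "(cmod (v z))\<^sup>2"
    have e1: "6 * (d z)\<^sup>2 * ?a \<le> 384 * r ^ 6 * ?a" using d2 by (intro mult_right_mono) auto
    have e2: "6 * (Z z)\<^sup>2 * b\<^sup>2 \<le> 6 * r ^ 8 * (2 * mdens a v G z)" using Z2 b2 by (intro mult_mono) auto
    have md: "0 \<le> mdens a v G z" by (simp add: mdens_def sum_nonneg)
    have r8: "0 \<le> r ^ 6" "0 \<le> r ^ 8" using r by auto
    let ?w = "1 / s\<^sup>2 * (indicator W z * ?a)"
    \<comment> \<open>In \<open>14 = 12 + 2\<close> the 12 comes from
      \<open>b\<^sup>2 \<le> 2 * mdens a v G z\<close> with the factor 6, and the 2 from the weight
      at negative height. One constant majorises the coefficients of all three terms.\<close>
    have e3: "6 * (d z)\<^sup>2 * ?a + 6 * (Z z)\<^sup>2 * b\<^sup>2 + 2 * r ^ 8 * ?w \<le> ?C * (mdens a v G z + ?a + ?w)"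
    proof -
      have nn: "0 \<le> r ^ 6 * mdens a v G z" "0 \<le> r ^ 8 * mdens a v G z" "0 \<le> r ^ 8 * ?a" "0 \<le> r ^ 6 * ?w" "0 \<le> r ^ 8 * ?w"
        using md r8 by (intro mult_nonneg_nonneg; simp)+
      have "?C * (mdens a v G z + ?a + ?w) = 384 * (r ^ 6 * mdens a v G z) + 14 * (r ^ 8 * mdens a v G z)
          + (384 * r ^ 6 * ?a + 14 * (r ^ 8 * ?a)) + (384 * (r ^ 6 * ?w) + 14 * (r ^ 8 * ?w))"
        by (simp only: distrib_left distrib_right mult.assoc)
      moreover have "6 * (Z z)\<^sup>2 * b\<^sup>2 \<le> 12 * (r ^ 8 * mdens a v G z)" using e2 by simp
      moreover have "2 * r ^ 8 * ?w = 2 * (r ^ 8 * ?w)" by (rule mult.assoc)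
      ultimately show ?thesis using e1 nn by linarith
    qed
    show ?thesis
    proof (cases "0 \<le> h z")
      case True
      have "?c * (?m z * ?a) \<le> (Z z)\<^sup>2 * ?a * (1 / (6 * (X z)\<^sup>2))"
      proof (cases "z \<in> ball p (r / 2)")
        case z2: True
        have "(z - p) \<bullet> (z - p) \<le> (r / 2)\<^sup>2"
          unfolding dot_square_norm using z2 by (intro power_mono) (auto simp: dist_norm norm_minus_commute)
        then have "(z - p) \<bullet> (z - p) \<le> r\<^sup>2 / 4" by (simp add: power_divide)
        then have "3 / 4 * r\<^sup>2 \<le> r\<^sup>2 - (z - p) \<bullet> (z - p)" by linarith
        then have "3 / 4 * r\<^sup>2 \<le> max 0 (r\<^sup>2 - (z - p) \<bullet> (z - p))" by (rule order_trans) simp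
        then have "(3 / 4 * r\<^sup>2)\<^sup>2 \<le> Z z" unfolding Z_def bump_def by (intro power_mono) auto
        then have "((3 / 4 * r\<^sup>2)\<^sup>2)\<^sup>2 \<le> (Z z)\<^sup>2" by (intro power_mono) auto
        then have "81 / 256 * r ^ 8 \<le> (Z z)\<^sup>2" by (simp add: power_mult_distrib power_divide flip: power_mult)
        then have "81 / 256 * r ^ 8 * (?a * (1 / (6 * (X z)\<^sup>2))) \<le> (Z z)\<^sup>2 * (?a * (1 / (6 * (X z)\<^sup>2)))"
          by (intro mult_right_mono) auto
        moreover have "?m z = 1 / (X z)\<^sup>2" using True z2 by (simp add: X_def)
        ultimately show ?thesis by (simp add: mult_ac)
      next
        case False
        then show ?thesis by simp
      qed
      also have "\<dots> \<le> f' z + 6 * (d z)\<^sup>2 * ?a + 6 * (Z z)\<^sup>2 * b\<^sup>2" using hp(1) True by (simp add: X_def)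
      also have "\<dots> \<le> f' z + ?C * (mdens a v G z + ?a + 1 / s\<^sup>2 * (indicator W z * ?a))"
      proof -
        have "0 \<le> 2 * r ^ 8 * (1 / s\<^sup>2 * (indicator W z * ?a))" using r8 by simp
        then show ?thesis using e3 by linarith
      qed
      finally show ?thesis .
    next
      case False
      then have "indicator W z = (1::real)" using W(2)[OF \<open>z \<in> ball p r\<close>] by simp
      then have "(Z z)\<^sup>2 * ?a * (2 / s\<^sup>2) \<le> 2 * r ^ 8 * (1 / s\<^sup>2 * (indicator W z * ?a))"
        using mult_right_mono[OF Z2, of "?a * (2 / s\<^sup>2)"] by (simp add: mult_ac)
      then have "0 \<le> f' z + ?C * (mdens a v G z + ?a + 1 / s\<^sup>2 * (indicator W z * ?a))"
        using hp(2) e3 by linarith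
      then show ?thesis using False by simp
    qed
  qed
  have mW: "indicator W \<in> borel_measurable borel" using W(1) by simp
  have iW: "integrable lborel (\<lambda>z. indicator W z * (cmod (v z))\<^sup>2)"
    by (rule sq_int_weight_integrable[OF sv(1) mW, where B = 1]) (auto simp: indicator_def)
  have iR: "integrable lborel (\<lambda>z. mdens a v G z + (cmod (v z))\<^sup>2 + 1 / s\<^sup>2 * (indicator W z * (cmod (v z))\<^sup>2))"
    using mi sv iW by (intro Bochner_Integration.integrable_add integrable_mult_right) auto
  note m = hardy_weight_measurable[OF h(1) s, where p = p and r = r]
  have "?c * (LINT z|lborel. ?m z * (cmod (v z))\<^sup>2) = (LINT z|lborel. ?c * (?m z * (cmod (v z))\<^sup>2))"
    by (rule integral_mult_right_zero[symmetric])
  also have "\<dots> \<le> (LINT z|lborel. f' z + ?C * (mdens a v G z + (cmod (v z))\<^sup>2 + 1 / s\<^sup>2 * (indicator W z * (cmod (v z))\<^sup>2)))"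
    by (intro integral_mono point integrable_mult_right sq_int_weight_integrable[OF sv(1) m]
        Bochner_Integration.integrable_add[OF z(1)] iR)
  also have "\<dots> = ?C * (LINT z|lborel. mdens a v G z + (cmod (v z))\<^sup>2 + 1 / s\<^sup>2 * (indicator W z * (cmod (v z))\<^sup>2))"
    using z iR by (subst Bochner_Integration.integral_add) auto
  also have "(LINT z|lborel. mdens a v G z + (cmod (v z))\<^sup>2 + 1 / s\<^sup>2 * (indicator W z * (cmod (v z))\<^sup>2)) =
     (LINT z|lborel. mdens a v G z) + (LINT z|lborel. (cmod (v z))\<^sup>2) + 1 / s\<^sup>2 * (LINT z|lborel. indicator W z * (cmod (v z))\<^sup>2)"
  proof -
    have j: "integrable lborel (\<lambda>z. (cmod (v z))\<^sup>2)" using sv by simp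
    show ?thesis
      by (simp only: Bochner_Integration.integral_add[OF Bochner_Integration.integrable_add[OF mi j] integrable_mult_right[OF iW]]
          Bochner_Integration.integral_add[OF mi j] integral_mult_right_zero)
  qed
  finally show ?thesis using r unfolding hardy_const_def by (simp add: field_simps)
qed

lemma hardy_H1:
  fixes n p :: "real^2" and h :: "real^2 \<Rightarrow> real"
  assumes v: "H1grad UNIV v G" and K: "compact K" "\<And>x. x \<notin> K \<Longrightarrow> v x = 0" "\<And>x k. x \<notin> K \<Longrightarrow> G k x = 0"
    and a: "\<And>k. a k \<in> borel_measurable borel" "\<And>k x. \<bar>a k x\<bar> \<le> B"
    and n: "\<And>k. \<bar>n $ k\<bar> \<le> 1" and h: "continuous_on UNIV h" "\<And>z t. h (z + t *\<^sub>R n) = h z + t"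
    and r: "r > 0" and s: "s > 0" and W: "W \<in> sets borel" "\<And>z. z \<in> ball p r \<Longrightarrow> h z < 0 \<Longrightarrow> z \<in> W"
  shows "(LINT z|lborel. indicator {z \<in> ball p (r / 2). 0 \<le> h z} z / (h z + s)\<^sup>2 * (cmod (v z))\<^sup>2) \<le>
    hardy_const r * ((LINT z|lborel. mdens a v G z) + (LINT z|lborel. (cmod (v z))\<^sup>2)
      + 1 / s\<^sup>2 * (LINT z|lborel. indicator W z * (cmod (v z))\<^sup>2))"
proof -
  obtain K' V D where V: "\<And>n. C1c (V n) (D n)"
    and lim: "l2_lim V v" "\<And>k. l2_lim (\<lambda>n. D n k) (G k)"
    using H1_approx[OF v K(1) subset_UNIV open_UNIV K(2,3)] by metis
  let ?m = "\<lambda>z. indicator {z \<in> ball p (r / 2). 0 \<le> h z} z / (h z + s)\<^sup>2"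
  note m = hardy_weight_measurable[OF h(1) s, where p = p and r = r]
  have one: "(\<lambda>n. LINT z|lborel. (cmod (V n z))\<^sup>2) \<longlonglongrightarrow> (LINT z|lborel. (cmod (v z))\<^sup>2)"
    using l2_lim_weighted[OF lim(1), of "\<lambda>_. 1" 1] by simp
  have wW: "(\<lambda>n. LINT z|lborel. indicator W z * (cmod (V n z))\<^sup>2) \<longlonglongrightarrow> (LINT z|lborel. indicator W z * (cmod (v z))\<^sup>2)"
    using W(1) by (intro l2_lim_weighted[OF lim(1), where B = 1] borel_measurable_indicator) (auto split: split_indicator)
  show ?thesis
  proof (rule LIMSEQ_le)
    show "(\<lambda>n. LINT z|lborel. ?m z * (cmod (V n z))\<^sup>2) \<longlonglongrightarrow> (LINT z|lborel. ?m z * (cmod (v z))\<^sup>2)"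
      by (rule l2_lim_weighted[OF lim(1) m])
    show "(\<lambda>n. hardy_const r * ((LINT z|lborel. mdens a (V n) (D n) z) + (LINT z|lborel. (cmod (V n z))\<^sup>2)
      + 1 / s\<^sup>2 * (LINT z|lborel. indicator W z * (cmod (V n z))\<^sup>2))) \<longlonglongrightarrow>
      hardy_const r * ((LINT z|lborel. mdens a v G z) + (LINT z|lborel. (cmod (v z))\<^sup>2)
      + 1 / s\<^sup>2 * (LINT z|lborel. indicator W z * (cmod (v z))\<^sup>2))"
      by (intro tendsto_intros mdens_limit[OF lim a] one wW)
    show "\<exists>N. \<forall>j\<ge>N. (LINT z|lborel. ?m z * (cmod (V j z))\<^sup>2) \<le> hardy_const r * ((LINT z|lborel. mdens a (V j) (D j) z) + (LINT z|lborel. (cmod (V j z))\<^sup>2)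
      + 1 / s\<^sup>2 * (LINT z|lborel. indicator W z * (cmod (V j z))\<^sup>2))"
    proof (intro exI allI impI)
      fix j
      show "(LINT z|lborel. ?m z * (cmod (V j z))\<^sup>2) \<le> hardy_const r * ((LINT z|lborel. mdens a (V j) (D j) z) + (LINT z|lborel. (cmod (V j z))\<^sup>2)
        + 1 / s\<^sup>2 * (LINT z|lborel. indicator W z * (cmod (V j z))\<^sup>2))"
        by (rule hardy_C1c[OF V _ _ n h r s W(1)]) (rule a, rule a, erule (1) W(2))
    qed
  qed
qed

section \<open>C1 cutoff functions of the distance to a set\<close>

lemma C1_fun_mollify:
  fixes g :: "real^2 \<Rightarrow> real"
  assumes "r > 0" "integrable lborel g"
  shows "C1_fun (mollify r g)"
  by (rule C1_funI(1)[OF has_derivative_mollify[OF assms] continuous_mollify_deriv[OF assms]])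

text \<open>A function of the distance, falling linearly from 1 to 0 between
  \<open>5 / 8 * r\<close> and \<open>7 / 8 * r\<close> and so of slope \<open>4 / r\<close>, is
  mollified at radius \<open>r / 16\<close>. Constancy survives below \<open>9 / 16 * r\<close> and
  above \<open>15 / 16 * r\<close>; these margins make the gradient vanish on the closed regions,
  including distances \<open>r / 2\<close> and \<open>r\<close>.\<close>

lemma distance_cutoff:
  fixes S :: "(real^2) set"
  assumes S: "S \<noteq> {}" "bounded S" and r: "r > 0"
  obtains \<eta> where "C1_fun \<eta>" "\<And>x. 0 \<le> \<eta> x" "\<And>x. \<eta> x \<le> 1"
    "\<And>x. infdist x S \<le> r / 2 \<Longrightarrow> \<eta> x = 0" "\<And>x. infdist x S \<ge> r \<Longrightarrow> \<eta> x = 1"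
    "\<And>x k. \<bar>pd \<eta> k x\<bar> \<le> 4 / r"
    "\<And>x k. infdist x S \<le> r / 2 \<Longrightarrow> pd \<eta> k x = 0" "\<And>x k. infdist x S \<ge> r \<Longrightarrow> pd \<eta> k x = 0"
proof -
  define g where "g x = max 0 (min 1 ((7 / 8 * r - infdist x S) * (4 / r)))" for x
  define \<eta> where "\<eta> x = 1 - mollify (r / 16) g x" for x
  have gc: "continuous_on UNIV g" unfolding g_def by (intro continuous_intros)
  obtain M where M: "\<And>x. x \<in> S \<Longrightarrow> norm x \<le> M" using S(2) bounded_iff by metis
  have g0: "g x = 0" if "infdist x S \<ge> 7 / 8 * r" for x
  proof -
    have "(7 / 8 * r - infdist x S) * (4 / r) \<le> 0" using that r by (intro mult_nonpos_nonneg) auto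
    then show ?thesis by (simp add: g_def)
  qed
  have g1: "g x = 1" if "infdist x S \<le> 5 / 8 * r" for x
  proof -
    have "1 \<le> (7 / 8 * r - infdist x S) * (4 / r)" using that r by (simp add: field_simps)
    then show ?thesis by (simp add: g_def)
  qed
  have gsupp: "g x = 0" if "norm x > M + r" for x
  proof (rule g0, rule ccontr)
    assume "\<not> 7 / 8 * r \<le> infdist x S"
    then have "infdist x S < r" using r by simp
    then have "(INF y\<in>S. dist x y) < r" using S(1) by (simp add: infdist_notempty)
    then obtain y where y: "y \<in> S" "dist x y < r"
      by (subst (asm) cINF_less_iff[OF S(1)]) (auto intro: bdd_belowI[of _ 0])
    then show False using M[OF y(1)] that norm_triangle_sub[of x y] by (auto simp: dist_norm)
  qed
  have gi: "integrable lborel g" by (rule continuous_compact_support_integrable[OF gc gsupp])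
  have r16: "r / 16 > 0" using r by simp
  have lip: "\<bar>g x - g y\<bar> \<le> 4 / r * dist x y" for x y
  proof -
    have "\<bar>g x - g y\<bar> \<le> \<bar>(7 / 8 * r - infdist x S) * (4 / r) - (7 / 8 * r - infdist y S) * (4 / r)\<bar>"
      unfolding g_def by (auto simp: max_def min_def)
    also have "(7 / 8 * r - infdist x S) * (4 / r) - (7 / 8 * r - infdist y S) * (4 / r) = 4 / r * (infdist y S - infdist x S)"
      by (simp only: left_diff_distrib[symmetric]) simp
    also have "\<bar>4 / r * (infdist y S - infdist x S)\<bar> = 4 / r * \<bar>infdist x S - infdist y S\<bar>"
      unfolding abs_mult abs_minus_commute[of "infdist y S"] using r by simp
    also have "\<dots> \<le> 4 / r * dist x y" using r by (intro mult_left_mono infdist_triangle_abs) auto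
    finally show ?thesis .
  qed
  have C: "C1_fun \<eta>"
  proof -
    have m: "C1_fun (mollify (r / 16) g)" by (rule C1_fun_mollify[OF r16 gi])
    have d: "(\<eta> has_derivative (\<lambda>h. - mollify_deriv (r / 16) g x h)) (at x)" for x
      unfolding \<eta>_def using has_derivative_mollify[OF r16 gi, of x] by (auto intro!: derivative_eq_intros)
    show ?thesis by (rule C1_funI(1)[OF d]) (intro continuous_intros continuous_mollify_deriv[OF r16 gi])
  qed
  have 01: "0 \<le> \<eta> x \<and> \<eta> x \<le> 1" for x
  proof -
    have "norm (mollify (r / 16) g x - 1 / 2) \<le> 1 / 2"
    proof (rule mollify_near[OF r16 gi])
      have "0 \<le> g y" "g y \<le> 1" for y by (auto simp: g_def)
      then show "norm (g y - 1 / 2) \<le> 1 / 2" for y unfolding real_norm_def abs_le_iff by (simp add: add_increasing)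
    qed
    then show ?thesis unfolding \<eta>_def real_norm_def by linarith
  qed
  have idl: "infdist y S \<le> infdist x S + dist x y" "infdist x S \<le> infdist y S + dist x y" for x y
    using infdist_triangle_abs[of x S y] by auto
  have z0: "\<eta> x = 0" if "infdist x S < 9 / 16 * r" for x
  proof -
    have "norm (mollify (r / 16) g x - 1) \<le> 0"
    proof (rule mollify_near[OF r16 gi])
      fix y assume "dist x y < r / 16"
      then have "infdist y S \<le> 5 / 8 * r" using idl(1)[of y x] that by linarith
      then show "norm (g y - 1) \<le> 0" using g1 by simp
    qed
    then show ?thesis by (simp add: \<eta>_def)
  qed
  have z1: "\<eta> x = 1" if "infdist x S > 15 / 16 * r" for x
  proof -
    have "norm (mollify (r / 16) g x - 0) \<le> 0"
    proof (rule mollify_near[OF r16 gi])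
      fix y assume "dist x y < r / 16"
      then have "infdist y S \<ge> 7 / 8 * r" using idl(2)[of x y] that by linarith
      then show "norm (g y - 0) \<le> 0" using g0 by simp
    qed
    then show ?thesis by (simp add: \<eta>_def)
  qed
  have op: "open {x. infdist x S < 9 / 16 * r}" "open {x. infdist x S > 15 / 16 * r}"
    by (intro open_Collect_less continuous_intros)+
  have p0: "pd \<eta> k x = 0" if "infdist x S < 9 / 16 * r" for x k
    by (rule pd_local_const(1)[OF op(1)]) (use that z0 in auto)
  have p1: "pd \<eta> k x = 0" if "infdist x S > 15 / 16 * r" for x k
    by (rule pd_local_const(1)[OF op(2)]) (use that z1 in auto)
  \<comment> \<open>Mollification commutes with translations, so the Lipschitz bound of
    \<open>g\<close> bounds the difference quotients of \<eta>, and the derivative as their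
    limit.\<close>
  have pb: "\<bar>pd \<eta> k x\<bar> \<le> 4 / r" for k x
  proof -
    let ?e = "axis k 1 :: real^2"
    have q: "norm ((\<eta> (x + t *\<^sub>R ?e) - \<eta> (x + 0 *\<^sub>R ?e)) / t) \<le> 4 / r" if "t \<noteq> 0" for t
    proof -
      have gs: "integrable lborel (\<lambda>y. g (y + t *\<^sub>R ?e))" using gi lborel_integral_shift(2)[of g] by simp
      have "norm (mollify (r / 16) (\<lambda>y. g (y + t *\<^sub>R ?e) - g y) x - 0) \<le> 4 / r * \<bar>t\<bar>"
      proof (rule mollify_near[OF r16])
        show "integrable lborel (\<lambda>y. g (y + t *\<^sub>R ?e) - g y)" using gs gi by simp
        show "norm (g (y + t *\<^sub>R ?e) - g y - 0) \<le> 4 / r * \<bar>t\<bar>" for y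
          using lip[of "y + t *\<^sub>R ?e" y] by (simp add: dist_norm norm_axis_1)
      qed
      then have "\<bar>\<eta> (x + t *\<^sub>R ?e) - \<eta> x\<bar> \<le> 4 / r * \<bar>t\<bar>"
        unfolding \<eta>_def mollify_shift mollify_diff[OF r16 gs gi] by (simp add: abs_minus_commute)
      then show ?thesis using that by (simp add: divide_le_eq)
    qed
    have "((\<lambda>t. (\<eta> (x + t *\<^sub>R ?e) - \<eta> (x + 0 *\<^sub>R ?e)) / t) \<longlongrightarrow> pd \<eta> k x) (at 0)"
      using C1_fun_directional[OF C, of x k] unfolding DERIV_def by simp
    then have "norm (pd \<eta> k x) \<le> 4 / r"
      by (rule Lim_norm_ubound[rotated]) (use q in \<open>auto simp: eventually_at intro!: exI[of _ 1]\<close>)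
    then show ?thesis by simp
  qed
  show ?thesis
  proof (rule that[OF C])
    fix x k
    show "\<eta> x = 0" "pd \<eta> k x = 0" if "infdist x S \<le> r / 2" using that r z0[of x] p0[of x k] by auto
    show "\<eta> x = 1" "pd \<eta> k x = 0" if "infdist x S \<ge> r" using that r z1[of x] p1[of x k] by auto
  qed (use 01 pb in auto)
qed

section \<open>Transversal heights of a boundary curve\<close>

text \<open>Near \<open>p\<close> the set \<open>J\<close> is an arc of \<open>c\<close>, which is strictly differentiable at \<open>t0\<close> with derivative \<open>D\<close>. This form also covers
  the base point of a closed curve.\<close>

definition local_curve :: "(real^2) set \<Rightarrow> real^2 \<Rightarrow> (real \<Rightarrow> real^2) \<Rightarrow> real \<Rightarrow> real^2 \<Rightarrow> bool" where
  "local_curve J p c t0 D \<longleftrightarrow> c t0 = p \<and> D \<noteq> 0 \<and>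
     (\<forall>\<epsilon>>0. \<exists>\<delta>>0. \<forall>s\<in>ball t0 \<delta>. \<forall>t\<in>ball t0 \<delta>. norm (c t - c s - (t - s) *\<^sub>R D) \<le> \<epsilon> * \<bar>t - s\<bar>) \<and>
     (\<forall>\<delta>>0. \<exists>\<rho>>0. J \<inter> ball p \<rho> \<subseteq> c ` ball t0 \<delta>) \<and> (\<exists>\<delta>>0. c ` ball t0 \<delta> \<subseteq> J)"

text \<open>The mean value inequality for \<open>g x - x *\<^sub>R D0\<close>, whose derivative
  \<open>D x - D0\<close> is small on \<open>S\<close>.\<close>

lemma curve_linear_bound:
  fixes g D :: "real \<Rightarrow> real^2"
  assumes g: "\<And>t. t \<in> {0..1} \<Longrightarrow> (g has_vector_derivative D t) (at t within {0..1})"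
    and S: "convex S" "S \<subseteq> {0..1}" and D: "\<And>t. t \<in> S \<Longrightarrow> norm (D t - D0) \<le> \<epsilon>" and st: "s \<in> S" "t \<in> S"
  shows "norm (g t - g s - (t - s) *\<^sub>R D0) \<le> \<epsilon> * \<bar>t - s\<bar>"
proof -
  have d: "((\<lambda>x. g x - x *\<^sub>R D0) has_derivative (\<lambda>h. h *\<^sub>R (D x - D0))) (at x within S)" if "x \<in> S" for x
  proof -
    have "(g has_derivative (\<lambda>h. h *\<^sub>R D x)) (at x within S)"
      using g[of x] S(2) that unfolding has_vector_derivative_def by (blast intro: has_derivative_subset)
    then show ?thesis by (auto intro!: derivative_eq_intros simp: scaleR_diff_right)
  qed
  have "norm ((g t - t *\<^sub>R D0) - (g s - s *\<^sub>R D0)) \<le> \<epsilon> * norm (t - s)"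
  proof (rule differentiable_bound[OF S(1) d _ st(2,1)])
    fix x assume x: "x \<in> S"
    show "onorm (\<lambda>h. h *\<^sub>R (D x - D0)) \<le> \<epsilon>"
    proof (rule onorm_le)
      fix h :: real
      show "norm (h *\<^sub>R (D x - D0)) \<le> \<epsilon> * norm h"
        using mult_right_mono[OF D[OF x], of "\<bar>h\<bar>"] by (simp add: mult.commute)
    qed
  qed
  then show ?thesis by (simp add: scaleR_diff_left algebra_simps)
qed

lemma compact_image_misses_ball:
  fixes g :: "real \<Rightarrow> real^2"
  assumes "continuous_on {0..1} g" "compact T" "T \<subseteq> {0..1}" "p \<notin> g ` T"
  obtains \<rho> where "\<rho> > 0" "ball p \<rho> \<inter> g ` T = {}"
proof -
  have "compact (g ` T)" using assms by (intro compact_continuous_image) (auto intro: continuous_on_subset)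
  then have "open (- (g ` T))" by (auto intro: compact_imp_closed)
  then obtain \<rho> where "\<rho> > 0" "ball p \<rho> \<subseteq> - (g ` T)" using assms(4) open_contains_ball by (metis ComplI)
  then show ?thesis using that by blast
qed

text \<open>Injectivity keeps the part of the curve away from the parameter of \<open>p\<close> at a
  positive distance from \<open>p\<close>, so near \<open>p\<close> only one arc is left. At the
  base point the end of \<open>g\<close> is glued to its beginning, and \<open>D 0 = D 1\<close>
  gives the glued arc a strict derivative.\<close>

lemma C1_jordan_local_curve:
  assumes "C1_jordan_boundary U" and p: "p \<in> frontier U"
  obtains c t0 D where "local_curve (frontier U) p c t0 D"
proof -
  obtain g D where g: "simple_path g" "pathfinish g = pathstart g" "path_image g = frontier U"
    and d: "\<And>t. t \<in> {0..1} \<Longrightarrow> (g has_vector_derivative D t) (at t within {0..1})"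
    and D: "continuous_on {0..1} D" "\<And>t. t \<in> {0..1} \<Longrightarrow> D t \<noteq> 0" "D 0 = D 1"
    using assms(1) unfolding C1_jordan_boundary_def by blast
  have gc: "continuous_on {0..1} g" using g(1) by (simp add: simple_path_def path_def)
  have g01: "g 0 = g 1" using g(2) by (simp add: pathfinish_def pathstart_def)
  have inj: "x = y \<or> x = 0 \<and> y = 1 \<or> x = 1 \<and> y = 0" if "x \<in> {0..1}" "y \<in> {0..1}" "g x = g y" for x y
    using g(1) that unfolding simple_path_def loop_free_def by blast
  obtain t1 where t1: "t1 \<in> {0..1}" "g t1 = p" using p g(3) unfolding path_image_def by (metis imageE)
  have Dc: "\<exists>\<delta>>0. \<forall>t\<in>{0..1}. dist t t0 < \<delta> \<longrightarrow> norm (D t - D t0) \<le> \<epsilon>" if "\<epsilon> > 0" "t0 \<in> {0..1}" for \<epsilon> t0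
    using D(1) that unfolding continuous_on_iff dist_norm by (meson less_imp_le)
  show ?thesis
  proof (cases "t1 = 0 \<or> t1 = 1")
    case False
    then have t: "0 < t1" "t1 < 1" using t1 by auto
    have "local_curve (frontier U) p g t1 (D t1)"
      unfolding local_curve_def
    proof (intro conjI allI impI)
      fix \<epsilon> :: real assume "\<epsilon> > 0"
      from Dc[OF this t1(1)] obtain \<delta> where \<delta>: "\<delta> > 0" "\<And>t. t \<in> {0..1} \<Longrightarrow> dist t t1 < \<delta> \<Longrightarrow> norm (D t - D t1) \<le> \<epsilon>" by blast
      define \<eta> where "\<eta> = min \<delta> (min t1 (1 - t1))"
      have sub: "ball t1 \<eta> \<subseteq> {0..1}" by (auto simp: \<eta>_def dist_real_def)
      show "\<exists>\<delta>>0. \<forall>s\<in>ball t1 \<delta>. \<forall>t\<in>ball t1 \<delta>. norm (g t - g s - (t - s) *\<^sub>R D t1) \<le> \<epsilon> * \<bar>t - s\<bar>"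
      proof (intro exI[of _ \<eta>] conjI ballI)
        show "\<eta> > 0" using \<delta>(1) t by (simp add: \<eta>_def)
        fix s t assume st: "s \<in> ball t1 \<eta>" "t \<in> ball t1 \<eta>"
        show "norm (g t - g s - (t - s) *\<^sub>R D t1) \<le> \<epsilon> * \<bar>t - s\<bar>"
        proof (rule curve_linear_bound[OF d convex_ball sub _ st])
          fix t assume "t \<in> ball t1 \<eta>"
          then show "norm (D t - D t1) \<le> \<epsilon>" using sub \<delta>(2)[of t] by (auto simp: \<eta>_def dist_commute)
        qed
      qed
    next
      fix \<delta> :: real assume \<delta>: "\<delta> > 0"
      let ?T = "{0..1} - ball t1 \<delta>"
      have "p \<notin> g ` ?T"
      proof
        assume "p \<in> g ` ?T"
        then obtain x where "x \<in> {0..1}" "x \<notin> ball t1 \<delta>" "g x = g t1" using t1 by auto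
        then show False using inj[of x t1] t1(1) \<delta> t by auto
      qed
      moreover have "compact ?T" by (intro compact_diff) auto
      ultimately obtain \<rho> where "\<rho> > 0" "ball p \<rho> \<inter> g ` ?T = {}"
        using compact_image_misses_ball[OF gc, of ?T p] by blast
      then show "\<exists>\<rho>>0. frontier U \<inter> ball p \<rho> \<subseteq> g ` ball t1 \<delta>"
        unfolding g(3)[symmetric] path_image_def by (intro exI[of _ \<rho>]) blast
    next
      show "\<exists>\<delta>>0. g ` ball t1 \<delta> \<subseteq> frontier U"
        unfolding g(3)[symmetric] path_image_def
        using t by (intro exI[of _ "min t1 (1 - t1)"] conjI image_mono) (auto simp: dist_real_def)
    qed (use t1 D in auto)
    then show ?thesis by (rule that)
  next
    case True
    then have p0: "g 0 = p" "g 1 = p" using t1 g01 by auto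
    \<comment> \<open>Negative parameters run through the end of \<open>g\<close>, the others
      through its beginning; the two definitions agree at 0 because
      \<open>g 0 = g 1\<close>.\<close>
    define c where "c t = (if t \<le> 0 then g (1 + t) else g t)" for t
    have "local_curve (frontier U) p c 0 (D 0)"
      unfolding local_curve_def
    proof (intro conjI allI impI)
      fix \<epsilon> :: real assume e: "\<epsilon> > 0"
      obtain \<delta>0 where \<delta>0: "\<delta>0 > 0" "\<And>t. t \<in> {0..1} \<Longrightarrow> dist t 0 < \<delta>0 \<Longrightarrow> norm (D t - D 0) \<le> \<epsilon>" using Dc[OF e, of 0] by auto
      obtain \<delta>1 where \<delta>1: "\<delta>1 > 0" "\<And>t. t \<in> {0..1} \<Longrightarrow> dist t 1 < \<delta>1 \<Longrightarrow> norm (D t - D 0) \<le> \<epsilon>" using Dc[OF e, of 1] D(3) by auto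
      define \<eta> where "\<eta> = min 1 (min \<delta>0 \<delta>1)"
      have \<eta>: "\<eta> > 0" "\<eta> \<le> 1" "\<eta> \<le> \<delta>0" "\<eta> \<le> \<delta>1" using \<delta>0 \<delta>1 by (auto simp: \<eta>_def)
      have right: "norm (c t - c s - (t - s) *\<^sub>R D 0) \<le> \<epsilon> * \<bar>t - s\<bar>" if "s \<in> {0..<\<eta>}" "t \<in> {0..<\<eta>}" for s t :: real
      proof -
        have "norm (g t - g s - (t - s) *\<^sub>R D 0) \<le> \<epsilon> * \<bar>t - s\<bar>"
          by (rule curve_linear_bound[OF d, of "{0..<\<eta>}"]) (use \<eta> \<delta>0(2) that in \<open>auto simp: dist_real_def\<close>)
        moreover have "c x = g x" if "x \<ge> 0" for x using that g01 by (auto simp: c_def)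
        ultimately show ?thesis using that by simp
      qed
      have left: "norm (c t - c s - (t - s) *\<^sub>R D 0) \<le> \<epsilon> * \<bar>t - s\<bar>" if "s \<in> {-\<eta><..0}" "t \<in> {-\<eta><..0}" for s t :: real
      proof -
        have "norm (g (1 + t) - g (1 + s) - ((1 + t) - (1 + s)) *\<^sub>R D 0) \<le> \<epsilon> * \<bar>(1 + t) - (1 + s)\<bar>"
          by (rule curve_linear_bound[OF d, of "{1-\<eta><..1}"]) (use \<eta> \<delta>1(2) that in \<open>auto simp: dist_real_def\<close>)
        then show ?thesis using that by (simp add: c_def)
      qed
      \<comment> \<open>For \<open>s \<le> 0 \<le> t\<close> the detour through 0 loses nothing,
        since the two parameter lengths add up to \<open>\<bar>t - s\<bar>\<close>.\<close>
      have cross: "norm (c t - c s - (t - s) *\<^sub>R D 0) \<le> \<epsilon> * \<bar>t - s\<bar>" if "s \<in> {-\<eta><..0}" "t \<in> {0..<\<eta>}" for s t :: real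
      proof -
        have "c t - c s - (t - s) *\<^sub>R D 0 = (c t - c 0 - (t - 0) *\<^sub>R D 0) + (c 0 - c s - (0 - s) *\<^sub>R D 0)"
          by (simp add: algebra_simps)
        then have "norm (c t - c s - (t - s) *\<^sub>R D 0) \<le> norm (c t - c 0 - (t - 0) *\<^sub>R D 0) + norm (c 0 - c s - (0 - s) *\<^sub>R D 0)"
          by (metis norm_triangle_ineq)
        also have "\<dots> \<le> \<epsilon> * \<bar>t - 0\<bar> + \<epsilon> * \<bar>0 - s\<bar>"
          using right[of 0 t] left[of s 0] that \<eta> by (intro add_mono) auto
        also have "\<dots> = \<epsilon> * \<bar>t - s\<bar>" using that by (simp add: algebra_simps)
        finally show ?thesis .
      qed
      show "\<exists>\<delta>>0. \<forall>s\<in>ball 0 \<delta>. \<forall>t\<in>ball 0 \<delta>. norm (c t - c s - (t - s) *\<^sub>R D 0) \<le> \<epsilon> * \<bar>t - s\<bar>"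
      proof (intro exI[of _ \<eta>] conjI ballI)
        fix s t :: real assume st: "s \<in> ball 0 \<eta>" "t \<in> ball 0 \<eta>"
        have sym: "norm (c t - c s - (t - s) *\<^sub>R D 0) = norm (c s - c t - (s - t) *\<^sub>R D 0)"
        proof -
          have "c t - c s - (t - s) *\<^sub>R D 0 = - (c s - c t - (s - t) *\<^sub>R D 0)" by (simp add: algebra_simps)
          then show ?thesis by (metis norm_minus_cancel)
        qed
        consider "0 \<le> s" "0 \<le> t" | "s \<le> 0" "t \<le> 0" | "s \<le> 0" "0 \<le> t" | "0 \<le> s" "t \<le> 0" by linarith
        then show "norm (c t - c s - (t - s) *\<^sub>R D 0) \<le> \<epsilon> * \<bar>t - s\<bar>"
        proof cases
          case 1 then show ?thesis using right st by auto
        next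
          case 2 then show ?thesis using left st by auto
        next
          case 3 then show ?thesis using cross st by auto
        next
          case 4
          then have "norm (c s - c t - (s - t) *\<^sub>R D 0) \<le> \<epsilon> * \<bar>s - t\<bar>" using cross[of t s] st by auto
          then show ?thesis unfolding sym by (simp add: abs_minus_commute)
        qed
      qed (rule \<eta>)
    next
      fix \<delta> :: real assume \<delta>: "\<delta> > 0"
      let ?T = "{\<delta>..1 - \<delta>}"
      have "p \<notin> g ` ?T"
      proof
        assume "p \<in> g ` ?T"
        then obtain x where "x \<in> ?T" "g x = g 0" using p0 by auto
        then show False using inj[of x 0] \<delta> by auto
      qed
      moreover have "?T \<subseteq> {0..1}" using \<delta> by auto
      ultimately obtain \<rho> where \<rho>: "\<rho> > 0" "ball p \<rho> \<inter> g ` ?T = {}"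
        using compact_image_misses_ball[OF gc, of ?T p] by blast
      have "frontier U \<inter> ball p \<rho> \<subseteq> c ` ball 0 \<delta>"
      proof
        fix z assume z: "z \<in> frontier U \<inter> ball p \<rho>"
        then obtain x where x: "x \<in> {0..1}" "z = g x" unfolding g(3)[symmetric] path_image_def by blast
        then have "x \<notin> ?T" using z \<rho>(2) by blast
        then consider "x < \<delta>" | "1 - \<delta> < x" by fastforce
        then show "z \<in> c ` ball 0 \<delta>"
        proof cases
          case 1
          then have "z = c x" "x \<in> ball 0 \<delta>" using x g01 by (auto simp: c_def)
          then show ?thesis by blast
        next
          case 2
          then have "z = c (x - 1)" "x - 1 \<in> ball 0 \<delta>" using x by (auto simp: c_def)
          then show ?thesis by blast
        qed
      qed
      then show "\<exists>\<rho>>0. frontier U \<inter> ball p \<rho> \<subseteq> c ` ball 0 \<delta>" using \<rho>(1) by blast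
    next
      have "c t \<in> frontier U" if "t \<in> ball 0 1" for t
        unfolding g(3)[symmetric] path_image_def c_def using that by auto
      then show "\<exists>\<delta>>0. c ` ball 0 \<delta> \<subseteq> frontier U" by (intro exI[of _ 1]) auto
    next
      show "c 0 = p" using p0 by (simp add: c_def)
      show "D 0 \<noteq> 0" using D(2) by simp
    qed
    then show ?thesis by (rule that)
  qed
qed

text \<open>The point of \<open>closure U\<close> nearest to \<open>z\<close> has height at most 0,
  since positive heights near it are free of points of \<open>U\<close>; the Lipschitz bound 2 of
  \<open>h\<close> then gives the claim. Connectedness yields the upper side only as the alternative
  \<open>up\<close>; \<open>z\<close> itself, of positive height and outside \<open>U\<close>,
  decides it.\<close>

lemma height_distance_bound:
  fixes h :: "real^2 \<Rightarrow> real"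
  assumes p: "p \<in> frontier U" and h: "continuous_on UNIV h" "\<And>z w. \<bar>h z - h w\<bar> \<le> 2 * dist z w"
    and m: "m > 0" "ball p (m / 2) \<subseteq> N"
    and low: "\<And>z. z \<in> N \<Longrightarrow> h z < 0 \<Longrightarrow> z \<in> U"
    and up: "(\<forall>z\<in>N. h z > 0 \<longrightarrow> z \<in> U) \<or> (\<forall>z\<in>N. h z > 0 \<longrightarrow> z \<notin> U)"
    and zero: "\<And>z. z \<in> N \<Longrightarrow> h z = 0 \<Longrightarrow> z \<in> closure U"
    and z: "z \<in> ball p (m / 4)" "z \<notin> closure U"
  shows "h z \<le> 2 * infdist z U"
proof -
  have pc: "p \<in> closure U" using p by (simp add: frontier_def)
  then have Une: "U \<noteq> {}" by auto
  have zN: "z \<in> N" using z m by auto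
  have hz: "h z > 0" using low[OF zN] zero[OF zN] z(2) closure_subset by (metis linorder_neqE_linordered_idom subsetD)
  have upn: "\<And>z. z \<in> N \<Longrightarrow> h z > 0 \<Longrightarrow> z \<notin> U" using up zN hz z(2) closure_subset by blast
  obtain q where q: "q \<in> closure U" "infdist z (closure U) = dist z q"
    using infdist_attains_inf[of "closure U" z] Une by auto
  have qd: "dist z q \<le> infdist z U" unfolding q(2)[symmetric] by (rule infdist_mono[OF closure_subset Une])
  have "infdist z (closure U) \<le> dist z p" using pc by (rule infdist_le)
  then have "dist p q < m / 2" using q(2) z(1) dist_triangle[of p q z] by (simp add: dist_commute)
  then have qb: "q \<in> ball p (m / 2)" by simp
  have "h q \<le> 0"
  proof (rule ccontr)
    assume "\<not> h q \<le> 0"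
    then have "q \<in> ball p (m / 2) \<inter> {z. 0 < h z}" using qb by simp
    moreover have "open (ball p (m / 2) \<inter> {z. 0 < h z})"
      using h(1) by (intro open_Int open_ball open_Collect_less continuous_intros)
    ultimately have "(ball p (m / 2) \<inter> {z. 0 < h z}) \<inter> U \<noteq> {}"
      using q(1) open_Int_closure_eq_empty by blast
    then show False using upn m by blast
  qed
  then show ?thesis using h(2)[of z q] qd hz by linarith
qed

text \<open>Near \<open>p\<close> the boundary is the graph of a 1-Lipschitz \<gamma> over the
  tangent line, and the height is the difference between the normal coordinate and \<gamma> of the
  tangential one. Both sides of the graph inside the neighbourhood \<open>N\<close> are connected
  and miss the frontier, so each lies in \<open>U\<close> or outside it. As \<open>U\<close> meets
  \<open>N\<close> off the graph, some side lies in \<open>U\<close>, and the sign of the normal is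
  chosen to make it the negative one.\<close>

lemma transversal_height:
  assumes U: "C1_jordan_boundary U" "open U" and p: "p \<in> frontier U"
  obtains n h r where "\<And>k. \<bar>n $ k\<bar> \<le> 1" "continuous_on UNIV h" "\<And>z t. h (z + t *\<^sub>R n) = h z + t" "r > 0"
    "\<And>z. z \<in> ball p r \<Longrightarrow> h z < 0 \<Longrightarrow> z \<in> U"
    "\<And>z. z \<in> ball p r \<Longrightarrow> z \<notin> closure U \<Longrightarrow> h z \<le> 2 * infdist z U"
proof -
  obtain c t0 D where lc: "local_curve (frontier U) p c t0 D" using C1_jordan_local_curve[OF U(1) p] by blast
  have ct0: "c t0 = p" and D: "D \<noteq> 0" using lc by (auto simp: local_curve_def)
  define d where "d = norm D"
  have d: "d > 0" using D by (simp add: d_def)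
  define \<tau> where "\<tau> = D /\<^sub>R d"
  define n :: "real^2" where "n = vector [- \<tau> $ 2, \<tau> $ 1]"
  have nt: "norm \<tau> = 1" using D by (simp add: \<tau>_def d_def)
  have tt: "(\<tau> $ 1)\<^sup>2 + (\<tau> $ 2)\<^sup>2 = 1"
    using nt by (simp add: norm_eq_1 inner_vec_def sum_2 power2_eq_square)
  have n12: "n $ 1 = - \<tau> $ 2" "n $ 2 = \<tau> $ 1" by (simp_all add: n_def)
  have nn: "norm n = 1" using tt by (simp add: norm_eq_1 inner_vec_def sum_2 n12 power2_eq_square add.commute)
  have tn: "\<tau> \<bullet> n = 0" by (simp add: inner_vec_def sum_2 n12)
  have decomp: "w = (w \<bullet> \<tau>) *\<^sub>R \<tau> + (w \<bullet> n) *\<^sub>R n" for w :: "real^2"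
  proof -
    have "(w $ 1 * \<tau> $ 1 + w $ 2 * \<tau> $ 2) * \<tau> $ 1 + (w $ 1 * (- \<tau> $ 2) + w $ 2 * \<tau> $ 1) * (- \<tau> $ 2) = w $ 1 * ((\<tau> $ 1)\<^sup>2 + (\<tau> $ 2)\<^sup>2)"
      "(w $ 1 * \<tau> $ 1 + w $ 2 * \<tau> $ 2) * \<tau> $ 2 + (w $ 1 * (- \<tau> $ 2) + w $ 2 * \<tau> $ 1) * \<tau> $ 1 = w $ 2 * ((\<tau> $ 1)\<^sup>2 + (\<tau> $ 2)\<^sup>2)"
      by (simp_all add: power2_eq_square algebra_simps)
    then show ?thesis unfolding tt by (simp add: vec_eq_iff forall_2 inner_vec_def sum_2 n12)
  qed
  define a where "a z = (z - p) \<bullet> \<tau>" for z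
  define b where "b z = (z - p) \<bullet> n" for z
  have ab: "z = p + a z *\<^sub>R \<tau> + b z *\<^sub>R n" for z using decomp[of "z - p"] by (simp add: a_def b_def algebra_simps)
  have adif: "a z - a w = (z - w) \<bullet> \<tau>" "b z - b w = (z - w) \<bullet> n" for z w
    by (simp_all add: a_def b_def inner_diff_left)
  have al: "\<bar>a z - a w\<bar> \<le> dist z w" "\<bar>b z - b w\<bar> \<le> dist z w" for z w
    using Cauchy_Schwarz_ineq2[of "z - w" \<tau>] Cauchy_Schwarz_ineq2[of "z - w" n] by (simp_all add: adif nt nn dist_norm)
  have abp: "a p = 0" "b p = 0" by (simp_all add: a_def b_def)
  have ac: "continuous_on S a" "continuous_on S b" for S unfolding a_def b_def by (intro continuous_intros)+
  have dh: "d / 2 > 0" using d by simp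
  \<comment> \<open>With error \<open>d / 2\<close>, half the speed, tangential increments are at
    least \<open>d / 2 * \<bar>t - s\<bar>\<close> and normal ones at most that: the slope of the
    graph is at most 1.\<close>
  obtain \<delta>1 where \<delta>1: "\<delta>1 > 0" "\<And>s t. s \<in> ball t0 \<delta>1 \<Longrightarrow> t \<in> ball t0 \<delta>1 \<Longrightarrow> norm (c t - c s - (t - s) *\<^sub>R D) \<le> d / 2 * \<bar>t - s\<bar>"
    using lc dh unfolding local_curve_def by meson
  obtain \<delta>2 where \<delta>2: "\<delta>2 > 0" "c ` ball t0 \<delta>2 \<subseteq> frontier U" using lc unfolding local_curve_def by blast
  define \<delta> where "\<delta> = min \<delta>1 \<delta>2 / 2"
  have \<delta>: "\<delta> > 0" using \<delta>1 \<delta>2 by (simp add: \<delta>_def)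
  let ?I = "{t0 - \<delta>..t0 + \<delta>}"
  have I: "?I \<subseteq> ball t0 \<delta>1" "?I \<subseteq> ball t0 \<delta>2" using \<delta>1(1) \<delta>2(1) by (auto simp: \<delta>_def dist_real_def)
  obtain \<rho> where \<rho>: "\<rho> > 0" "frontier U \<inter> ball p \<rho> \<subseteq> c ` ball t0 \<delta>" using lc \<delta> unfolding local_curve_def by blast
  have Dt: "D \<bullet> \<tau> = d" "D \<bullet> n = 0"
  proof -
    have "D = d *\<^sub>R \<tau>" using d by (simp add: \<tau>_def)
    then show "D \<bullet> \<tau> = d" "D \<bullet> n = 0" using nt tn by (simp_all add: dot_square_norm)
  qed
  have est: "\<bar>(a (c t) - a (c s)) - (t - s) * d\<bar> \<le> d / 2 * \<bar>t - s\<bar>" "\<bar>b (c t) - b (c s)\<bar> \<le> d / 2 * \<bar>t - s\<bar>"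
    if "s \<in> ?I" "t \<in> ?I" for s t
  proof -
    let ?e = "c t - c s - (t - s) *\<^sub>R D"
    have e: "norm ?e \<le> d / 2 * \<bar>t - s\<bar>" using \<delta>1(2) I that by blast
    have "\<bar>?e \<bullet> \<tau>\<bar> \<le> norm ?e" "\<bar>?e \<bullet> n\<bar> \<le> norm ?e"
      using Cauchy_Schwarz_ineq2[of ?e \<tau>] Cauchy_Schwarz_ineq2[of ?e n] by (simp_all add: nt nn)
    moreover have "?e \<bullet> \<tau> = (a (c t) - a (c s)) - (t - s) * d" "?e \<bullet> n = b (c t) - b (c s)"
      by (simp_all add: adif inner_diff_left Dt)
    ultimately show "\<bar>(a (c t) - a (c s)) - (t - s) * d\<bar> \<le> d / 2 * \<bar>t - s\<bar>" "\<bar>b (c t) - b (c s)\<bar> \<le> d / 2 * \<bar>t - s\<bar>"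
      using e by auto
  qed
  have ba: "\<bar>b (c t) - b (c s)\<bar> \<le> \<bar>a (c t) - a (c s)\<bar>" if "s \<in> ?I" "t \<in> ?I" for s t
  proof -
    have "d * \<bar>t - s\<bar> = \<bar>(t - s) * d\<bar>" using d by (simp add: abs_mult)
    also have "\<dots> \<le> \<bar>a (c t) - a (c s)\<bar> + d / 2 * \<bar>t - s\<bar>" using est(1)[OF that] by linarith
    finally show ?thesis using est(2)[OF that] by linarith
  qed
  have cI: "continuous_on ?I (\<lambda>t. a (c t))"
  proof (rule lipschitz_on_continuous_on[of "3 / 2 * d"])
    show "(3 / 2 * d)-lipschitz_on ?I (\<lambda>t. a (c t))"
    proof (rule lipschitz_onI)
      fix s t assume "s \<in> ?I" "t \<in> ?I"
      note e = est(1)[OF this(2,1)]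
      have "\<bar>(s - t) * d\<bar> = d * \<bar>s - t\<bar>" using d by (simp add: abs_mult)
      then show "dist (a (c s)) (a (c t)) \<le> 3 / 2 * d * dist s t" using e unfolding dist_real_def by linarith
    qed (use d in simp)
  qed
  \<comment> \<open>At the parameters \<open>t0 - \<delta>\<close> and \<open>t0 + \<delta>\<close>
    the tangential coordinate has modulus at least \<open>d * \<delta> - d * \<delta> / 2\<close>,
    so the arc covers all tangential coordinates up to \<open>r1\<close>.\<close>
  define r1 where "r1 = d * \<delta> / 2"
  have r1: "r1 > 0" using d \<delta> by (simp add: r1_def)
  have ends: "a (c (t0 - \<delta>)) \<le> - r1" "r1 \<le> a (c (t0 + \<delta>))"
  proof -
    have "\<bar>a (c (t0 - \<delta>)) + d * \<delta>\<bar> \<le> d / 2 * \<delta>" "\<bar>a (c (t0 + \<delta>)) - d * \<delta>\<bar> \<le> d / 2 * \<delta>"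
      using est(1)[of t0 "t0 - \<delta>"] est(1)[of t0 "t0 + \<delta>"] \<delta> by (simp_all add: ct0 abp mult.commute)
    then show "a (c (t0 - \<delta>)) \<le> - r1" "r1 \<le> a (c (t0 + \<delta>))"
      unfolding r1_def abs_le_iff by (simp_all add: algebra_simps)
  qed
  have "\<exists>t. t \<in> ?I \<and> a (c t) = x" if "x \<in> {-r1..r1}" for x
    using IVT'[of "\<lambda>t. a (c t)" "t0 - \<delta>" x "t0 + \<delta>", OF _ _ _ cI] ends that \<delta> by auto
  then obtain \<sigma> where \<sigma>: "\<And>x. x \<in> {-r1..r1} \<Longrightarrow> \<sigma> x \<in> ?I" "\<And>x. x \<in> {-r1..r1} \<Longrightarrow> a (c (\<sigma> x)) = x"
    by metis
  \<comment> \<open>Clamping the tangential coordinate makes \<gamma> a 1-Lipschitz function on the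
    whole line, so that the height is defined on the whole plane.\<close>
  define k where "k x = max (- r1) (min r1 x)" for x
  have k: "k x \<in> {-r1..r1}" "\<bar>k x - k y\<bar> \<le> \<bar>x - y\<bar>" for x y using r1 by (auto simp: k_def max_def min_def)
  have kid: "k x = x" if "\<bar>x\<bar> \<le> r1" for x using that by (auto simp: k_def)
  define \<gamma> where "\<gamma> x = b (c (\<sigma> (k x)))" for x
  have \<gamma>L: "\<bar>\<gamma> x - \<gamma> y\<bar> \<le> \<bar>x - y\<bar>" for x y
    using ba[OF \<sigma>(1)[OF k(1)[of y]] \<sigma>(1)[OF k(1)[of x]]] k(2)[of x y] unfolding \<gamma>_def \<sigma>(2)[OF k(1)] by linarith
  have t0I: "t0 \<in> ?I" using \<delta> by simp
  have \<gamma>curve: "\<gamma> (a (c t)) = b (c t)" if "t \<in> ?I" "\<bar>a (c t)\<bar> \<le> r1" for t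
  proof -
    have "a (c (\<sigma> (k (a (c t))))) = a (c t)" by (rule trans[OF \<sigma>(2)[OF k(1)] kid[OF that(2)]])
    then show ?thesis using ba[OF that(1) \<sigma>(1)[OF k(1)[of "a (c t)"]]] by (simp add: \<gamma>_def)
  qed
  have \<gamma>0: "\<gamma> 0 = 0" using \<gamma>curve[OF t0I] r1 by (simp add: ct0 abp)
  have \<gamma>c: "continuous_on S \<gamma>" for S
    by (rule lipschitz_on_continuous_on[of 1]) (auto intro!: lipschitz_onI simp: dist_real_def \<gamma>L)
  define H where "H z = b z - \<gamma> (a z)" for z
  have HL: "\<bar>H z - H w\<bar> \<le> 2 * dist z w" for z w
    using \<gamma>L[of "a z" "a w"] al[of z w] unfolding H_def by linarith
  have Hc: "continuous_on UNIV H"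
    unfolding H_def by (intro continuous_intros ac continuous_on_compose2[OF \<gamma>c ac(1)]) auto
  have shift: "a (z + t *\<^sub>R n) = a z" "b (z + t *\<^sub>R n) = b z + t" for z t
    using adif[of "z + t *\<^sub>R n" z] tn nn by (simp_all add: inner_commute dot_square_norm)
  have Hn: "H (z + t *\<^sub>R n) = H z + t" for z t by (simp add: H_def shift)
  \<comment> \<open>In \<open>N\<close> the tangential coordinate is below \<open>m\<close> and the
    normal one below \<open>2 * m\<close>, so \<open>3 * m < \<rho>\<close> keeps \<open>N\<close>
    inside the ball in which the frontier belongs to the arc.\<close>
  define m where "m = min r1 (\<rho> / 4)"
  have m: "m > 0" "m \<le> r1" "3 * m < \<rho>" using r1 \<rho>(1) by (auto simp: m_def)
  define N where "N = {z. \<bar>a z\<bar> < m \<and> \<bar>H z\<bar> < m}"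
  have oN: "open N"
  proof -
    have "N = {z. \<bar>a z\<bar> < m} \<inter> {z. \<bar>H z\<bar> < m}" by (auto simp: N_def)
    then show ?thesis by (auto intro!: open_Int open_Collect_less continuous_intros ac Hc)
  qed
  have Hp: "H p = 0" by (simp add: H_def abp \<gamma>0)
  have bN: "ball p (m / 2) \<subseteq> N"
  proof
    fix z assume "z \<in> ball p (m / 2)"
    then have "dist z p < m / 2" by (simp add: dist_commute)
    then show "z \<in> N" using al(1)[of z p] HL[of z p] m(1) by (simp add: N_def abp Hp)
  qed
  have zero1: "z \<in> frontier U" if "z \<in> N" "H z = 0" for z
  proof -
    have az: "\<bar>a z\<bar> \<le> r1" using that m by (simp add: N_def)
    then have "a z \<in> {-r1..r1}" by auto
    note s = \<sigma>[OF this]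
    have "b z = b (c (\<sigma> (a z)))" using that(2) by (simp add: H_def \<gamma>_def kid[OF az])
    then have "z = c (\<sigma> (a z))" using ab[of z] ab[of "c (\<sigma> (a z))"] s(2) by simp
    then show ?thesis using s(1) I(2) \<delta>2(2) by blast
  qed
  have zero2: "H z = 0" if zN: "z \<in> N" and zf: "z \<in> frontier U" for z
  proof -
    have az: "\<bar>a z\<bar> < m" "\<bar>H z\<bar> < m" using zN by (auto simp: N_def)
    have "\<bar>b z\<bar> < 2 * m" using az \<gamma>L[of "a z" 0] by (simp add: H_def \<gamma>0)
    moreover have "norm (z - p) \<le> \<bar>a z\<bar> + \<bar>b z\<bar>"
    proof -
      have "z - p = a z *\<^sub>R \<tau> + b z *\<^sub>R n" using decomp[of "z - p"] by (simp add: a_def b_def)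
      then show ?thesis using norm_triangle_ineq[of "a z *\<^sub>R \<tau>" "b z *\<^sub>R n"] by (simp add: nt nn)
    qed
    ultimately have "z \<in> ball p \<rho>" using az m by (simp add: dist_norm norm_minus_commute)
    then obtain t where t: "z = c t" "t \<in> ball t0 \<delta>" using \<rho>(2) zf by blast
    then have "t \<in> ?I" by (auto simp: dist_real_def)
    then show ?thesis using \<gamma>curve[of t] az(1) m t by (simp add: H_def)
  qed
  \<comment> \<open>Tangential coordinate and height are global coordinates, in which the points of
    \<open>N\<close> with height in \<open>S\<close> form a convex product. Its image is connected
    and avoids the frontier, which in \<open>N\<close> is exactly the zero level.\<close>
  have side: "{z \<in> N. H z \<in> S} \<subseteq> U \<or> {z \<in> N. H z \<in> S} \<inter> U = {}"
    if S: "convex S" "S \<subseteq> {-m<..<m}" "0 \<notin> S" for S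
  proof -
    let ?F = "\<lambda>xy. p + fst xy *\<^sub>R \<tau> + (\<gamma> (fst xy) + snd xy) *\<^sub>R n"
    have aF: "a (?F xy) = fst xy" "b (?F xy) = \<gamma> (fst xy) + snd xy" for xy
      using nt nn tn by (simp_all add: a_def b_def inner_add_left inner_commute dot_square_norm algebra_simps)
    have eq: "{z \<in> N. H z \<in> S} = ?F ` ({-m<..<m} \<times> S)"
    proof (intro set_eqI iffI)
      fix z assume z: "z \<in> {z \<in> N. H z \<in> S}"
      have "z = ?F (a z, H z)" using ab[of z] by (simp add: H_def)
      moreover have "(a z, H z) \<in> {-m<..<m} \<times> S" using z by (auto simp: N_def)
      ultimately show "z \<in> ?F ` ({-m<..<m} \<times> S)" by (rule image_eqI)
    next
      fix z assume "z \<in> ?F ` ({-m<..<m} \<times> S)"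
      then obtain xy where xy: "z = ?F xy" "xy \<in> {-m<..<m} \<times> S" by blast
      have "a z = fst xy" "H z = snd xy" unfolding H_def xy(1) aF by simp_all
      moreover have "fst xy \<in> {-m<..<m}" "snd xy \<in> S" "snd xy \<in> {-m<..<m}" using xy(2) S(2) by (auto simp: mem_Times_iff)
      ultimately show "z \<in> {z \<in> N. H z \<in> S}" unfolding N_def by (auto simp: abs_less_iff)
    qed
    have "connected (?F ` ({-m<..<m} \<times> S))"
      by (intro connected_continuous_image continuous_intros continuous_on_compose2[OF \<gamma>c] convex_connected convex_Times S) auto
    then have "connected {z \<in> N. H z \<in> S}" unfolding eq .
    moreover have "{z \<in> N. H z \<in> S} \<inter> frontier U = {}" using zero2 S(3) by fastforce
    ultimately show ?thesis using connected_Int_frontier by blast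
  qed
  have low: "{z \<in> N. H z \<in> {-m<..<0}} \<subseteq> U \<or> {z \<in> N. H z \<in> {-m<..<0}} \<inter> U = {}"
    and up: "{z \<in> N. H z \<in> {0<..<m}} \<subseteq> U \<or> {z \<in> N. H z \<in> {0<..<m}} \<inter> U = {}"
    using m by (intro side; auto)+
  have HN: "H z \<in> {-m<..<0}" if "z \<in> N" "H z < 0" for z using that by (auto simp: N_def)
  have HP: "H z \<in> {0<..<m}" if "z \<in> N" "H z > 0" for z using that by (auto simp: N_def)
  have up2: "(\<forall>z\<in>N. 0 < H z \<longrightarrow> z \<in> U) \<or> (\<forall>z\<in>N. 0 < H z \<longrightarrow> z \<notin> U)"
    using up
  proof
    assume "{z \<in> N. H z \<in> {0<..<m}} \<subseteq> U"
    then have "\<forall>z\<in>N. 0 < H z \<longrightarrow> z \<in> U" using HP by blast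
    then show ?thesis ..
  next
    assume "{z \<in> N. H z \<in> {0<..<m}} \<inter> U = {}"
    then have "\<forall>z\<in>N. 0 < H z \<longrightarrow> z \<notin> U" using HP by blast
    then show ?thesis ..
  qed
  have low2: "(\<forall>z\<in>N. 0 < - H z \<longrightarrow> z \<in> U) \<or> (\<forall>z\<in>N. 0 < - H z \<longrightarrow> z \<notin> U)"
    using low
  proof
    assume "{z \<in> N. H z \<in> {-m<..<0}} \<subseteq> U"
    then have "\<forall>z\<in>N. H z < 0 \<longrightarrow> z \<in> U" using HN by blast
    then show ?thesis by simp
  next
    assume "{z \<in> N. H z \<in> {-m<..<0}} \<inter> U = {}"
    then have "\<forall>z\<in>N. H z < 0 \<longrightarrow> z \<notin> U" using HN by blast
    then show ?thesis by simp
  qed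
  have pN: "p \<in> N" using bN m by auto
  have zc: "z \<in> closure U" if "z \<in> N" "H z = 0" for z using zero1[OF that] by (simp add: frontier_def)
  have "p \<in> closure U" using p by (simp add: frontier_def)
  then have "N \<inter> U \<noteq> {}" using open_Int_closure_eq_empty[OF oN] pN by blast
  then obtain u where u: "u \<in> N" "u \<in> U" by blast
  have "H u \<noteq> 0"
  proof
    assume "H u = 0"
    then have "u \<in> frontier U" by (rule zero1[OF u(1)])
    then show False using u(2) U(2) by (simp add: frontier_def interior_open)
  qed
  have m4: "ball p (m / 4) \<subseteq> N" using bN m(1) by auto
  have nk: "\<bar>n $ k\<bar> \<le> 1" for k using component_le_norm_cart[of n k] nn by simp
  show ?thesis
  proof (cases "H u < 0")
    case True
    then have low': "z \<in> U" if "z \<in> N" "H z < 0" for z using low HN u that by blast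
    show ?thesis
    proof (rule that[of n H "m / 4"])
      fix z assume z: "z \<in> ball p (m / 4)"
      then show "z \<in> U" if "H z < 0" using low' m4 that by blast
      show "H z \<le> 2 * infdist z U" if "z \<notin> closure U"
        by (rule height_distance_bound[OF p Hc HL m(1) bN low' up2 zc z that])
    qed (use nk Hc Hn m in auto)
  next
    case False
    \<comment> \<open>Here \<open>U\<close> lies above the graph; reversing the signs of
      \<open>n\<close> and \<open>H\<close> puts it below.\<close>
    then have "H u > 0" using \<open>H u \<noteq> 0\<close> by simp
    then have up': "z \<in> U" if "z \<in> N" "- H z < 0" for z using up2 u that by auto
    have H'c: "continuous_on UNIV (\<lambda>z. - H z)" using Hc by (intro continuous_intros)
    have H'L: "\<bar>- H z - - H w\<bar> \<le> 2 * dist z w" for z w using HL[of z w] by simp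
    have zc': "z \<in> closure U" if "z \<in> N" "- H z = 0" for z using zc that by simp
    show ?thesis
    proof (rule that[of "- n" "\<lambda>z. - H z" "m / 4"])
      fix z assume z: "z \<in> ball p (m / 4)"
      then show "z \<in> U" if "- H z < 0" using up' m4 that by blast
      show "- H z \<le> 2 * infdist z U" if "z \<notin> closure U"
        by (rule height_distance_bound[OF p H'c H'L m(1) bN up' low2 zc' z that])
    next
      show "- H (z + t *\<^sub>R - n) = - H z + t" for z t using Hn[of z "- t"] by simp
    qed (use nk H'c m in auto)
  qed
qed

lemma hardy_const_nonneg: "r > 0 \<Longrightarrow> 0 \<le> hardy_const r"
  by (simp add: hardy_const_def)

text \<open>Finitely many balls of half the local radius cover the compact frontier and hence a
  collar of some width \<rho>. On each ball \<open>h p z \<le> 2 * infdist z U\<close> turns the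
  local weight into the distance weight at the price of a factor 4. Both \<rho> and \<open>C\<close>
  are fixed before \<open>v\<close>, the potential and \<open>s\<close>.\<close>

lemma hardy_global:
  fixes U :: "(real^2) set"
  assumes U: "C1_jordan_boundary U" "open U" "bounded U" "U \<noteq> {}"
  obtains \<rho> C where "\<rho> > 0" "C \<ge> 0"
    "\<And>v G K a B s. H1grad UNIV v G \<Longrightarrow> compact K \<Longrightarrow> (\<And>x. x \<notin> K \<Longrightarrow> v x = 0) \<Longrightarrow> (\<And>x k. x \<notin> K \<Longrightarrow> G k x = 0) \<Longrightarrow>
       (\<And>k. a k \<in> borel_measurable borel) \<Longrightarrow> (\<And>k x. \<bar>a k x\<bar> \<le> B) \<Longrightarrow> s > 0 \<Longrightarrow>
      (LINT z|lborel. indicator {z. 0 < infdist z U \<and> infdist z U < \<rho>} z / (infdist z U + s)\<^sup>2 * (cmod (v z))\<^sup>2) \<le>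
      C * ((LINT z|lborel. mdens a v G z) + (LINT z|lborel. (cmod (v z))\<^sup>2)
      + 1 / s\<^sup>2 * (LINT z|lborel. indicator U z * (cmod (v z))\<^sup>2))"
proof -
  define Q where "Q p n h r \<longleftrightarrow> (\<forall>k. \<bar>n $ k\<bar> \<le> 1) \<and> continuous_on UNIV h \<and> (\<forall>z t. h (z + t *\<^sub>R n) = h z + t) \<and> r > 0 \<and>
    (\<forall>z\<in>ball p r. h z < 0 \<longrightarrow> z \<in> U) \<and> (\<forall>z\<in>ball p r. z \<notin> closure U \<longrightarrow> h z \<le> 2 * infdist z U)"
    for p n :: "real^2" and h :: "real^2 \<Rightarrow> real" and r :: real
  have "\<exists>n h r. Q p n h r" if p: "p \<in> frontier U" for p
  proof (rule transversal_height[OF U(1,2) p])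
    fix n h r
    assume "\<And>k. \<bar>n $ k\<bar> \<le> 1" "continuous_on UNIV h" "\<And>z t. h (z + t *\<^sub>R n) = h z + t" "0 < r"
      "\<And>z. z \<in> ball p r \<Longrightarrow> h z < 0 \<Longrightarrow> z \<in> U" "\<And>z. z \<in> ball p r \<Longrightarrow> z \<notin> closure U \<Longrightarrow> h z \<le> 2 * infdist z U"
    then have "Q p n h r" unfolding Q_def by blast
    then show ?thesis by blast
  qed
  then obtain n h r where nhrQ: "\<And>p. p \<in> frontier U \<Longrightarrow> Q p (n p) (h p) (r p)" by metis
  note nhr = nhrQ[unfolded Q_def, THEN conjunct1, THEN spec]
    nhrQ[unfolded Q_def, THEN conjunct2, THEN conjunct1]
    nhrQ[unfolded Q_def, THEN conjunct2, THEN conjunct2, THEN conjunct1, THEN spec, THEN spec]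
    nhrQ[unfolded Q_def, THEN conjunct2, THEN conjunct2, THEN conjunct2, THEN conjunct1]
    nhrQ[unfolded Q_def, THEN conjunct2, THEN conjunct2, THEN conjunct2, THEN conjunct2, THEN conjunct1, THEN bspec, THEN mp]
    nhrQ[unfolded Q_def, THEN conjunct2, THEN conjunct2, THEN conjunct2, THEN conjunct2, THEN conjunct2, THEN bspec, THEN mp]
  have "compact (frontier U)" using U(3) by (simp add: compact_frontier_bounded)
  moreover have "\<And>p. p \<in> frontier U \<Longrightarrow> open (ball p (r p / 2))" by simp
  moreover have "frontier U \<subseteq> (\<Union>p\<in>frontier U. ball p (r p / 2))" using nhr(4) by fastforce
  ultimately obtain T where T: "T \<subseteq> frontier U" "finite T" "frontier U \<subseteq> (\<Union>p\<in>T. ball p (r p / 2))"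
    by (rule compactE_image)
  let ?V = "\<Union>p\<in>T. ball p (r p / 2)"
  have "compact (closure U)" using U(3) by (simp add: compact_closure)
  moreover have "open (?V \<union> U)" using U(2) by auto
  moreover have "closure U \<subseteq> ?V \<union> U" using T(3) U(2) by (auto simp: frontier_def interior_open)
  ultimately obtain \<rho> where \<rho>: "\<rho> > 0" "(\<Union>x\<in>closure U. cball x \<rho>) \<subseteq> ?V \<union> U"
    by (rule compact_subset_open_imp_cball_epsilon_subset)
  define C where "C = (\<Sum>p\<in>T. 4 * hardy_const (r p))"
  have C: "C \<ge> 0" unfolding C_def using T(1) nhr(4) by (intro sum_nonneg mult_nonneg_nonneg hardy_const_nonneg) auto
  show ?thesis
  proof (rule that[OF \<rho>(1) C])
    fix v :: "real^2 \<Rightarrow> complex" and G :: "2 \<Rightarrow> real^2 \<Rightarrow> complex" and K :: "(real^2) set"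
      and a :: "2 \<Rightarrow> real^2 \<Rightarrow> real" and B s :: real
    assume v: "H1grad UNIV v G" and K: "compact K" "\<And>x. x \<notin> K \<Longrightarrow> v x = 0" "\<And>x k. x \<notin> K \<Longrightarrow> G k x = 0"
      and a: "\<And>k. a k \<in> borel_measurable borel" "\<And>k x. \<bar>a k x\<bar> \<le> B" and s: "s > 0"
    let ?m = "\<lambda>p z. indicator {z \<in> ball p (r p / 2). 0 \<le> h p z} z / (h p z + s)\<^sup>2 :: real"
    let ?E = "(LINT z|lborel. mdens a v G z) + (LINT z|lborel. (cmod (v z))\<^sup>2)
      + 1 / s\<^sup>2 * (LINT z|lborel. indicator U z * (cmod (v z))\<^sup>2)"
    have sv: "sq_int v" using v by (simp add: H1grad_def L2_iff)
    have hp: "(LINT z|lborel. ?m p z * (cmod (v z))\<^sup>2) \<le> hardy_const (r p) * ?E" if "p \<in> T" for p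
    proof -
      have p: "p \<in> frontier U" using that T by auto
      show ?thesis
        by (rule hardy_H1[OF v K _ _ nhr(1)[OF p] nhr(2)[OF p] nhr(3)[OF p] nhr(4)[OF p] s])
          (use a U(2) nhr(5)[OF p] in auto)
    qed
    have mi: "integrable lborel (\<lambda>z. ?m p z * (cmod (v z))\<^sup>2)" if "p \<in> T" for p
    proof -
      have "continuous_on UNIV (h p)" using nhr(2) that T(1) by blast
      from sq_int_weight_integrable[OF sv hardy_weight_measurable[OF this s]] show ?thesis .
    qed
    let ?w = "\<lambda>z. indicator {z. 0 < infdist z U \<and> infdist z U < \<rho>} z / (infdist z U + s)\<^sup>2 :: real"
    have pt: "?w z \<le> (\<Sum>p\<in>T. 4 * ?m p z)" for z
    proof (cases "0 < infdist z U \<and> infdist z U < \<rho>")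
      case False
      then show ?thesis by (auto intro!: sum_nonneg)
    next
      case True
      have zc: "z \<notin> closure U" using True U(4) by (auto simp: in_closure_iff_infdist_zero)
      obtain q where q: "q \<in> closure U" "infdist z (closure U) = dist z q"
        using infdist_attains_inf[of "closure U" z] U(4) by auto
      have "infdist z (closure U) \<le> infdist z U" by (rule infdist_mono[OF closure_subset U(4)])
      then have "dist q z \<le> \<rho>" using q(2) True by (simp add: dist_commute)
      then have "z \<in> (\<Union>x\<in>closure U. cball x \<rho>)" using q(1) by (intro UN_I[of q]) simp_all
      then have "z \<in> ?V \<union> U" by (rule subsetD[OF \<rho>(2)])
      then have "z \<in> ?V" using zc closure_subset by blast
      then obtain p where p: "p \<in> T" "z \<in> ball p (r p / 2)" by blast
      have pf: "p \<in> frontier U" using p T by auto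
      have zb: "z \<in> ball p (r p)" using p(2) nhr(4)[OF pf] by auto
      have h0: "0 \<le> h p z" using nhr(5)[OF pf zb] zc closure_subset by (meson not_le subsetD)
      have h1: "h p z \<le> 2 * infdist z U" by (rule nhr(6)[OF pf zb zc])
      have "(h p z + s)\<^sup>2 \<le> (2 * (infdist z U + s))\<^sup>2" using h0 h1 s by (intro power_mono) auto
      also have "(2 * (infdist z U + s))\<^sup>2 = 4 * (infdist z U + s)\<^sup>2" by (simp only: power_mult_distrib) simp
      finally have "(h p z + s)\<^sup>2 \<le> 4 * (infdist z U + s)\<^sup>2" .
      then have "4 / (4 * (infdist z U + s)\<^sup>2) \<le> 4 / (h p z + s)\<^sup>2" using h0 s by (intro frac_le) auto
      then have "?w z \<le> 4 * ?m p z" using True p(2) h0 by simp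
      also have "\<dots> \<le> (\<Sum>p\<in>T. 4 * ?m p z)" using p(1) T(2) by (intro member_le_sum) auto
      finally show ?thesis .
    qed
    have "(LINT z|lborel. ?w z * (cmod (v z))\<^sup>2) \<le> (LINT z|lborel. (\<Sum>p\<in>T. 4 * (?m p z * (cmod (v z))\<^sup>2)))"
    proof (rule integral_mono)
      have "{z. 0 < infdist z U \<and> infdist z U < \<rho>} = {z. 0 < infdist z U} \<inter> {z. infdist z U < \<rho>}" by auto
      also have "open \<dots>" by (intro open_Int open_Collect_less continuous_intros)
      finally have o: "{z. 0 < infdist z U \<and> infdist z U < \<rho>} \<in> sets borel" by simp
      have "?w \<in> borel_measurable borel"
        using o by (intro borel_measurable_divide borel_measurable_indicator borel_measurable_continuous_onI continuous_intros)
      moreover have "\<bar>?w z\<bar> \<le> 1 / s\<^sup>2" for z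
        using s by (auto simp: indicator_def intro!: frac_le power_mono)
      ultimately show "integrable lborel (\<lambda>z. ?w z * (cmod (v z))\<^sup>2)" by (intro sq_int_weight_integrable[OF sv])
      show "integrable lborel (\<lambda>z. \<Sum>p\<in>T. 4 * (?m p z * (cmod (v z))\<^sup>2))"
        using mi by (intro Bochner_Integration.integrable_sum integrable_mult_right) auto
      show "?w z * (cmod (v z))\<^sup>2 \<le> (\<Sum>p\<in>T. 4 * (?m p z * (cmod (v z))\<^sup>2))" for z
        using mult_right_mono[OF pt[of z], of "(cmod (v z))\<^sup>2"] by (simp add: sum_distrib_right mult.assoc)
    qed
    also have "\<dots> = (\<Sum>p\<in>T. 4 * (LINT z|lborel. ?m p z * (cmod (v z))\<^sup>2))"
      by (simp only: Bochner_Integration.integral_sum[OF integrable_mult_right[OF mi]] integral_mult_right_zero)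
    also have "\<dots> \<le> (\<Sum>p\<in>T. 4 * (hardy_const (r p) * ?E))" using hp by (intro sum_mono mult_left_mono) auto
    also have "\<dots> = C * ?E" unfolding C_def by (simp add: sum_distrib_right mult.assoc)
    finally show "(LINT z|lborel. ?w z * (cmod (v z))\<^sup>2) \<le> C * ?E" .
  qed
qed

section \<open>Local gauge functions\<close>

text \<open>The derivatives of \<psi> times \<open>Re v\<close> and of \<psi> times
  \<open>Im v\<close> integrate to 0; real and imaginary parts are separated because
  \<open>pd\<close> acts on real functions.\<close>

lemma C1c_weak_grad:
  assumes "C1c v G"
  shows "weak_grad UNIV v G"
  unfolding weak_grad_zext zext_UNIV
proof (intro allI impI)
  fix \<psi> k assume psi: "test_fun UNIV \<psi>"
  note r = C1c_Re[OF assms]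
  obtain R where R: "\<And>x. norm x > R \<Longrightarrow> v x = 0" "\<And>x k. norm x > R \<Longrightarrow> G k x = 0"
    using C1c_support[OF assms] by blast
  have C: "C1_fun \<psi>" using psi by (simp add: test_fun_def C1_fun_def)
  have z: "(LINT x|lborel. pd (\<lambda>x. \<psi> x * f x) k x) = 0" if f: "C1_fun f" "\<And>x. norm x > R \<Longrightarrow> f x = 0" for f
  proof -
    have m: "C1_fun (\<lambda>x. \<psi> x * f x)" by (rule C1_fun_mult[OF C f(1)])
    have m0: "norm x > R \<Longrightarrow> \<psi> x * f x = 0" for x using f(2) by simp
    obtain B where B: "\<And>x. \<bar>pd (\<lambda>x. \<psi> x * f x) k x\<bar> \<le> B" using C1_fun_pd_bounded[OF m m0] by blast
    show ?thesis
      by (rule integral_directional_derivative_eq_0(2)[OF C1_fun_directional[OF m] C1_fun_continuous[OF m] B m0])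
  qed
  have d: "\<psi> differentiable (at x)" "(\<lambda>x. Re (v x)) differentiable (at x)" "(\<lambda>x. Im (v x)) differentiable (at x)" for x
    using C r(1,3) unfolding C1_fun_def by blast+
  have i: "integrable lborel (\<lambda>x. complex_of_real (pd \<psi> k x) * v x)" "integrable lborel (\<lambda>x. complex_of_real (\<psi> x) * G k x)"
    using test_fun_sq_int[OF psi] C1c_sq_int[OF assms] by (auto intro: sq_int_mult_integrable)
  have "(LINT x|lborel. complex_of_real (pd \<psi> k x) * v x + complex_of_real (\<psi> x) * G k x) = 0" (is "?I = 0")
  proof (rule complex_eqI)
    have "integrable lborel (\<lambda>x. complex_of_real (pd \<psi> k x) * v x + complex_of_real (\<psi> x) * G k x)" using i by simp
    note ri = integral_Re[OF this] integral_Im[OF this]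
    have "Re ?I = (LINT x|lborel. pd (\<lambda>x. \<psi> x * Re (v x)) k x)"
      unfolding ri(1)[symmetric] by (simp add: pd_mult[OF d(1,2)] r)
    then show "Re ?I = Re 0" using z[OF r(1)] R by simp
    have "Im ?I = (LINT x|lborel. pd (\<lambda>x. \<psi> x * Im (v x)) k x)"
      unfolding ri(2)[symmetric] by (simp add: pd_mult[OF d(1,3)] r)
    then show "Im ?I = Im 0" using z[OF r(3)] R by simp
  qed
  then show "(LINT x|lborel. complex_of_real (pd \<psi> k x) * v x) = - (LINT x|lborel. complex_of_real (\<psi> x) * G k x)"
    using i by (simp add: eq_neg_iff_add_eq_0)
qed

lemma C1c_H1grad: "C1c v G \<Longrightarrow> H1grad UNIV v G"
  unfolding H1grad_def L2_iff using C1c_weak_grad C1c_sq_int by simp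

lemma test_fun_mono: "test_fun V \<psi> \<Longrightarrow> V \<subseteq> U \<Longrightarrow> test_fun U \<psi>"
  unfolding test_fun_def by blast

lemma H1grad_restrict:
  fixes u :: "real^2 \<Rightarrow> complex"
  assumes u: "H1grad U u G" and V: "V \<subseteq> U" "open V"
  shows "H1grad V u G"
proof -
  have one: "C1_fun (\<lambda>_. 1)" "pd (\<lambda>_. 1) k x = 0" for k x
    using pd_local_const[of UNIV x "\<lambda>_. 1" 1] by (auto simp: C1_fun_def pd_local_const[of UNIV _ "\<lambda>_. 1" 1])
  have "H1grad V (zext U (\<lambda>x. complex_of_real 1 * u x)) (\<lambda>k. zext U (\<lambda>x. complex_of_real 1 * G k x + complex_of_real (pd (\<lambda>_. 1) k x) * u x))"
  proof (rule H1grad_mult[OF u one(1), where B = 1])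
    show "test_fun U (\<lambda>x. \<psi> x * 1)" if "test_fun V \<psi>" for \<psi> using test_fun_mono[OF that V(1)] by simp
  qed (use V in \<open>auto simp: one\<close>)
  then have *: "H1grad V (zext U u) (\<lambda>k. zext U (G k))" by (simp add: one)
  have "zext V (zext U f) = zext V f" for f using V(1) by (auto simp: zext_def fun_eq_iff)
  then show ?thesis using * unfolding H1grad_def L2_iff weak_grad_zext by simp
qed

context flux
begin

text \<open>Off \<omega> the function \<phi> is weakly harmonic, so
  \<open>pd \<phi> 1 - \<i> * pd \<phi> 2\<close> is holomorphic, and the imaginary part of a
  primitive is a harmonic conjugate of \<phi>, whose gradient is \<open>potF \<phi>\<close>. As
  \<phi> is only known to be C1, the Cauchy-Riemann equations are checked for mollified derivatives
  and holomorphy passes to their uniform limit.\<close>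

lemma gauge_function:
  assumes R: "R > 0" "cball z0 R \<subseteq> \<Omega> - closure \<omega>"
  obtains \<theta> R' where "R' > 0" "\<And>x. x \<in> ball z0 R' \<Longrightarrow> (\<theta> has_derivative (\<lambda>h. \<Sum>k\<in>UNIV. h $ k * potF \<phi> k x)) (at x)"
proof -
  define R1 where "R1 = R / 2"
  define V :: "complex \<Rightarrow> real^2" where "V w = vector [Re w, Im w]" for w
  define emb :: "real^2 \<Rightarrow> complex" where "emb x = Complex (x $ 1) (x $ 2)" for x
  have VE: "V (emb x) = x" "emb (V w) = w" for x w by (auto simp: V_def emb_def vec_eq_iff forall_2 complex_eq_iff)
  have bV: "bounded_linear V"
    by (rule linear_conv_bounded_linear[THEN iffD1], rule linearI) (auto simp: V_def vec_eq_iff forall_2)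
  have bE: "bounded_linear emb"
    by (rule linear_conv_bounded_linear[THEN iffD1], rule linearI) (auto simp: emb_def complex_eq_iff)
  have eRI: "Re (emb x) = x $ 1" "Im (emb x) = x $ 2" for x by (simp_all add: emb_def)
  have dE: "dist (V w) (V w') = dist w w'" for w w'
    by (simp add: V_def dist_norm norm_vec_def L2_set_def sum_2 cmod_def)
  have dE': "dist (emb x) (emb y) = dist x y" for x y using dE[of "emb x" "emb y"] by (simp add: VE)
  have sub: "cball z0 R \<subseteq> \<Omega>" using R by auto
  \<comment> \<open>The derivatives of \<phi> are restricted to a closed ball, where they are
    bounded, so that they can be mollified on the whole plane.\<close>
  define a where "a k x = (if x \<in> cball z0 R then pd \<phi> k x else 0)" for k x
  have ca: "continuous_on (cball z0 R) (pd \<phi> k)" for k using phi_cont sub by (rule continuous_on_subset)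
  have am: "a k \<in> borel_measurable borel" for k
    unfolding a_def[abs_def] by (rule borel_measurable_continuous_on_if[OF _ ca]) auto
  have ai: "integrable lborel (a k)" for k
  proof -
    obtain B where B: "\<And>x. x \<in> cball z0 R \<Longrightarrow> \<bar>pd \<phi> k x\<bar> \<le> B"
      using compact_imp_bounded[OF compact_continuous_image[OF ca compact_cball]] bounded_iff by (metis imageI real_norm_def)
    have "norm (a k x) \<le> max B 0" for x using B[of x] by (auto simp: a_def)
    moreover have "a k x = 0" if "norm x > norm z0 + R" for x
      using that norm_triangle_sub[of x z0] by (auto simp: a_def dist_norm norm_minus_commute)
    ultimately show ?thesis using am by (intro integrable_bounded_support[of "a k" "max B 0" "norm z0 + R"]) auto
  qed
  define r where "r n = R1 * inverse (real (Suc n))" for n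
  have r: "r n > 0" "r n \<le> R1" for n
    using R inverse_Suc_null_sequence(3)[of n] by (auto simp: r_def R1_def mult_left_le)
  have r0: "r \<longlonglongrightarrow> 0" unfolding r_def by (rule tendsto_mult_right_zero[OF inverse_Suc_null_sequence(1)])
  have "compact (cball z0 R)" by simp
  obtain e K where e: "e > 0" and K: "compact K" "K \<subseteq> \<Omega>" and near: "\<And>x y. y \<in> cball z0 R \<Longrightarrow> dist y x \<le> e \<Longrightarrow> x \<in> K"
    using compact_neighbourhood[OF compact_cball openO sub] by metis
  have ne: "cball z0 R \<noteq> {}" "bounded (cball z0 R)" using R by auto
  obtain \<eta> where \<eta>: "C1_fun \<eta>" "\<And>x. infdist x (cball z0 R) \<le> e / 2 \<Longrightarrow> \<eta> x = 0" "\<And>x. infdist x (cball z0 R) \<ge> e \<Longrightarrow> \<eta> x = 1"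
    using distance_cutoff[OF ne e] by metis
  \<comment> \<open>A compactly supported C1 function on the plane with the same derivatives as
    \<phi> on the ball: the symmetry of mixed derivatives is available for such functions
    only.\<close>
  define b where "b x = (1 - \<eta> x) * \<phi> x" for x
  have b0: "b x = 0" if "x \<notin> K" for x
  proof -
    have "infdist x (cball z0 R) \<ge> e"
    proof (rule ccontr)
      assume "\<not> e \<le> infdist x (cball z0 R)"
      moreover obtain y where "y \<in> cball z0 R" "infdist x (cball z0 R) = dist x y"
        using infdist_attains_inf[of "cball z0 R" x] ne by auto
      ultimately show False using near[of y x] that by (auto simp: dist_commute)
    qed
    then show ?thesis using \<eta>(3) by (simp add: b_def)
  qed
  have m1: "C1_fun (\<lambda>x. 1 - \<eta> x)" by (rule C1_fun_one_minus(1)[OF \<eta>(1)])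
  have bd: "b differentiable (at x)" "x \<in> \<Omega> \<Longrightarrow> pd b k x = pd (\<lambda>x. 1 - \<eta> x) k x * \<phi> x + (1 - \<eta> x) * pd \<phi> k x" for x k
  proof -
    have 1: "(\<lambda>x. 1 - \<eta> x) differentiable (at x)" using m1 by (simp add: C1_fun_def)
    show "b differentiable (at x)"
    proof (cases "x \<in> \<Omega>")
      case True
      then show ?thesis unfolding b_def[abs_def] by (intro differentiable_mult 1 phi_diff)
    next
      case False
      then have "x \<in> - K" using K by auto
      then show ?thesis by (rule pd_local_const(2)[rotated]) (use b0 K(1) in \<open>auto simp: compact_imp_closed open_Compl\<close>)
    qed
    show "x \<in> \<Omega> \<Longrightarrow> pd b k x = pd (\<lambda>x. 1 - \<eta> x) k x * \<phi> x + (1 - \<eta> x) * pd \<phi> k x"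
      unfolding b_def[abs_def] by (rule pd_mult[OF 1 phi_diff])
  qed
  have phc: "continuous_on \<Omega> \<phi>"
    using phi_diff by (meson continuous_at_imp_continuous_on differentiable_imp_continuous_within)
  have bC: "C1_fun b"
  proof -
    have "continuous_on UNIV (pd b k)" for k
    proof -
      have "continuous_on \<Omega> (\<lambda>x. pd (\<lambda>x. 1 - \<eta> x) k x * \<phi> x + (1 - \<eta> x) * pd \<phi> k x)"
        using m1 C1_fun_continuous[OF \<eta>(1)] by (intro continuous_intros phc phi_cont) (auto simp: C1_fun_def intro: continuous_on_subset)
      then have 1: "continuous_on \<Omega> (pd b k)" by (rule continuous_on_eq) (simp add: bd)
      have p0: "pd b k x = 0" if "x \<notin> K" for x by (rule pd_eq_0_outside[OF K(1) b0 that])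
      have 2: "continuous_on (- K) (pd b k)"
        by (rule continuous_on_eq[OF continuous_on_const[of _ 0]]) (simp add: p0)
      have "continuous_on (\<Omega> \<union> - K) (pd b k)"
        by (rule continuous_on_open_Un[OF openO _ 1 2]) (simp add: compact_imp_closed[OF K(1)] open_Compl)
      moreover have "\<Omega> \<union> - K = UNIV" using K(2) by auto
      ultimately show ?thesis by simp
    qed
    then show ?thesis using bd by (simp add: C1_fun_def)
  qed
  have pb: "pd b k x = a k x" if "x \<in> ball z0 R" for x k
  proof -
    have "pd b k x = pd \<phi> k x"
    proof -
      have i0: "infdist y (cball z0 R) = 0" if "y \<in> ball z0 R" for y using that by (intro infdist_zero) auto
      have "pd (\<lambda>x. 1 - \<eta> x) k x = 0" by (rule pd_local_const(1)[OF open_ball that, of _ 1]) (use i0 \<eta>(2) e in auto)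
      moreover have "x \<in> \<Omega>" using that sub by auto
      ultimately show ?thesis using bd(2)[of x k] \<eta>(2)[of x] i0[OF that] e by simp
    qed
    then show ?thesis using that by (simp add: a_def)
  qed
  \<comment> \<open>The first equation is the equation for \<phi> tested with the kernel, whose
    support misses \<omega>; the second is the weak symmetry of mixed derivatives, applied to the
    kernel and \<open>b\<close>.\<close>
  have CR: "mollify_deriv (r n) (a 1) x (axis 1 1) + mollify_deriv (r n) (a 2) x (axis 2 1) = 0"
    "mollify_deriv (r n) (a 1) x (axis 2 1) = mollify_deriv (r n) (a 2) x (axis 1 1)"
    if x: "x \<in> ball z0 R1" for n x
  proof -
    let ?m = "bump_mass (r n) TYPE(real^2)"
    let ?p = "\<lambda>y. bump (r n) (x - y) / ?m"
    note t = test_fun_bump[OF r(1)[of n], of x ?m]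
    have ys: "y \<in> ball z0 R" if "norm (x - y) < r n" for y
    proof -
      have "dist z0 y \<le> dist z0 x + dist x y" by (rule dist_triangle)
      then show ?thesis using that x r(2)[of n] by (auto simp: dist_norm R1_def)
    qed
    have p0: "?p y = 0" "pd ?p k y = 0" if "norm (x - y) \<ge> r n" for y k
      unfolding t(2) using that r(1)[of n] by (simp_all add: bump_outside bump_deriv_outside)
    have md: "mollify_deriv (r n) (a k) x (axis j 1) = - (LINT y|lborel. pd ?p j y * a k y)" for j k
      unfolding mollify_deriv_def t(2) by (simp add: minus_divide_left[symmetric])
    have ii: "integrable lborel (\<lambda>y. pd ?p j y * a k y)" for j k
      using Bochner_Integration.integrable_minus[OF mollify_deriv_integrable[OF r(1)[of n] ai[of k], of x "axis j 1"]] unfolding t(2)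
      by (simp add: minus_divide_left[symmetric])
    have "test_fun \<Omega> ?p"
      unfolding test_fun_iff
    proof (intro conjI exI[of _ "cball x (r n)"])
      show "C1_fun ?p" using t(1) by (simp add: test_fun_def C1_fun_def)
      show "cball x (r n) \<subseteq> \<Omega>"
      proof
        fix y assume "y \<in> cball x (r n)"
        moreover have "dist z0 y \<le> dist z0 x + dist x y" by (rule dist_triangle)
        ultimately have "y \<in> cball z0 R" using x r(2)[of n] by (auto simp: R1_def)
        then show "y \<in> \<Omega>" using sub by auto
      qed
    qed (use p0 in \<open>auto simp: dist_norm\<close>)
    note tp = this
    have z1: "indicator \<omega> y * ?p y = 0" for y
    proof -
      show "indicator \<omega> y * ?p y = 0"
      proof (cases "norm (x - y) < r n")
        case True
        then have "y \<in> cball z0 R" using ys by force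
        then have "y \<notin> \<omega>" using R(2) closure_subset by blast
        then show ?thesis by simp
      next
        case False
        then show ?thesis using p0(1)[of y] by simp
      qed
    qed
    have z2: "indicator \<Omega> y * (\<Sum>k\<in>UNIV. pd \<phi> k y * pd ?p k y) = pd ?p 1 y * a 1 y + pd ?p 2 y * a 2 y" for y
    proof -
      show "indicator \<Omega> y * (\<Sum>k\<in>UNIV. pd \<phi> k y * pd ?p k y) = pd ?p 1 y * a 1 y + pd ?p 2 y * a 2 y"
      proof (cases "norm (x - y) < r n")
        case True
        then have "y \<in> cball z0 R" using ys by force
        then show ?thesis using sub by (auto simp: a_def sum_2 mult.commute)
      next
        case False
        then show ?thesis using p0(2)[of y] by simp
      qed
    qed
    have "(LINT y|lborel. indicator \<Omega> y * (\<Sum>k\<in>UNIV. pd \<phi> k y * pd ?p k y)) = 2 * pi / measure lborel \<omega> * (LINT y|lborel. indicator \<omega> y * ?p y)"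
      using phi_eq[OF tp] unfolding set_lebesgue_integral_def real_scaleR_def .
    then have "(LINT y|lborel. pd ?p 1 y * a 1 y + pd ?p 2 y * a 2 y) = 0" unfolding z1 z2 by simp
    then show "mollify_deriv (r n) (a 1) x (axis 1 1) + mollify_deriv (r n) (a 2) x (axis 2 1) = 0"
      unfolding md using ii by simp
    obtain M where M: "\<And>x. x \<in> K \<Longrightarrow> norm x \<le> M" using K(1) compact_imp_bounded bounded_iff by metis
    have pC: "C1_fun ?p" using t(1) by (simp add: test_fun_def C1_fun_def)
    have far: "norm (x - y) \<ge> r n" if "norm y > max M (norm x + r n)" for y
      using that norm_triangle_sub[of y x] by (simp add: norm_minus_commute)
    have "(LINT y|lborel. pd ?p 2 y * pd b 1 y) = (LINT y|lborel. pd ?p 1 y * pd b 2 y)"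
    proof (rule integral_pd_symmetric[OF pC _ bC, where R = "max M (norm x + r n)"])
      show "?p y = 0" if "norm y > max M (norm x + r n)" for y by (rule p0(1)[OF far[OF that]])
      show "b y = 0" if "norm y > max M (norm x + r n)" for y
        using that M[of y] by (intro b0) (auto simp: not_le)
    qed
    moreover have "pd ?p j y * pd b k y = pd ?p j y * a k y" for j k y
      using p0(2)[of y j] pb[OF ys, of y k] by (cases "norm (x - y) < r n") auto
    ultimately show "mollify_deriv (r n) (a 1) x (axis 2 1) = mollify_deriv (r n) (a 2) x (axis 1 1)"
      unfolding md by simp
  qed
  define f where "f w = Complex (pd \<phi> 1 (V w)) (- pd \<phi> 2 (V w))" for w
  define fn where "fn n w = Complex (mollify (r n) (a 1) (V w)) (- mollify (r n) (a 2) (V w))" for n w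
  let ?B = "ball (emb z0) R1"
  have VB: "V w \<in> ball z0 R1" if "w \<in> ?B" for w using dE'[of z0 "V w"] that by (simp add: VE)
  have hol: "fn n holomorphic_on ?B" for n
    unfolding holomorphic_on_open[OF open_ball]
  proof (intro ballI exI)
    fix w assume w: "w \<in> ?B"
    let ?A = "\<lambda>k j. mollify_deriv (r n) (a k) (V w) (axis j 1)"
    note cr = CR[OF VB[OF w], of n]
    have md: "mollify_deriv (r n) (a k) (V w) (V h) = Re h * ?A k 1 + Im h * ?A k 2" for k h
    proof -
      interpret bounded_linear "mollify_deriv (r n) (a k) (V w)"
        using has_derivative_mollify[OF r(1) ai] by (rule has_derivative_bounded_linear)
      have "V h = Re h *\<^sub>R axis 1 1 + Im h *\<^sub>R axis 2 1" by (simp add: V_def vec_eq_iff forall_2 axis_def)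
      then show ?thesis by (simp add: add scaleR)
    qed
    have dm: "((\<lambda>w. mollify (r n) (a k) (V w)) has_derivative (\<lambda>h. Re h * ?A k 1 + Im h * ?A k 2)) (at w)" for k
      using has_derivative_compose[OF bounded_linear_imp_has_derivative[OF bV, of "at w"] has_derivative_mollify[OF r(1)[of n] ai[of k], of "V w"]]
      by (simp add: md)
    have "((\<lambda>w. complex_of_real (mollify (r n) (a 1) (V w)) - \<i> * complex_of_real (mollify (r n) (a 2) (V w))) has_derivative
       (\<lambda>h. complex_of_real (Re h * ?A 1 1 + Im h * ?A 1 2) - \<i> * complex_of_real (Re h * ?A 2 1 + Im h * ?A 2 2))) (at w)"
      by (intro has_derivative_diff has_derivative_mult_right has_derivative_of_real dm)
    moreover have "fn n = (\<lambda>w. complex_of_real (mollify (r n) (a 1) (V w)) - \<i> * complex_of_real (mollify (r n) (a 2) (V w)))"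
      by (auto simp: fn_def complex_eq_iff fun_eq_iff)
    moreover have "(\<lambda>h. complex_of_real (Re h * ?A 1 1 + Im h * ?A 1 2) - \<i> * complex_of_real (Re h * ?A 2 1 + Im h * ?A 2 2)) =
       (*) (Complex (?A 1 1) (- ?A 2 1))"
    proof
      have "?A 2 2 = - ?A 1 1" using cr(1) by linarith
      then show "complex_of_real (Re h * ?A 1 1 + Im h * ?A 1 2) - \<i> * complex_of_real (Re h * ?A 2 1 + Im h * ?A 2 2) = Complex (?A 1 1) (- ?A 2 1) * h" for h
        using cr(2) by (simp add: complex_eq_iff algebra_simps)
    qed
    ultimately show "(fn n has_field_derivative Complex (?A 1 1) (- ?A 2 1)) (at w)"
      unfolding has_field_derivative_def by simp
  qed
  have unif: "\<exists>N. \<forall>n\<ge>N. \<forall>x\<in>ball z0 R1. \<bar>mollify (r n) (a k) x - pd \<phi> k x\<bar> \<le> \<epsilon>" if \<epsilon>: "\<epsilon> > 0" for k \<epsilon>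
  proof -
    have "uniformly_continuous_on (cball z0 R) (pd \<phi> k)" by (rule compact_uniformly_continuous[OF ca compact_cball])
    then obtain d where d: "d > 0" "\<And>x y. x \<in> cball z0 R \<Longrightarrow> y \<in> cball z0 R \<Longrightarrow> dist y x < d \<Longrightarrow> dist (pd \<phi> k y) (pd \<phi> k x) < \<epsilon>"
      using \<epsilon> unfolding uniformly_continuous_on_def by meson
    have "eventually (\<lambda>n. r n < d) sequentially" using r0 d(1) by (intro order_tendstoD) auto
    then obtain N where N: "\<And>n. n \<ge> N \<Longrightarrow> r n < d" by (auto simp: eventually_sequentially)
    have "\<bar>mollify (r n) (a k) x - pd \<phi> k x\<bar> \<le> \<epsilon>" if "n \<ge> N" and x: "x \<in> ball z0 R1" for n x
    proof -
      have "norm (mollify (r n) (a k) x - pd \<phi> k x) \<le> \<epsilon>"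
      proof (rule mollify_near[OF r(1) ai])
        fix y assume y: "dist x y < r n"
        have "dist z0 y \<le> dist z0 x + dist x y" by (rule dist_triangle)
        then have yb: "y \<in> cball z0 R" using y x r(2)[of n] by (auto simp: R1_def)
        have xb: "x \<in> cball z0 R" using x R by (auto simp: R1_def)
        have "dist (pd \<phi> k y) (pd \<phi> k x) < \<epsilon>" using d(2)[OF xb yb] y N[OF \<open>n \<ge> N\<close>] by (simp add: dist_commute)
        then show "norm (a k y - pd \<phi> k x) \<le> \<epsilon>" using yb by (simp add: a_def dist_norm)
      qed
      then show ?thesis by simp
    qed
    then show ?thesis by blast
  qed
  have "f holomorphic_on ?B"
  proof (rule holomorphic_uniform_sequence[OF open_ball hol])
    fix w assume "w \<in> ?B"
    then obtain d where d: "d > 0" "cball w d \<subseteq> ?B" using open_contains_cball by (metis open_ball)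
    have "uniform_limit (cball w d) fn f sequentially"
    proof (rule uniform_limitI)
      fix e :: real assume "e > 0"
      then have e3: "e / 3 > 0" by simp
      obtain N1 where N1: "\<And>n x. n \<ge> N1 \<Longrightarrow> x \<in> ball z0 R1 \<Longrightarrow> \<bar>mollify (r n) (a 1) x - pd \<phi> 1 x\<bar> \<le> e / 3" using unif[OF e3] by blast
      obtain N2 where N2: "\<And>n x. n \<ge> N2 \<Longrightarrow> x \<in> ball z0 R1 \<Longrightarrow> \<bar>mollify (r n) (a 2) x - pd \<phi> 2 x\<bar> \<le> e / 3" using unif[OF e3] by blast
      have "dist (fn n y) (f y) < e" if "n \<ge> max N1 N2" "y \<in> cball w d" for n y
      proof -
        have yb: "V y \<in> ball z0 R1" using that d VB by blast
        have "cmod (fn n y - f y) \<le> \<bar>Re (fn n y - f y)\<bar> + \<bar>Im (fn n y - f y)\<bar>" by (rule cmod_le)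
        also have "\<dots> \<le> e / 3 + e / 3"
          using N1[OF _ yb, of n] N2[OF _ yb, of n] that by (intro add_mono) (auto simp: fn_def f_def abs_minus_commute)
        also have "\<dots> < e" using \<open>e > 0\<close> by simp
        finally show ?thesis by (simp add: dist_norm)
      qed
      then show "\<forall>\<^sub>F n in sequentially. \<forall>x\<in>cball w d. dist (fn n x) (f x) < e"
        unfolding eventually_sequentially by blast
    qed
    then show "\<exists>d>0. cball w d \<subseteq> ?B \<and> uniform_limit (cball w d) fn f sequentially" using d by blast
  qed
  then obtain g where g: "\<And>w. w \<in> ?B \<Longrightarrow> (g has_field_derivative f w) (at w within ?B)"
    using holomorphic_convex_primitive'[OF convex_ball open_ball] by metis
  show ?thesis
  proof (rule that[of R1 "\<lambda>x. Im (g (emb x))"])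
    show "R1 > 0" using R by (simp add: R1_def)
    fix x assume x: "x \<in> ball z0 R1"
    then have eb: "emb x \<in> ?B" using dE'[of z0 x] by simp
    then have "(g has_field_derivative f (emb x)) (at (emb x))"
      using g[OF eb] by (simp add: at_within_open[OF eb open_ball])
    then have "(g has_derivative (*) (f (emb x))) (at (emb x))" by (simp add: has_field_derivative_def)
    from bounded_linear.has_derivative[OF bounded_linear_Im has_derivative_compose[OF bounded_linear_imp_has_derivative[OF bE] this]]
    have "((\<lambda>x. Im (g (emb x))) has_derivative (\<lambda>h. Im (f (emb x) * emb h))) (at x)" .
    moreover have "Im (f (emb x) * emb h) = (\<Sum>k\<in>UNIV. h $ k * potF \<phi> k x)" for h
      by (simp add: f_def VE eRI potF_def sum_2 algebra_simps)
    ultimately show "((\<lambda>x. Im (g (emb x))) has_derivative (\<lambda>h. \<Sum>k\<in>UNIV. h $ k * potF \<phi> k x)) (at x)" by simp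
  qed
qed

end

section \<open>The two variational problems\<close>

lemma complex_of_real_measurable:
  "f \<in> borel_measurable M \<Longrightarrow> (\<lambda>x. complex_of_real (f x)) \<in> borel_measurable M"
  by measurable

lemma sq_int_indicator:
  assumes "sq_int f" "S \<in> sets borel"
  shows "sq_int (\<lambda>x. complex_of_real (indicator S x) * f x)"
  using assms by (intro sq_int_mult_bounded[where B = 1] complex_of_real_measurable borel_measurable_indicator)
    (auto split: split_indicator)

text \<open>Mollifications of the restriction of \<open>h (g x)\<close> to \<open>K\<close> are test
  functions in \<open>U\<close> and converge in the mean, so orthogonality passes to the limit and
  says that the integral of \<open>(h (g x))\<^sup>2\<close> over \<open>K\<close> is 0.
  \<open>h\<close> stands for \<open>Re\<close> or \<open>Im\<close>, since test functions are
  real.\<close>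

lemma orthogonal_test_fun_real:
  fixes g :: "real^2 \<Rightarrow> complex" and h :: "complex \<Rightarrow> real"
  assumes U: "open U" and g: "sq_int g"
    and orth: "\<And>\<psi>. test_fun U \<psi> \<Longrightarrow> (LINT x|lborel. complex_of_real (\<psi> x) * g x) = 0"
    and h: "bounded_linear h" "\<And>z. \<bar>h z\<bar> \<le> cmod z" and K: "compact K" "K \<subseteq> U"
  shows "AE x in lborel. x \<in> K \<longrightarrow> h (g x) = 0"
proof -
  interpret h: bounded_linear h by (rule h)
  define f where "f x = indicator K x * h (g x)" for x
  have Ks: "K \<in> sets borel" by (intro borel_closed compact_imp_closed K)
  have hm: "(\<lambda>x. h (g x)) \<in> borel_measurable borel"
    using measurable_compose[OF sq_int_measurable[OF g] borel_measurable_continuous_onI[OF h.continuous_on[OF continuous_on_id]]] by simp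
  have hg: "sq_int (\<lambda>x. complex_of_real (h (g x)))"
  proof (rule sq_int_bound)
    show "integrable lborel (\<lambda>x. (cmod (g x))\<^sup>2)" using g by simp
    show "(cmod (complex_of_real (h (g x))))\<^sup>2 \<le> (cmod (g x))\<^sup>2" for x
      using power_mono[OF h(2)[of "g x"], of 2] by simp
  qed (use hm in simp)
  have fs: "sq_int (\<lambda>x. complex_of_real (f x))" unfolding f_def of_real_mult by (rule sq_int_indicator[OF hg Ks])
  obtain R where R: "\<And>x. x \<in> K \<Longrightarrow> norm x \<le> R" using K(1) compact_imp_bounded bounded_iff by metis
  have f0: "complex_of_real (f x) = 0" if "norm x > R" for x using R[of x] that by (auto simp: f_def indicator_def)
  have fi: "integrable lborel (\<lambda>x. complex_of_real (f x))" by (rule sq_int_integrable[OF fs f0])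
  then have fr: "integrable lborel f" using integrable_Re[OF fi] by simp
  obtain e K' where e: "e > 0" "compact K'" "K' \<subseteq> U" and near: "\<And>x y. y \<in> K \<Longrightarrow> dist y x \<le> e \<Longrightarrow> x \<in> K'"
    using compact_neighbourhood[OF K(1) U K(2)] by metis
  define r where "r n = e * inverse (real (Suc n))" for n
  have r: "r n > 0" "r n \<le> e" for n
    using e inverse_Suc_null_sequence(3)[of n] by (auto simp: r_def mult_left_le)
  have r0: "r \<longlonglongrightarrow> 0" unfolding r_def by (rule tendsto_mult_right_zero[OF inverse_Suc_null_sequence(1)])
  have mo: "mollify (r n) (\<lambda>x. complex_of_real (f x)) x = complex_of_real (mollify (r n) f x)" for n x
    unfolding mollify_def by (simp add: scaleR_conv_of_real flip: of_real_mult)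
  have "l2_lim (\<lambda>n. mollify (r n) (\<lambda>x. complex_of_real (f x))) (\<lambda>x. complex_of_real (f x))"
    by (rule l2_lim_mollify[OF fs f0 r(1) r0])
  from l2_lim_pair[OF this g]
  have "(\<lambda>n. LINT x|lborel. complex_of_real (mollify (r n) f x) * g x) \<longlonglongrightarrow> (LINT x|lborel. complex_of_real (f x) * g x)"
    by (simp only: mo)
  moreover have "(LINT x|lborel. complex_of_real (mollify (r n) f x) * g x) = 0" for n
  proof (rule orth, unfold test_fun_iff, intro conjI exI[of _ K'] allI impI)
    show "C1_fun (mollify (r n) f)" by (rule C1_fun_mollify[OF r(1) fr])
    fix x assume x: "x \<notin> K'"
    show "mollify (r n) f x = 0"
    proof (rule mollify_eq_0[OF r(1) fr])
      fix y assume "dist x y < r n"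
      then have "dist y x \<le> e" using r(2)[of n] by (simp add: dist_commute)
      then have "y \<notin> K" using near x by blast
      then show "f y = 0" by (simp add: f_def)
    qed
  qed (use e in auto)
  ultimately have "(\<lambda>n. 0) \<longlonglongrightarrow> (LINT x|lborel. complex_of_real (f x) * g x)" by simp
  then have z: "(LINT x|lborel. complex_of_real (f x) * g x) = 0" by (simp add: LIMSEQ_const_iff)
  have i: "integrable lborel (\<lambda>x. complex_of_real (f x) * g x)" by (rule sq_int_mult_integrable[OF fs g])
  have eq: "h (complex_of_real (f x) * g x) = indicator K x * (h (g x))\<^sup>2" for x
    by (simp add: f_def scaleR_conv_of_real[symmetric] h.scaleR power2_eq_square)
  have "(LINT x|lborel. indicator K x * (h (g x))\<^sup>2) = 0"
    using integral_bounded_linear[OF h(1) i] unfolding eq z h.zero .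
  moreover have "integrable lborel (\<lambda>x. indicator K x * (h (g x))\<^sup>2)"
    using integrable_bounded_linear[OF h(1) i] unfolding eq .
  ultimately have "AE x in lborel. indicator K x * (h (g x))\<^sup>2 = 0"
    by (subst (asm) integral_nonneg_eq_0_iff_AE) auto
  then show ?thesis by eventually_elim (auto simp: indicator_def)
qed

lemma orthogonal_test_fun:
  fixes g :: "real^2 \<Rightarrow> complex"
  assumes U: "open U" and g: "sq_int g"
    and orth: "\<And>\<psi>. test_fun U \<psi> \<Longrightarrow> (LINT x|lborel. complex_of_real (\<psi> x) * g x) = 0"
  shows "AE x in lborel. x \<in> U \<longrightarrow> g x = 0"
proof -
  obtain C :: "nat \<Rightarrow> (real^2) set" where C: "\<And>n. compact (C n)" "\<And>n. C n \<subseteq> U" "\<Union>(range C) = U"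
    using open_Union_compact_subsets[OF U] by metis
  have "AE x in lborel. \<forall>n. (x \<in> C n \<longrightarrow> Re (g x) = 0) \<and> (x \<in> C n \<longrightarrow> Im (g x) = 0)"
    unfolding AE_all_countable
    using orthogonal_test_fun_real[OF assms bounded_linear_Re abs_Re_le_cmod C(1,2)]
      orthogonal_test_fun_real[OF assms bounded_linear_Im abs_Im_le_cmod C(1,2)] by (auto intro: AE_conjI)
  then show ?thesis
  proof eventually_elim
    fix x assume *: "\<forall>n. (x \<in> C n \<longrightarrow> Re (g x) = 0) \<and> (x \<in> C n \<longrightarrow> Im (g x) = 0)"
    show "x \<in> U \<longrightarrow> g x = 0"
    proof
      assume "x \<in> U"
      then obtain n where "x \<in> C n" using C(3) by blast
      then show "g x = 0" using * by (simp add: complex_eq_iff)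
    qed
  qed
qed

text \<open>The difference of two weak gradients of one function is orthogonal to all test
  functions. This identifies the gradient of an extension by zero, which the Dirichlet condition
  only asserts to exist.\<close>

lemma weak_grad_unique:
  fixes u :: "real^2 \<Rightarrow> complex"
  assumes U: "open U" and 1: "H1grad U u G" and 2: "H1grad U u' G'" and eq: "\<And>x. x \<in> U \<Longrightarrow> u x = u' x"
  shows "AE x in lborel. x \<in> U \<longrightarrow> G k x = G' k x"
proof -
  let ?g = "\<lambda>x. zext U (G k) x - zext U (G' k) x"
  have s: "sq_int (zext U (G k))" "sq_int (zext U (G' k))" using 1 2 by (auto simp: H1grad_def L2_iff)
  have zz: "zext U u = zext U u'" using eq by (auto simp: zext_def)
  have "AE x in lborel. x \<in> U \<longrightarrow> ?g x = 0"
  proof (rule orthogonal_test_fun[OF U sq_int_diff[OF s]])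
    fix \<psi> assume p: "test_fun U \<psi>"
    have "(LINT x|lborel. complex_of_real (\<psi> x) * zext U (G k) x) = (LINT x|lborel. complex_of_real (\<psi> x) * zext U (G' k) x)"
    proof -
      have "(LINT x|lborel. complex_of_real (pd \<psi> k x) * zext U u x) = - (LINT x|lborel. complex_of_real (\<psi> x) * zext U (G k) x)"
        using 1 p unfolding H1grad_def weak_grad_zext by blast
      moreover have "(LINT x|lborel. complex_of_real (pd \<psi> k x) * zext U u x) = - (LINT x|lborel. complex_of_real (\<psi> x) * zext U (G' k) x)"
        unfolding zz using 2 p unfolding H1grad_def weak_grad_zext by blast
      ultimately show ?thesis by simp
    qed
    moreover have "integrable lborel (\<lambda>x. complex_of_real (\<psi> x) * zext U (G k) x)" "integrable lborel (\<lambda>x. complex_of_real (\<psi> x) * zext U (G' k) x)"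
      using test_fun_sq_int(1)[OF p] s by (auto intro: sq_int_mult_integrable)
    ultimately show "(LINT x|lborel. complex_of_real (\<psi> x) * ?g x) = 0" by (simp add: right_diff_distrib)
  qed
  then show ?thesis by eventually_elim (auto simp: zext_def)
qed

text \<open>A differentiable image of an interval in the plane is negligible. The frontier of
  \<omega> is what remains of \<Omega> once \<omega> and the complement of its closure are removed,
  so it must carry no mass or energy.\<close>

lemma C1_jordan_frontier_null:
  assumes "C1_jordan_boundary U"
  shows "frontier U \<in> null_sets lborel"
proof -
  obtain g D where g: "path_image g = frontier U"
    and d: "\<And>t. t \<in> {0..1} \<Longrightarrow> (g has_vector_derivative D t) (at t within {0..1})"
    using assms unfolding C1_jordan_boundary_def by blast
  have "negligible (g ` {0..1})"
  proof (rule negligible_differentiable_image_lowdim)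
    show "g differentiable_on {0..1}"
      unfolding differentiable_on_def using d by (metis differentiableI_vector)
  qed simp
  then have "negligible (frontier U)" using g by (simp add: path_image_def)
  then show ?thesis by (simp add: negligible_iff_null_sets null_sets_completion_iff)
qed

section \<open>Rayleigh quotients of the Neumann and of the Dirichlet problem\<close>

context flux
begin

abbreviation "\<Omega>0 \<equiv> \<Omega> - closure \<omega>"

lemma open_O0: "open \<Omega>0"
  using openO by (intro open_Diff closed_closure)

lemma O_measurable: "\<Omega> \<in> sets borel" "\<omega> \<in> sets borel" "\<Omega>0 \<in> sets borel"
  using openO openw open_O0 by auto

lemma A_measurable: "A \<Omega> \<Phi> k \<in> borel_measurable borel"
proof -
  have "(\<lambda>x. if x \<in> \<Omega> then \<Phi> * potF \<phi> k x else 0) \<in> borel_measurable borel"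
    by (rule borel_measurable_continuous_on_if) (use O_measurable potF_continuous in \<open>auto intro!: continuous_intros\<close>)
  then show ?thesis by (simp add: A_def[abs_def])
qed

lemma mag_energy_mdens:
  assumes "U \<subseteq> \<Omega>"
  shows "mag_energy U \<Phi> (potF \<phi>) u G = (LINT x|lborel. mdens (A \<Omega> \<Phi>) (zext U u) (\<lambda>k. zext U (G k)) x)"
  unfolding mag_energy_def set_lebesgue_integral_def
proof (rule Bochner_Integration.integral_cong)
  fix x
  have "cmod (- \<i> * G k x - complex_of_real (\<Phi> * potF \<phi> k x) * u x) = cmod (G k x - \<i> * complex_of_real (\<Phi> * potF \<phi> k x) * u x)" for k
  proof -
    have "- \<i> * G k x - complex_of_real (\<Phi> * potF \<phi> k x) * u x = - \<i> * (G k x - \<i> * complex_of_real (\<Phi> * potF \<phi> k x) * u x)"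
      by (simp add: algebra_simps)
    then show ?thesis by (simp add: norm_mult)
  qed
  then show "indicator U x *\<^sub>R (\<Sum>k\<in>UNIV. (cmod (- \<i> * G k x - complex_of_real (\<Phi> * potF \<phi> k x) * u x))\<^sup>2) =
    mdens (A \<Omega> \<Phi>) (zext U u) (\<lambda>k. zext U (G k)) x"
    using assms by (auto simp: mdens_def mgrad_def zext_def A_def)
qed simp

lemma mgrad_measurable:
  assumes "sq_int v" "\<And>k. sq_int (G k)"
  shows "mgrad (A \<Omega> \<Phi>) v G k \<in> borel_measurable borel"
  unfolding mgrad_def[abs_def]
  using A_measurable[of \<Phi> k] sq_int_measurable[OF assms(1)] sq_int_measurable[OF assms(2)[of k]]
  by (intro borel_measurable_diff borel_measurable_times complex_of_real_measurable borel_measurable_const)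

lemma mdens_measurable:
  assumes "sq_int v" "\<And>k. sq_int (G k)"
  shows "mdens (A \<Omega> \<Phi>) v G \<in> borel_measurable borel"
proof -
  have [measurable]: "mgrad (A \<Omega> \<Phi>) v G k \<in> borel_measurable borel" for k by (rule mgrad_measurable[OF assms])
  show ?thesis unfolding mdens_def[abs_def] by measurable
qed

text \<open>On all of \<Omega> the potential may be unbounded, so square integrability has to come
  from the energy density and not from a bound on the potential.\<close>

lemma mgrad_sq_int:
  assumes "sq_int v" "\<And>k. sq_int (G k)" "integrable lborel (mdens (A \<Omega> \<Phi>) v G)"
  shows "sq_int (mgrad (A \<Omega> \<Phi>) v G k)"
proof (rule sq_int_bound[OF mgrad_measurable[OF assms(1,2)] assms(3)])
  show "(cmod (mgrad (A \<Omega> \<Phi>) v G k x))\<^sup>2 \<le> mdens (A \<Omega> \<Phi>) v G x" for x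
    unfolding mdens_def by (rule member_le_sum) auto
qed

definition "set_N \<Phi> = {mag_energy \<Omega> \<Phi> (potF \<phi>) u G / L2norm2 \<Omega> u | u G. H1grad \<Omega> u G \<and> L2norm2 \<Omega> u > 0}"

definition "set_D \<Phi> = {mag_energy \<Omega>0 \<Phi> (potF \<phi>) u G / L2norm2 \<Omega>0 u | u G.
      H1grad \<Omega>0 u G \<and> (\<exists>G'. H1grad \<Omega> (\<lambda>x. if x \<in> \<Omega>0 then u x else 0) G') \<and> L2norm2 \<Omega>0 u > 0}"

lemma lambda_sets:
  "lambda_N \<Omega> (potF \<phi>) \<Phi> = Inf (set_N \<Phi>)" "lambda_D \<Omega> \<omega> (potF \<phi>) \<Phi> = Inf (set_D \<Phi>)"
  unfolding lambda_N_def lambda_D_def set_N_def set_D_def by auto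

lemma mag_energy_nonneg: "0 \<le> mag_energy U \<Phi> F u G"
  unfolding mag_energy_def set_lebesgue_integral_def by (intro integral_nonneg_AE AE_I2) (auto intro!: mult_nonneg_nonneg sum_nonneg)

lemma sets_nonneg: "q \<in> set_N \<Phi> \<Longrightarrow> 0 \<le> q" "q \<in> set_D \<Phi> \<Longrightarrow> 0 \<le> q"
  unfolding set_N_def set_D_def by (auto intro!: divide_nonneg_pos mag_energy_nonneg)

lemma sets_bdd_below: "bdd_below (set_N \<Phi>)" "bdd_below (set_D \<Phi>)"
  using sets_nonneg by (auto intro!: bdd_belowI[of _ 0])

text \<open>The extension by zero competes in \<Omega>. Its weak gradient agrees almost everywhere
  with \<open>G\<close> on \<open>\<Omega>0\<close> and with 0 on \<omega>, by uniqueness on these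
  open sets, and the frontier between them is null; hence the quotient does not change.\<close>

lemma set_D_subset_set_N:
  assumes null: "frontier \<omega> \<in> null_sets lborel"
  shows "set_D \<Phi> \<subseteq> set_N \<Phi>"
proof
  fix q assume "q \<in> set_D \<Phi>"
  then obtain u G G' where q: "q = mag_energy \<Omega>0 \<Phi> (potF \<phi>) u G / L2norm2 \<Omega>0 u"
    and G: "H1grad \<Omega>0 u G" and G': "H1grad \<Omega> (\<lambda>x. if x \<in> \<Omega>0 then u x else 0) G'" and pos: "L2norm2 \<Omega>0 u > 0"
    unfolding set_D_def by blast
  define w where "w x = (if x \<in> \<Omega>0 then u x else 0)" for x
  have G': "H1grad \<Omega> w G'" using G' by (simp add: w_def[abs_def])
  have zw: "zext \<Omega> w = zext \<Omega>0 u" by (auto simp: zext_def w_def)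
  have n: "L2norm2 \<Omega> w = L2norm2 \<Omega>0 u" unfolding L2norm2_zext zw ..
  have wO: "\<omega> \<subseteq> \<Omega>" using w_O closure_subset by blast
  have z0: "H1grad \<omega> (\<lambda>_. 0) (\<lambda>_ _. 0)"
    unfolding H1grad_def L2_iff weak_grad_zext by (simp add: zext_def[abs_def] sq_int_def)
  have 1: "AE x in lborel. x \<in> \<Omega>0 \<longrightarrow> G' k x = G k x" for k
    by (rule weak_grad_unique[OF open_O0 H1grad_restrict[OF G' _ open_O0] G]) (auto simp: w_def)
  have 2: "AE x in lborel. x \<in> \<omega> \<longrightarrow> G' k x = 0" for k
    by (rule weak_grad_unique[OF openw H1grad_restrict[OF G' wO openw] z0]) (use closure_subset in \<open>auto simp: w_def\<close>)
  have 3: "AE x in lborel. x \<notin> frontier \<omega>" using null by (rule AE_not_in)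
  have s: "sq_int (zext \<Omega> w)" "sq_int (zext \<Omega> (G' k))" "sq_int (zext \<Omega>0 u)" "sq_int (zext \<Omega>0 (G k))" for k
    using G G' by (auto simp: H1grad_def L2_iff)
  have AE: "AE x in lborel. zext \<Omega> (G' k) x = zext \<Omega>0 (G k) x" for k
    using 1[of k] 2[of k] 3
  proof eventually_elim
    fix x assume a: "x \<in> \<Omega>0 \<longrightarrow> G' k x = G k x" "x \<in> \<omega> \<longrightarrow> G' k x = 0" "x \<notin> frontier \<omega>"
    have "x \<in> closure \<omega> \<Longrightarrow> x \<in> \<omega>" using a(3) openw by (simp add: frontier_def interior_open)
    then show "zext \<Omega> (G' k) x = zext \<Omega>0 (G k) x" using a(1,2) by (auto simp: zext_def)
  qed
  have "AE x in lborel. zext \<Omega> (G' 1) x = zext \<Omega>0 (G 1) x \<and> zext \<Omega> (G' 2) x = zext \<Omega>0 (G 2) x"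
    using AE[of 1] AE[of 2] by (rule AE_conjI)
  then have "AE x in lborel. mdens (A \<Omega> \<Phi>) (zext \<Omega> w) (\<lambda>k. zext \<Omega> (G' k)) x = mdens (A \<Omega> \<Phi>) (zext \<Omega>0 u) (\<lambda>k. zext \<Omega>0 (G k)) x"
    by eventually_elim (simp add: mdens_def mgrad_def zw sum_2)
  then have "mag_energy \<Omega> \<Phi> (potF \<phi>) w G' = mag_energy \<Omega>0 \<Phi> (potF \<phi>) u G"
    unfolding mag_energy_mdens[OF order_refl] mag_energy_mdens[OF Diff_subset]
    by (intro integral_cong_AE) (use s mdens_measurable in auto)
  then have "q = mag_energy \<Omega> \<Phi> (potF \<phi>) w G' / L2norm2 \<Omega> w" unfolding q n by simp
  then show "q \<in> set_N \<Phi>" unfolding set_N_def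
    using G' pos n by (intro CollectI exI[of _ w] exI[of _ G']) simp
qed

lemma admissible_D:
  assumes w: "H1grad \<Omega> w Gw" and 0: "\<And>x. x \<notin> \<Omega>0 \<Longrightarrow> w x = 0" "\<And>x k. x \<notin> \<Omega>0 \<Longrightarrow> Gw k x = 0"
    and pos: "(LINT x|lborel. (cmod (w x))\<^sup>2) > 0"
  shows "(LINT x|lborel. mdens (A \<Omega> \<Phi>) w Gw x) / (LINT x|lborel. (cmod (w x))\<^sup>2) \<in> set_D \<Phi>"
proof -
  have z: "zext \<Omega>0 w = w" "zext \<Omega>0 (Gw k) = Gw k" for k using 0 by (auto simp: zext_def)
  have e: "(\<lambda>x. if x \<in> \<Omega>0 then w x else 0) = w" using 0 by auto
  have "(LINT x|lborel. mdens (A \<Omega> \<Phi>) w Gw x) = mag_energy \<Omega>0 \<Phi> (potF \<phi>) w Gw"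
    unfolding mag_energy_mdens[OF Diff_subset] z ..
  moreover have "(LINT x|lborel. (cmod (w x))\<^sup>2) = L2norm2 \<Omega>0 w" unfolding L2norm2_zext z ..
  moreover have "H1grad \<Omega>0 w Gw" by (rule H1grad_restrict[OF w Diff_subset open_O0])
  ultimately show ?thesis unfolding set_D_def
    using w pos by (intro CollectI exI[of _ w] exI[of _ Gw] conjI) (simp_all only: e)
qed

lemma O0_nonempty:
  assumes "\<Omega> \<noteq> {}"
  shows "\<Omega>0 \<noteq> {}"
proof
  assume "\<Omega>0 = {}"
  then have "\<Omega> = closure \<omega>" using w_O by auto
  then have "closed \<Omega>" by simp
  then have "\<Omega> = {} \<or> \<Omega> = UNIV" using openO clopen by blast
  then show False using assms bounded_O not_bounded_UNIV by auto
qed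

text \<open>Multiplication by \<open>exp (\<i> * \<Phi> * \<theta>)\<close> gauges the potential
  away on a small ball, so the magnetic energy of the trial function is the plain Dirichlet energy
  of the bump. The quotient is therefore the same number for every \<Phi>.\<close>

lemma trial_function:
  assumes "\<Omega> \<noteq> {}"
  obtains \<Lambda> where "\<Lambda> \<ge> 0" "\<And>\<Phi>. \<Lambda> \<in> set_D \<Phi>"
proof -
  obtain z0 where "z0 \<in> \<Omega>0" using O0_nonempty[OF assms] by blast
  then obtain R0 where R0: "R0 > 0" "cball z0 R0 \<subseteq> \<Omega>0" using open_O0 open_contains_cball by metis
  have "\<exists>\<theta> R1. R1 > 0 \<and> (\<forall>x\<in>ball z0 R1. (\<theta> has_derivative (\<lambda>h. \<Sum>k\<in>UNIV. h $ k * potF \<phi> k x)) (at x))"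
    by (rule gauge_function[OF R0]) blast
  then obtain \<theta> R1 where R1: "R1 > 0" and th0: "\<And>x. x \<in> ball z0 R1 \<Longrightarrow> (\<theta> has_derivative (\<lambda>h. \<Sum>k\<in>UNIV. h $ k * potF \<phi> k x)) (at x)"
    by blast
  define R where "R = min R0 R1"
  have R: "R > 0" "ball z0 R \<subseteq> \<Omega>0"
    using R0(1) R1 by (simp add: R_def, intro order_trans[OF _ R0(2)]) (auto simp: R_def)
  have th: "(\<theta> has_derivative (\<lambda>h. \<Sum>k\<in>UNIV. h $ k * potF \<phi> k x)) (at x)" if "x \<in> ball z0 R" for x
    using th0[of x] that by (auto simp: R_def)
  \<comment> \<open>The bump has radius \<open>r\<close> strictly below \<open>R\<close>, which
    leaves a shell on which the trial function is 0 by both of its formulas.\<close>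
  define r where "r = R / 2"
  have r: "r > 0" "r < R" using R by (auto simp: r_def)
  define c where "c = (LINT x|lborel. (bump r (x - z0))\<^sup>2)"
  define E where "E = (LINT x|lborel. (\<Sum>k\<in>UNIV. (bump_deriv r (x - z0) (axis k 1))\<^sup>2))"
  have far: "norm (x - z0) \<ge> r" if "norm x > norm z0 + r" for x
    using that norm_triangle_sub[of x z0] by simp
  have c: "c > 0"
  proof -
    have i: "integrable lborel (\<lambda>x. (bump r (x - z0))\<^sup>2)"
      using bump_outside[OF r(1)] far
      by (intro continuous_compact_support_integrable[where R = "norm z0 + r"] continuous_intros) auto
    have "c \<noteq> 0"
    proof
      assume "c = 0"
      then have "AE x in lborel. (bump r (x - z0))\<^sup>2 = 0"
        unfolding c_def using i by (subst (asm) integral_nonneg_eq_0_iff_AE) auto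
      then have "AE x in lborel. bump r (x - z0) / bump_mass r TYPE(real^2) = 0" by eventually_elim simp
      then have "(LINT x|lborel. bump r (x - z0) / bump_mass r TYPE(real^2)) = 0" by (rule integral_eq_zero_AE)
      then show False using kernel_integral(3)[OF r(1), of z0] by simp
    qed
    moreover have "c \<ge> 0" unfolding c_def by simp
    ultimately show ?thesis by simp
  qed
  have "E / c \<in> set_D \<Phi>" for \<Phi>
  proof -
    define ph where "ph x = exp (\<i> * complex_of_real (\<Phi> * \<theta> x))" for x
    define u where "u x = (if x \<in> ball z0 R then complex_of_real (bump r (x - z0)) * ph x else 0)" for x
    define G where "G k x = (if x \<in> ball z0 R then (complex_of_real (bump_deriv r (x - z0) (axis k 1))
       + \<i> * complex_of_real (\<Phi> * potF \<phi> k x * bump r (x - z0))) * ph x else 0)" for k x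
    have ph1: "cmod (ph x) = 1" for x by (simp add: ph_def)
    have u0: "u x = 0" "G k x = 0" if "x \<notin> cball z0 r" for x k
      using that bump_outside[OF r(1), of "x - z0"] bump_deriv_outside[OF r(1), of "x - z0"]
      by (auto simp: u_def G_def dist_norm norm_minus_commute)
    \<comment> \<open>These two open sets cover the plane: on the ball the product formula holds,
      off the smaller closed ball everything vanishes. Derivative and continuity of the gradient are
      checked on each.\<close>
    have out: "open (- cball z0 r)" "ball z0 R \<union> - cball z0 r = UNIV" using r by auto
    have du: "(u has_derivative (\<lambda>h. \<Sum>k\<in>UNIV. complex_of_real (h $ k) * G k x)) (at x)" for x
    proof (cases "x \<in> ball z0 R")
      case True
      let ?b = "bump_deriv r (x - z0)"
      interpret b: bounded_linear ?b by (rule linear_bump_deriv)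
      have "((\<lambda>x. x - z0) has_derivative (\<lambda>h. h)) (at x)" by (auto intro!: derivative_eq_intros)
      from has_derivative_compose[OF this has_derivative_bump[OF r(1)]]
      have d1: "((\<lambda>x. complex_of_real (bump r (x - z0))) has_derivative (\<lambda>h. complex_of_real (?b h))) (at x)"
        by (rule has_derivative_of_real)
      have "((\<lambda>x. \<i> * complex_of_real (\<Phi> * \<theta> x)) has_derivative (\<lambda>h. \<i> * complex_of_real (\<Phi> * (\<Sum>k\<in>UNIV. h $ k * potF \<phi> k x)))) (at x)"
        by (intro has_derivative_mult_right has_derivative_of_real th True)
      moreover have "(exp has_derivative (*) (ph x)) (at (\<i> * complex_of_real (\<Phi> * \<theta> x)))"
        using DERIV_exp[of "\<i> * complex_of_real (\<Phi> * \<theta> x)"] by (simp add: has_field_derivative_def ph_def)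
      ultimately have d2: "(ph has_derivative (\<lambda>h. ph x * (\<i> * complex_of_real (\<Phi> * (\<Sum>k\<in>UNIV. h $ k * potF \<phi> k x))))) (at x)"
        unfolding ph_def[abs_def] by (rule has_derivative_compose)
      have bs: "?b h = (\<Sum>k\<in>UNIV. h $ k * ?b (axis k 1))" for h
        by (subst vec2_axis_sum[of h, symmetric]) (simp only: b.sum b.scaleR real_scaleR_def)
      have Gx: "G k x = (complex_of_real (?b (axis k 1)) + \<i> * complex_of_real (\<Phi> * potF \<phi> k x * bump r (x - z0))) * ph x" for k
        using True by (simp only: G_def if_True)
      have alg: "\<beta> * (p * (\<i> * (P * (h1 * f1 + h2 * f2)))) + (h1 * b1 + h2 * b2) * p
        = h1 * ((b1 + \<i> * (P * f1 * \<beta>)) * p) + h2 * ((b2 + \<i> * (P * f2 * \<beta>)) * p)" for \<beta> p P h1 h2 f1 f2 b1 b2 :: complex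
        by (simp add: algebra_simps)
      have "((\<lambda>x. complex_of_real (bump r (x - z0)) * ph x) has_derivative (\<lambda>h. \<Sum>k\<in>UNIV. complex_of_real (h $ k) * G k x)) (at x)"
      proof (rule has_derivative_eq_rhs[OF has_derivative_mult[OF d1 d2]], rule ext)
        fix h
        show "complex_of_real (bump r (x - z0)) * (ph x * (\<i> * complex_of_real (\<Phi> * (\<Sum>k\<in>UNIV. h $ k * potF \<phi> k x)))) + complex_of_real (?b h) * ph x
          = (\<Sum>k\<in>UNIV. complex_of_real (h $ k) * G k x)"
          unfolding bs[of h] Gx sum_2 of_real_add of_real_mult by (rule alg)
      qed
      then show ?thesis
        by (rule has_derivative_transform_within_open[OF _ open_ball True]) (simp add: u_def)
    next
      case False
      then have x: "x \<in> - cball z0 r" using out(2) by blast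
      have "((\<lambda>_. 0) has_derivative (\<lambda>h. \<Sum>k\<in>UNIV. complex_of_real (h $ k) * G k x)) (at x)"
        using u0(2)[of x] x by simp
      then show ?thesis by (rule has_derivative_transform_within_open[OF _ out(1) x]) (simp add: u0)
    qed
    have cG: "continuous_on UNIV (G k)" for k
    proof -
      have sub: "ball z0 R \<subseteq> \<Omega>" using R by auto
      have cth: "continuous_on (ball z0 R) \<theta>"
        using th by (meson continuous_at_imp_continuous_on has_derivative_continuous)
      have "continuous_on (ball z0 R) (\<lambda>x. (complex_of_real (bump_deriv r (x - z0) (axis k 1))
          + \<i> * complex_of_real (\<Phi> * potF \<phi> k x * bump r (x - z0))) * ph x)"
        unfolding ph_def by (intro continuous_intros cth continuous_on_subset[OF potF_continuous sub])
      then have 1: "continuous_on (ball z0 R) (G k)" by (rule continuous_on_eq) (simp add: G_def)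
      have 2: "continuous_on (- cball z0 r) (G k)"
        by (rule continuous_on_eq[OF continuous_on_const[of _ 0]]) (simp add: u0)
      show ?thesis using continuous_on_open_Un[OF open_ball out(1) 1 2] out(2) by simp
    qed
    have C: "C1c u G"
      unfolding C1c_def using du cG
    proof (intro conjI allI exI[of _ "norm z0 + r"] impI)
      fix x :: "real^2" assume "norm z0 + r < norm x"
      then have "x \<notin> cball z0 r" using norm_triangle_sub[of x z0] by (auto simp: dist_norm norm_minus_commute)
      then show "u x = 0" by (rule u0)
    qed auto
    have n: "(LINT x|lborel. (cmod (u x))\<^sup>2) = c"
      unfolding c_def
    proof (rule Bochner_Integration.integral_cong)
      fix x show "(cmod (u x))\<^sup>2 = (bump r (x - z0))\<^sup>2"
        using bump_outside[OF r(1), of "x - z0"] r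
        by (auto simp: u_def norm_mult ph1 dist_norm norm_minus_commute)
    qed simp
    have e: "(LINT x|lborel. mdens (A \<Omega> \<Phi>) u G x) = E"
      unfolding E_def
    proof (rule Bochner_Integration.integral_cong)
      fix x
      show "mdens (A \<Omega> \<Phi>) u G x = (\<Sum>k\<in>UNIV. (bump_deriv r (x - z0) (axis k 1))\<^sup>2)"
      proof (cases "x \<in> ball z0 R")
        case True
        then have "x \<in> \<Omega>" using R by auto
        then have "mgrad (A \<Omega> \<Phi>) u G k x = complex_of_real (bump_deriv r (x - z0) (axis k 1)) * ph x" for k
          using True by (simp add: mgrad_def u_def G_def A_def algebra_simps)
        then show ?thesis by (simp add: mdens_def norm_mult ph1)
      next
        case False
        then have "norm (x - z0) \<ge> r" using r by (auto simp: dist_norm norm_minus_commute)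
        then show ?thesis using False by (simp add: mdens_def mgrad_def u_def G_def bump_deriv_outside[OF r(1)])
      qed
    qed simp
    have H: "H1grad \<Omega> u G" by (rule H1grad_restrict[OF C1c_H1grad[OF C] subset_UNIV openO])
    have o0: "u x = 0" "G k x = 0" if "x \<notin> \<Omega>0" for x k
    proof -
      have "x \<notin> ball z0 R" using that R by auto
      then show "u x = 0" "G k x = 0" by (auto simp: u_def G_def)
    qed
    show ?thesis using admissible_D[OF H o0, of \<Phi>] c unfolding n e by simp
  qed
  then show ?thesis using that[of "E / c"] sets_nonneg(2) by blast
qed

end

section \<open>Cutoffs and the comparison\<close>

text \<open>The clauses on \<open>pd\<close> confine the gradient to distances strictly between
  \<open>r / 2\<close> and \<open>r\<close>, so the gradients of cutoffs at dyadic radii have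
  disjoint supports.\<close>

definition is_cutoff :: "(real^2) set \<Rightarrow> real \<Rightarrow> (real^2 \<Rightarrow> real) \<Rightarrow> bool" where
  "is_cutoff U r \<eta> \<longleftrightarrow> C1_fun \<eta> \<and> (\<forall>x. 0 \<le> \<eta> x \<and> \<eta> x \<le> 1 \<and>
     (infdist x U \<le> r / 2 \<longrightarrow> \<eta> x = 0 \<and> (\<forall>k. pd \<eta> k x = 0)) \<and>
     (infdist x U \<ge> r \<longrightarrow> \<eta> x = 1 \<and> (\<forall>k. pd \<eta> k x = 0)) \<and> (\<forall>k. \<bar>pd \<eta> k x\<bar> \<le> 4 / r))"

lemma ex_cutoff: "U \<noteq> {} \<Longrightarrow> bounded U \<Longrightarrow> r > 0 \<Longrightarrow> \<exists>\<eta>. is_cutoff U r \<eta>"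
  unfolding is_cutoff_def by (rule distance_cutoff[of U r]) blast+

definition cut :: "(real^2 \<Rightarrow> real) \<Rightarrow> (real^2 \<Rightarrow> complex) \<Rightarrow> real^2 \<Rightarrow> complex" where
  "cut \<eta> u x = complex_of_real (\<eta> x) * u x"

definition cut_grad :: "(real^2 \<Rightarrow> real) \<Rightarrow> (real^2 \<Rightarrow> complex) \<Rightarrow> (2 \<Rightarrow> real^2 \<Rightarrow> complex) \<Rightarrow> 2 \<Rightarrow> real^2 \<Rightarrow> complex" where
  "cut_grad \<eta> u G k x = complex_of_real (\<eta> x) * G k x + complex_of_real (pd \<eta> k x) * u x"

definition grad_sq :: "(real^2 \<Rightarrow> real) \<Rightarrow> real^2 \<Rightarrow> real" where
  "grad_sq \<eta> x = (\<Sum>k\<in>UNIV. (pd \<eta> k x)\<^sup>2)"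

lemma H1grad_cut:
  fixes u :: "real^2 \<Rightarrow> complex"
  assumes u: "H1grad U u G" and eta: "C1_fun \<eta>" "\<And>x. \<bar>\<eta> x\<bar> \<le> 1" "\<And>x k. \<bar>pd \<eta> k x\<bar> \<le> B" and V: "V \<in> sets borel"
    and test: "\<And>\<psi>. test_fun V \<psi> \<Longrightarrow> test_fun U (\<lambda>x. \<psi> x * \<eta> x)"
  shows "H1grad V (cut \<eta> (zext U u)) (cut_grad \<eta> (zext U u) (\<lambda>k. zext U (G k)))"
proof -
  have e: "zext U (\<lambda>x. \<eta> x * u x) = cut \<eta> (zext U u)"
    "(\<lambda>k. zext U (\<lambda>x. \<eta> x * G k x + pd \<eta> k x * u x)) = cut_grad \<eta> (zext U u) (\<lambda>k. zext U (G k))"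
    by (auto simp: cut_def cut_grad_def zext_def fun_eq_iff)
  have b: "\<bar>\<eta> x\<bar> \<le> max 1 B" "\<bar>pd \<eta> k x\<bar> \<le> max 1 B" for x k
    using eta(2)[of x] eta(3)[of k x] by (auto simp: le_max_iff_disj)
  have Vl: "V \<in> sets lborel" using V by simp
  show ?thesis using H1grad_mult[OF u eta(1) b Vl test] unfolding e .
qed

lemma test_fun_mult:
  assumes "test_fun U \<psi>" "C1_fun \<eta>"
  shows "test_fun U (\<lambda>x. \<psi> x * \<eta> x)" "test_fun U (\<lambda>x. \<eta> x * \<psi> x)"
proof -
  obtain K where K: "C1_fun \<psi>" "compact K" "K \<subseteq> U" "\<And>x. x \<notin> K \<Longrightarrow> \<psi> x = 0" using assms(1) unfolding test_fun_iff by blast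
  show "test_fun U (\<lambda>x. \<psi> x * \<eta> x)" "test_fun U (\<lambda>x. \<eta> x * \<psi> x)"
    unfolding test_fun_iff using K assms(2) C1_fun_mult by (auto intro!: exI[of _ K])
qed

lemma mgrad_cut: "mgrad a (cut \<eta> v) (cut_grad \<eta> v G) k x = complex_of_real (\<eta> x) * mgrad a v G k x + complex_of_real (pd \<eta> k x) * v x"
  by (simp add: mgrad_def cut_def cut_grad_def algebra_simps)

text \<open>Young's inequality with weight \<kappa>. The first coefficient can be made as close to 1
  as desired, because the energy must be preserved up to a small error and not merely up to a
  factor.\<close>

lemma cmod_add_sq_le_weighted:
  assumes "\<kappa> > 0"
  shows "(cmod (a + b))\<^sup>2 \<le> (1 + \<kappa>) * (cmod a)\<^sup>2 + (1 + 1 / \<kappa>) * (cmod b)\<^sup>2"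
proof -
  have "(cmod (a + b))\<^sup>2 \<le> (cmod a + cmod b)\<^sup>2" by (intro power_mono norm_triangle_ineq) auto
  moreover have "0 \<le> (sqrt \<kappa> * cmod a - cmod b / sqrt \<kappa>)\<^sup>2" by simp
  moreover have "(sqrt \<kappa> * cmod a - cmod b / sqrt \<kappa>)\<^sup>2 = \<kappa> * (cmod a)\<^sup>2 - 2 * cmod a * cmod b + (cmod b)\<^sup>2 / \<kappa>"
    using assms by (simp add: power2_diff power_mult_distrib power_divide)
  ultimately show ?thesis by (simp add: power2_sum algebra_simps)
qed

lemma mdens_cut:
  assumes \<kappa>: "\<kappa> > 0" and \<eta>: "\<bar>\<eta> x\<bar> \<le> 1"
  shows "mdens a (cut \<eta> v) (cut_grad \<eta> v G) x \<le> (1 + \<kappa>) * mdens a v G x + (1 + 1 / \<kappa>) * (grad_sq \<eta> x * (cmod (v x))\<^sup>2)"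
proof -
  have "(cmod (mgrad a (cut \<eta> v) (cut_grad \<eta> v G) k x))\<^sup>2 \<le> (1 + \<kappa>) * (cmod (mgrad a v G k x))\<^sup>2 + (1 + 1 / \<kappa>) * ((pd \<eta> k x)\<^sup>2 * (cmod (v x))\<^sup>2)" for k
  proof -
    have "(cmod (mgrad a (cut \<eta> v) (cut_grad \<eta> v G) k x))\<^sup>2 \<le> (1 + \<kappa>) * (cmod (complex_of_real (\<eta> x) * mgrad a v G k x))\<^sup>2 + (1 + 1 / \<kappa>) * (cmod (complex_of_real (pd \<eta> k x) * v x))\<^sup>2"
      unfolding mgrad_cut by (rule cmod_add_sq_le_weighted[OF \<kappa>])
    also have "cmod (complex_of_real (\<eta> x) * mgrad a v G k x) \<le> cmod (mgrad a v G k x)"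
      using \<eta> by (simp add: norm_mult mult_left_le_one_le)
    then have "(1 + \<kappa>) * (cmod (complex_of_real (\<eta> x) * mgrad a v G k x))\<^sup>2 \<le> (1 + \<kappa>) * (cmod (mgrad a v G k x))\<^sup>2"
      using \<kappa> by (intro mult_left_mono power_mono) auto
    finally show ?thesis by (simp add: norm_mult power_mult_distrib)
  qed
  then have "mdens a (cut \<eta> v) (cut_grad \<eta> v G) x \<le> (\<Sum>k\<in>UNIV. (1 + \<kappa>) * (cmod (mgrad a v G k x))\<^sup>2 + (1 + 1 / \<kappa>) * ((pd \<eta> k x)\<^sup>2 * (cmod (v x))\<^sup>2))"
    unfolding mdens_def by (intro sum_mono)
  then show ?thesis unfolding mdens_def grad_sq_def by (simp add: sum.distrib sum_distrib_left sum_distrib_right)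
qed

lemma grad_sq_le: "(\<And>k. \<bar>pd \<eta> k x\<bar> \<le> B) \<Longrightarrow> 0 \<le> grad_sq \<eta> x \<and> grad_sq \<eta> x \<le> 2 * B\<^sup>2"
  using power_mono[of "\<bar>pd \<eta> 1 x\<bar>" B 2] power_mono[of "\<bar>pd \<eta> 2 x\<bar>" B 2] by (simp add: grad_sq_def sum_2)

lemma grad_sq_measurable: "C1_fun \<eta> \<Longrightarrow> grad_sq \<eta> \<in> borel_measurable borel"
  unfolding grad_sq_def by (intro borel_measurable_continuous_onI continuous_intros) (simp add: C1_fun_def)

context flux
begin

lemma bounded_w: "bounded \<omega>"
  by (rule bounded_subset[OF bounded_O]) (use w_O closure_subset in blast)

text \<open>Provides a collar of \<omega> inside a compact subset of \<Omega>, on which the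
  potential is bounded.\<close>

lemma inner_cutoff:
  obtains e K where "e > 0" "compact K" "K \<subseteq> \<Omega>" "\<And>x. infdist x \<omega> < e \<Longrightarrow> x \<in> K"
proof -
  have "compact (closure \<omega>)" using bounded_w by (simp add: compact_closure)
  then obtain e K where e: "e > 0" "compact K" "K \<subseteq> \<Omega>" and near: "\<And>x y. y \<in> closure \<omega> \<Longrightarrow> dist y x \<le> e \<Longrightarrow> x \<in> K"
    using compact_neighbourhood[OF _ openO w_O] by metis
  have "x \<in> K" if "infdist x \<omega> < e" for x
  proof -
    have "infdist x (closure \<omega>) \<le> infdist x \<omega>" by (rule infdist_mono[OF closure_subset w_ne])
    moreover obtain q where "q \<in> closure \<omega>" "infdist x (closure \<omega>) = dist x q"
      using infdist_attains_inf[of "closure \<omega>" x] w_ne by auto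
    ultimately show ?thesis using near[of q x] that by (simp add: dist_commute)
  qed
  then show ?thesis using that e by blast
qed

lemma cutoff_outer:
  assumes cut: "is_cutoff \<omega> r \<eta>" and r: "r > 0" and u: "H1grad \<Omega> u G"
  defines "w \<equiv> cut \<eta> (zext \<Omega> u)" and "Gw \<equiv> cut_grad \<eta> (zext \<Omega> u) (\<lambda>k. zext \<Omega> (G k))"
  shows "H1grad \<Omega> w Gw" "x \<notin> \<Omega>0 \<Longrightarrow> w x = 0" "x \<notin> \<Omega>0 \<Longrightarrow> Gw k x = 0" "sq_int w" "sq_int (Gw k)"
proof -
  have c: "C1_fun \<eta>" "\<And>x. \<bar>\<eta> x\<bar> \<le> 1" "\<And>x k. \<bar>pd \<eta> k x\<bar> \<le> 4 / r"
    using cut by (auto simp: is_cutoff_def)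
  show H: "H1grad \<Omega> w Gw" unfolding w_def Gw_def
    by (rule H1grad_cut[OF u c O_measurable(1)]) (rule test_fun_mult(1)[OF _ c(1)])
  have 0: "\<eta> x = 0 \<and> (\<forall>k. pd \<eta> k x = 0)" if "x \<in> closure \<omega>" for x
  proof -
    have "infdist x \<omega> = 0" using that w_ne by (simp add: in_closure_iff_infdist_zero)
    then show ?thesis using cut r unfolding is_cutoff_def by simp
  qed
  show "w x = 0" if "x \<notin> \<Omega>0" for x
    using that 0 by (cases "x \<in> closure \<omega>") (auto simp: w_def cut_def zext_def)
  show "Gw k x = 0" if "x \<notin> \<Omega>0" for x k
    using that 0 by (cases "x \<in> closure \<omega>") (auto simp: Gw_def cut_grad_def zext_def)
  have "zext \<Omega> w = w" "zext \<Omega> (Gw k) = Gw k" for k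
    by (auto simp: w_def Gw_def cut_def cut_grad_def zext_def fun_eq_iff)
  then show "sq_int w" "sq_int (Gw k)" using H by (auto simp: H1grad_def L2_iff)
qed

text \<open>The part of \<open>u\<close> near \<omega> is supported in \<open>K\<close>, so it
  extends to the plane and meets only a bounded potential. The magnetic lower bound and the Hardy
  inequality apply to this part, though not directly to \<open>u\<close>.\<close>

lemma cutoff_inner:
  assumes cut: "is_cutoff \<omega> r \<eta>" and r: "0 < r" "r \<le> e" and K: "compact K" "K \<subseteq> \<Omega>" "\<And>x. infdist x \<omega> < e \<Longrightarrow> x \<in> K"
    and u: "H1grad \<Omega> u G"
  defines "\<zeta> \<equiv> \<lambda>x. 1 - \<eta> x"
  defines "v \<equiv> cut \<zeta> (zext \<Omega> u)" and "Gv \<equiv> cut_grad \<zeta> (zext \<Omega> u) (\<lambda>k. zext \<Omega> (G k))"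
  shows "H1grad UNIV v Gv" "x \<notin> K \<Longrightarrow> v x = 0" "x \<notin> K \<Longrightarrow> Gv k x = 0"
    "mgrad (A K \<Phi>) v Gv = mgrad (A \<Omega> \<Phi>) v Gv" "sq_int (mgrad (A \<Omega> \<Phi>) v Gv k)"
proof -
  have c: "C1_fun \<eta>" "\<And>x. \<bar>\<eta> x\<bar> \<le> 1" "\<And>x k. \<bar>pd \<eta> k x\<bar> \<le> 4 / r"
    using cut by (auto simp: is_cutoff_def)
  have z: "C1_fun \<zeta>" "\<And>x. \<bar>\<zeta> x\<bar> \<le> 1" "\<And>x k. \<bar>pd \<zeta> k x\<bar> \<le> 4 / r"
    using C1_fun_one_minus[OF c(1)] c(3) cut by (auto simp: \<zeta>_def is_cutoff_def)
  have out: "\<zeta> x = 0 \<and> pd \<zeta> k x = 0" if "x \<notin> K" for x k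
  proof -
    have "infdist x \<omega> \<ge> r" using K(3)[of x] that r by fastforce
    then show ?thesis using cut C1_fun_one_minus(2)[OF c(1)] by (auto simp: \<zeta>_def is_cutoff_def)
  qed
  have t: "test_fun \<Omega> \<zeta>" unfolding test_fun_iff using z(1) K out by blast
  show H: "H1grad UNIV v Gv" unfolding v_def Gv_def
  proof (rule H1grad_cut[OF u z])
    show "test_fun \<Omega> (\<lambda>x. \<psi> x * \<zeta> x)" if "test_fun UNIV \<psi>" for \<psi>
      by (rule test_fun_mult(2)[OF t]) (use that in \<open>simp add: test_fun_def C1_fun_def\<close>)
  qed simp
  show v0: "x \<notin> K \<Longrightarrow> v x = 0" "x \<notin> K \<Longrightarrow> Gv k x = 0" for x k
    using out by (auto simp: v_def Gv_def cut_def cut_grad_def)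
  show m: "mgrad (A K \<Phi>) v Gv = mgrad (A \<Omega> \<Phi>) v Gv"
  proof (intro ext)
    fix k x show "mgrad (A K \<Phi>) v Gv k x = mgrad (A \<Omega> \<Phi>) v Gv k x"
      using v0(1)[of x] K(2) by (cases "x \<in> K") (auto simp: mgrad_def A_def)
  qed
  obtain B where B: "\<And>k x. \<bar>A K \<Phi> k x\<bar> \<le> B" using A_bound_uniform[OF K(1,2)] by blast
  have "sq_int v" "\<And>k. sq_int (Gv k)" using H by (auto simp: H1grad_def L2_iff)
  then show "sq_int (mgrad (A \<Omega> \<Phi>) v Gv k)"
    unfolding m[symmetric] using A_bounded(1)[OF K(1,2)] B by (rule sq_int_mgrad)
qed

text \<open>A nonintegrable energy density makes the Bochner integral, and hence the energy, \<open>0\<close>. The density is integrable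
  near \<open>\<omega>\<close>, so a cutoff there keeps it nonintegrable, and both infima vanish together.\<close>

lemma zero_in_set_D:
  assumes u: "H1grad \<Omega> u G" and ni: "\<not> integrable lborel (mdens (A \<Omega> \<Phi>) (zext \<Omega> u) (\<lambda>k. zext \<Omega> (G k)))"
  shows "0 \<in> set_D \<Phi>"
proof -
  obtain e K where e: "e > 0" and K: "compact K" "K \<subseteq> \<Omega>" "\<And>x. infdist x \<omega> < e \<Longrightarrow> x \<in> K" using inner_cutoff by blast
  obtain \<eta> where eta: "is_cutoff \<omega> e \<eta>" using ex_cutoff[OF w_ne bounded_w e] by blast
  let ?u = "zext \<Omega> u" and ?G = "\<lambda>k. zext \<Omega> (G k)"
  define w where "w = cut \<eta> ?u"
  define Gw where "Gw = cut_grad \<eta> ?u ?G"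
  note w = cutoff_outer[OF eta e u, folded w_def Gw_def]
  note v = cutoff_inner[OF eta e order_refl K u]
  have c: "C1_fun \<eta>" using eta by (simp add: is_cutoff_def)
  have niw: "\<not> integrable lborel (mdens (A \<Omega> \<Phi>) w Gw)"
  proof
    assume i: "integrable lborel (mdens (A \<Omega> \<Phi>) w Gw)"
    have s: "sq_int (mgrad (A \<Omega> \<Phi>) w Gw k)" for k by (rule mgrad_sq_int[OF w(4,5) i])
    have "mgrad (A \<Omega> \<Phi>) ?u ?G k = (\<lambda>x. mgrad (A \<Omega> \<Phi>) w Gw k x + mgrad (A \<Omega> \<Phi>) (cut (\<lambda>x. 1 - \<eta> x) ?u) (cut_grad (\<lambda>x. 1 - \<eta> x) ?u ?G) k x)" for k
      by (auto simp: w_def Gw_def mgrad_cut C1_fun_one_minus[OF c] algebra_simps)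
    then have "sq_int (mgrad (A \<Omega> \<Phi>) ?u ?G k)" for k using sq_int_add[OF s v(5)] by simp
    then show False using ni mdens_integrable by blast
  qed
  \<comment> \<open>Were \<open>w\<close> zero almost everywhere, the potential would drop out and
    the density would be that of \<open>Gw\<close> alone, which is integrable.\<close>
  have pos: "(LINT x|lborel. (cmod (w x))\<^sup>2) > 0"
  proof (rule ccontr)
    assume "\<not> ?thesis"
    then have "(LINT x|lborel. (cmod (w x))\<^sup>2) = 0" by (simp add: order_antisym)
    then have "AE x in lborel. (cmod (w x))\<^sup>2 = 0" using w(4) by (subst (asm) integral_nonneg_eq_0_iff_AE) auto
    then have ae: "AE x in lborel. mdens (A \<Omega> \<Phi>) w Gw x = (\<Sum>k\<in>UNIV. (cmod (Gw k x))\<^sup>2)"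
      by eventually_elim (simp add: mdens_def mgrad_def)
    have i: "integrable lborel (\<lambda>x. \<Sum>k\<in>UNIV. (cmod (Gw k x))\<^sup>2)" using w(5) by simp
    have m1: "mdens (A \<Omega> \<Phi>) w Gw \<in> borel_measurable lborel" using mdens_measurable[OF w(4,5)] by simp
    show False using niw integrable_cong_AE[OF m1 borel_measurable_integrable[OF i] ae] i by blast
  qed
  show ?thesis using admissible_D[OF w(1,2,3) pos, of \<Phi>] not_integrable_integral_eq[OF niw] by simp
qed

text \<open>The threshold \<open>\<Phi>0\<close> depends on \<open>M\<close> and \<epsilon> only,
  and the estimates are stated relative to the squared norm of \<open>u\<close>, so the result
  applies to a near-minimiser that changes with \<Phi>.\<close>

lemma dirichlet_competitor:
  assumes J: "C1_jordan_boundary \<omega>" and M: "M \<ge> 0" and \<epsilon>: "\<epsilon> > 0"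
  obtains \<Phi>0 where "\<And>\<Phi> u G. \<Phi> \<ge> \<Phi>0 \<Longrightarrow> H1grad \<Omega> u G \<Longrightarrow>
      integrable lborel (mdens (A \<Omega> \<Phi>) (zext \<Omega> u) (\<lambda>k. zext \<Omega> (G k))) \<Longrightarrow>
      (LINT x|lborel. mdens (A \<Omega> \<Phi>) (zext \<Omega> u) (\<lambda>k. zext \<Omega> (G k)) x) \<le> M * (LINT x|lborel. (cmod (zext \<Omega> u x))\<^sup>2) \<Longrightarrow>
      \<exists>w Gw. H1grad \<Omega> w Gw \<and> (\<forall>x. x \<notin> \<Omega>0 \<longrightarrow> w x = 0 \<and> (\<forall>k. Gw k x = 0)) \<and>
        (LINT x|lborel. mdens (A \<Omega> \<Phi>) w Gw x) \<le> (LINT x|lborel. mdens (A \<Omega> \<Phi>) (zext \<Omega> u) (\<lambda>k. zext \<Omega> (G k)) x) + \<epsilon> * (LINT x|lborel. (cmod (zext \<Omega> u x))\<^sup>2) \<and>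
        (1 - \<epsilon>) * (LINT x|lborel. (cmod (zext \<Omega> u x))\<^sup>2) \<le> (LINT x|lborel. (cmod (w x))\<^sup>2)"
proof -
  obtain \<rho> C where \<rho>: "\<rho> > 0" and C: "C \<ge> 0" and hardy:
    "\<And>v G K a B s. H1grad UNIV v G \<Longrightarrow> compact K \<Longrightarrow> (\<And>x. x \<notin> K \<Longrightarrow> v x = 0) \<Longrightarrow> (\<And>x k. x \<notin> K \<Longrightarrow> G k x = 0) \<Longrightarrow>
       (\<And>k. a k \<in> borel_measurable borel) \<Longrightarrow> (\<And>k x. \<bar>a k x\<bar> \<le> B) \<Longrightarrow> s > 0 \<Longrightarrow>
      (LINT z|lborel. indicator {z. 0 < infdist z \<omega> \<and> infdist z \<omega> < \<rho>} z / (infdist z \<omega> + s)\<^sup>2 * (cmod (v z))\<^sup>2) \<le>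
      C * ((LINT z|lborel. mdens a v G z) + (LINT z|lborel. (cmod (v z))\<^sup>2)
      + 1 / s\<^sup>2 * (LINT z|lborel. indicator \<omega> z * (cmod (v z))\<^sup>2))"
    using hardy_global[OF J openw bounded_w w_ne] by blast
  obtain e K where e: "e > 0" and K: "compact K" "K \<subseteq> \<Omega>" "\<And>x. infdist x \<omega> < e \<Longrightarrow> x \<in> K" using inner_cutoff by blast
  define b where "b = min \<rho> e"
  have b: "b > 0" "b \<le> e" "b \<le> \<rho>" using \<rho> e by (auto simp: b_def)
  obtain \<eta> where eta: "is_cutoff \<omega> b \<eta>" using ex_cutoff[OF w_ne bounded_w b(1)] by blast
  \<comment> \<open>The energy of the part \<open>v\<close> of \<open>u\<close> near \<omega>, in
    units of the mass: \<open>mdens_cut\<close> with weight 1 doubles the energy and doubles the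
    gradient term, itself at most \<open>2 * (4 / b)\<^sup>2\<close>.\<close>
  define C1 where "C1 = 2 * M + 64 / b\<^sup>2"
  \<comment> \<open>The Hardy constant times its three contributions: \<open>C1\<close> for the
    energy, 1 for the mass and 1 for the mass in \<omega> divided by
    \<open>s\<^sup>2\<close>.\<close>
  define C2 where "C2 = C * (C1 + 2)"
  define \<kappa> where "\<kappa> = \<epsilon> / (2 * (M + 1))"
  have C1: "C1 > 0" using M b by (simp add: C1_def add_nonneg_pos)
  have C2: "C2 \<ge> 0" using C C1 by (simp add: C2_def)
  have \<kappa>: "\<kappa> > 0" "\<kappa> * M \<le> \<epsilon> / 2" using \<epsilon> M by (auto simp: \<kappa>_def field_simps)
  \<comment> \<open>The first summand bounds the energy spent on cutting off, the second the mass
    lost in the collar, both before the gain \<open>1 / n\<close>;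
    \<open>2 * Y / \<epsilon> < n\<close> makes each at most \<open>\<epsilon> / 2\<close>.\<close>
  define Y where "Y = (1 + 1 / \<kappa>) * (128 * C2) + b\<^sup>2 * C2"
  have Y1: "0 \<le> (1 + 1 / \<kappa>) * (128 * C2)" "0 \<le> b\<^sup>2 * C2" using \<kappa> C2 by auto
  obtain n :: nat where n0: "2 * Y / \<epsilon> < real n" using reals_Archimedean2 by blast
  have "0 \<le> 2 * Y / \<epsilon>" using Y1 \<epsilon> by (simp add: Y_def)
  then have n: "n > 0" using n0 by (cases n) auto
  have Yn: "Y / real n \<le> \<epsilon> / 2" using n0 n \<epsilon> by (simp add: field_simps)
  \<comment> \<open>Radii start at \<open>b / 2\<close>, the distance up to which \<open>v\<close>
    equals \<open>u\<close>, so estimates for \<open>v\<close> hold for \<open>u\<close> in every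
    layer.\<close>
  define t where "t j = b / 2 * (1 / 2) ^ j" for j :: nat
  define s where "s = t (2 * n)"
  have t: "t j > 0" "t j \<le> b / 2" for j using b by (auto simp: t_def mult_left_le power_le_one)
  have tanti: "t i \<le> t j" if "j \<le> i" for i j
    using that b unfolding t_def by (intro mult_left_mono power_decreasing) auto
  have tS: "t (Suc j) = t j / 2" for j by (simp add: t_def)
  have s: "s > 0" unfolding s_def by (rule t)
  have "\<forall>j. \<exists>\<eta>. is_cutoff \<omega> (t j) \<eta>" using ex_cutoff[OF w_ne bounded_w t(1)] by blast
  then obtain \<xi> where xi: "\<And>j. is_cutoff \<omega> (t j) (\<xi> j)" by metis
  \<comment> \<open>The fraction of mass tolerated in \<omega>: \<open>s\<^sup>2\<close> tames the
    last Hardy term, and \<open>\<epsilon> / 2\<close> bounds the mass lost by vanishing on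
    \<omega>.\<close>
  define \<mu> where "\<mu> = min (s\<^sup>2) (\<epsilon> / 2)"
  have \<mu>: "\<mu> > 0" "\<mu> \<le> s\<^sup>2" "\<mu> \<le> \<epsilon> / 2" using s \<epsilon> by (auto simp: \<mu>_def)
  \<comment> \<open>From this value on, the magnetic bound
    \<open>\<Phi> * beta * m \<le> C1 * N\<close> forces the mass \<open>m\<close> in \<omega> below
    \<open>\<mu> * N\<close>.\<close>
  define \<Phi>0 where "\<Phi>0 = C1 / (beta * \<mu>)"
  have \<Phi>0: "\<Phi>0 > 0" using C1 beta_pos \<mu> by (simp add: \<Phi>0_def)
  show ?thesis
  proof (rule that[of \<Phi>0])
    fix \<Phi> u G
    assume Phi: "\<Phi> \<ge> \<Phi>0" and u: "H1grad \<Omega> u G"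
    define zu where "zu = zext \<Omega> u"
    define zG where "zG = (\<lambda>k. zext \<Omega> (G k))"
    define N where "N = (LINT x|lborel. (cmod (zu x))\<^sup>2)"
    define E where "E = (LINT x|lborel. mdens (A \<Omega> \<Phi>) zu zG x)"
    assume "integrable lborel (mdens (A \<Omega> \<Phi>) (zext \<Omega> u) (\<lambda>k. zext \<Omega> (G k)))"
    then have Ei: "integrable lborel (mdens (A \<Omega> \<Phi>) zu zG)" by (simp add: zu_def zG_def)
    assume "(LINT x|lborel. mdens (A \<Omega> \<Phi>) (zext \<Omega> u) (\<lambda>k. zext \<Omega> (G k)) x) \<le> M * (LINT x|lborel. (cmod (zext \<Omega> u x))\<^sup>2)"
    then have EM: "E \<le> M * N" by (simp add: E_def N_def zu_def zG_def)
    have su: "sq_int zu" using u by (simp add: H1grad_def L2_iff zu_def)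
    have N0: "0 \<le> N" by (simp add: N_def)
    have iu: "integrable lborel (\<lambda>x. (cmod (zu x))\<^sup>2)" using su by simp
    define \<zeta> where "\<zeta> = (\<lambda>x. 1 - \<eta> x)"
    define v where "v = cut \<zeta> zu"
    define Gv where "Gv = cut_grad \<zeta> zu zG"
    note vv = cutoff_inner[OF eta b(1,2) K u, folded \<zeta>_def, folded zu_def zG_def, folded v_def Gv_def]
    have ceta: "C1_fun \<eta>" using eta by (simp add: is_cutoff_def)
    have z1: "\<bar>\<zeta> x\<bar> \<le> 1" "\<bar>pd \<zeta> k x\<bar> \<le> 4 / b" for x k
      using eta by (auto simp: is_cutoff_def \<zeta>_def C1_fun_one_minus(2)[OF ceta])
    have vzu: "v x = zu x" if "infdist x \<omega> \<le> b / 2" for x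
      using eta that by (simp add: is_cutoff_def \<zeta>_def v_def cut_def)
    have vle: "(cmod (v x))\<^sup>2 \<le> (cmod (zu x))\<^sup>2" for x
      using z1(1)[of x] by (intro power_mono) (auto simp: v_def cut_def norm_mult mult_left_le_one_le)
    have sv: "sq_int v" using vv(1) by (simp add: H1grad_def L2_iff)
    have vN: "(LINT x|lborel. (cmod (v x))\<^sup>2) \<le> N"
      unfolding N_def using sv su vle by (intro integral_mono) auto
    have md: "mdens (A K \<Phi>) v Gv = mdens (A \<Omega> \<Phi>) v Gv" using vv(4) by (simp add: mdens_def fun_eq_iff)
    have iv: "integrable lborel (mdens (A \<Omega> \<Phi>) v Gv)" by (rule mdens_integrable[OF vv(5)])
    have Ev: "(LINT x|lborel. mdens (A \<Omega> \<Phi>) v Gv x) \<le> C1 * N"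
    proof -
      have "(LINT x|lborel. mdens (A \<Omega> \<Phi>) v Gv x) \<le> (LINT x|lborel. 2 * mdens (A \<Omega> \<Phi>) zu zG x + 64 / b\<^sup>2 * (cmod (zu x))\<^sup>2)"
      proof (rule integral_mono[OF iv])
        show "integrable lborel (\<lambda>x. 2 * mdens (A \<Omega> \<Phi>) zu zG x + 64 / b\<^sup>2 * (cmod (zu x))\<^sup>2)" using Ei iu by simp
        fix x
        have "mdens (A \<Omega> \<Phi>) v Gv x \<le> (1 + 1) * mdens (A \<Omega> \<Phi>) zu zG x + (1 + 1 / 1) * (grad_sq \<zeta> x * (cmod (zu x))\<^sup>2)"
          unfolding v_def Gv_def by (rule mdens_cut) (use z1 in auto)
        moreover have "grad_sq \<zeta> x * (cmod (zu x))\<^sup>2 \<le> 2 * (4 / b)\<^sup>2 * (cmod (zu x))\<^sup>2"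
          using grad_sq_le[of \<zeta> x "4 / b"] z1(2) by (intro mult_right_mono) auto
        moreover have "2 * (4 / b)\<^sup>2 * (cmod (zu x))\<^sup>2 = 32 / b\<^sup>2 * (cmod (zu x))\<^sup>2" by (simp add: power_divide)
        ultimately show "mdens (A \<Omega> \<Phi>) v Gv x \<le> 2 * mdens (A \<Omega> \<Phi>) zu zG x + 64 / b\<^sup>2 * (cmod (zu x))\<^sup>2" by simp
      qed
      also have "\<dots> = 2 * E + 64 / b\<^sup>2 * N" using Ei iu by (simp add: E_def N_def)
      also have "\<dots> \<le> C1 * N" using EM by (simp add: C1_def algebra_simps)
      finally show ?thesis .
    qed
    define m where "m = (LINT x|lborel. indicator \<omega> x * (cmod (zu x))\<^sup>2)"
    have mv: "m = (LINT x|lborel. indicator \<omega> x * (cmod (v x))\<^sup>2)"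
      unfolding m_def
    proof (rule Bochner_Integration.integral_cong)
      fix x show "indicator \<omega> x * (cmod (zu x))\<^sup>2 = indicator \<omega> x * (cmod (v x))\<^sup>2"
        using vzu[of x] b(1) by (cases "x \<in> \<omega>") (simp_all add: infdist_zero)
    qed simp
    have mN: "m \<le> \<mu> * N"
    proof -
      have P0: "\<Phi> > 0" using Phi \<Phi>0 by linarith
      have "\<Phi> * beta * m \<le> C1 * N"
        using magnetic_H1[OF vv(1) K(1,2) vv(2,3), of \<Phi>] P0 Ev unfolding md mv by linarith
      also have "C1 = \<Phi>0 * beta * \<mu>" using beta_pos \<mu> by (simp add: \<Phi>0_def)
      also have "\<Phi>0 * beta * \<mu> * N \<le> \<Phi> * beta * \<mu> * N" using Phi beta_pos \<mu> N0 by (intro mult_right_mono) auto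
      finally have "\<Phi> * beta * m \<le> \<Phi> * beta * (\<mu> * N)" by (simp add: mult.assoc)
      then show ?thesis using P0 beta_pos by simp
    qed
    define wt where "wt = (\<lambda>z. indicator {z. 0 < infdist z \<omega> \<and> infdist z \<omega> < \<rho>} z / (infdist z \<omega> + s)\<^sup>2 :: real)"
    define X where "X = (LINT z|lborel. wt z * (cmod (v z))\<^sup>2)"
    have X: "X \<le> C2 * N"
    proof -
      obtain B where B: "\<And>k x. \<bar>A K \<Phi> k x\<bar> \<le> B" using A_bound_uniform[OF K(1,2)] by blast
      have "X \<le> C * ((LINT z|lborel. mdens (A K \<Phi>) v Gv z) + (LINT z|lborel. (cmod (v z))\<^sup>2) + 1 / s\<^sup>2 * m)"
        unfolding X_def wt_def mv by (rule hardy[OF vv(1) K(1) vv(2,3) A_bounded(1)[OF K(1,2)] B s])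
      also have "\<dots> \<le> C * (C1 * N + N + N)"
      proof (intro mult_left_mono add_mono C)
        show "(LINT z|lborel. mdens (A K \<Phi>) v Gv z) \<le> C1 * N" unfolding md by (rule Ev)
        have "m \<le> s\<^sup>2 * N" using mN mult_right_mono[OF \<mu>(2) N0] by linarith
        then show "1 / s\<^sup>2 * m \<le> N" using s by (simp add: divide_le_eq mult.commute)
      qed (rule vN)
      finally show ?thesis by (simp add: C2_def algebra_simps)
    qed
    have wm: "wt \<in> borel_measurable borel" "\<bar>wt z\<bar> \<le> 1 / s\<^sup>2" "0 \<le> wt z" for z
    proof -
      have "{z. 0 < infdist z \<omega> \<and> infdist z \<omega> < \<rho>} = {z. 0 < infdist z \<omega>} \<inter> {z. infdist z \<omega> < \<rho>}" by auto
      also have "open \<dots>" by (intro open_Int open_Collect_less continuous_intros)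
      finally have o: "{z. 0 < infdist z \<omega> \<and> infdist z \<omega> < \<rho>} \<in> sets borel" by simp
      show "wt \<in> borel_measurable borel" unfolding wt_def
        using o by (intro borel_measurable_divide borel_measurable_indicator borel_measurable_continuous_onI continuous_intros)
      show "\<bar>wt z\<bar> \<le> 1 / s\<^sup>2" unfolding wt_def
        using s by (auto simp: indicator_def intro!: frac_le power_mono)
      show "0 \<le> wt z" unfolding wt_def by simp
    qed
    have wi: "integrable lborel (\<lambda>z. wt z * (cmod (v z))\<^sup>2)" by (rule sq_int_weight_integrable[OF sv wm(1,2)])
    \<comment> \<open>Inside distance \<open>t j\<close> the shifted distance is at most
      \<open>2 * t j\<close>, because \<open>s = t (2 * n)\<close> does not exceed
      \<open>t j\<close>.\<close>
    have wlow: "1 / (4 * (t j)\<^sup>2) \<le> wt z" if "0 < infdist z \<omega>" "infdist z \<omega> < t j" "j \<le> 2 * n" for j z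
    proof -
      have "infdist z \<omega> < \<rho>" using that t(2)[of j] b by linarith
      then have "wt z = 1 / (infdist z \<omega> + s)\<^sup>2" using that by (simp add: wt_def)
      moreover have "(infdist z \<omega> + s)\<^sup>2 \<le> (2 * t j)\<^sup>2"
        using that s tanti[of j "2 * n"] unfolding s_def by (intro power_mono) auto
      then have "1 / (2 * t j)\<^sup>2 \<le> 1 / (infdist z \<omega> + s)\<^sup>2" using that s by (intro divide_left_mono mult_pos_pos zero_less_power) (auto simp: add_pos_pos t)
      ultimately show ?thesis by (simp add: power_mult_distrib)
    qed
    have xb: "0 \<le> \<xi> j x" "\<xi> j x \<le> 1" "\<bar>pd (\<xi> j) k x\<bar> \<le> 4 / t j" for j x k using xi[of j] by (auto simp: is_cutoff_def)
    have xC: "C1_fun (\<xi> j)" for j using xi[of j] by (simp add: is_cutoff_def)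
    define g where "g j x = grad_sq (\<xi> j) x * (cmod (zu x))\<^sup>2" for j x
    have gi: "integrable lborel (g j)" for j
      unfolding g_def
      by (rule sq_int_weight_integrable[OF su grad_sq_measurable[OF xC], where B = "2 * (4 / t j)\<^sup>2"])
        (use grad_sq_le[of "\<xi> j" _ "4 / t j"] xb(3) in auto)
    \<comment> \<open>\<open>128 = 32 * 4\<close>: the squared gradient is at most
      \<open>32 / (t j)\<^sup>2\<close>, the Hardy weight at least
      \<open>1 / (4 * (t j)\<^sup>2)\<close>.\<close>
    have gpt: "g j x \<le> 128 * (wt x * (cmod (v x))\<^sup>2)" "g j x = 0 \<or> t (Suc j) < infdist x \<omega> \<and> infdist x \<omega> < t j"
      if "j \<le> 2 * n" for j x
    proof -
      have a: "g j x = 0" if "\<not> (t (Suc j) < infdist x \<omega> \<and> infdist x \<omega> < t j)"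
      proof -
        have "\<forall>k. pd (\<xi> j) k x = 0" using that xi[of j] unfolding is_cutoff_def tS by (meson not_le)
        then show ?thesis by (simp add: g_def grad_sq_def)
      qed
      then show "g j x = 0 \<or> t (Suc j) < infdist x \<omega> \<and> infdist x \<omega> < t j" by blast
      show "g j x \<le> 128 * (wt x * (cmod (v x))\<^sup>2)"
      proof (cases "t (Suc j) < infdist x \<omega> \<and> infdist x \<omega> < t j")
        case True
        then have d: "0 < infdist x \<omega>" using t(1)[of "Suc j"] by linarith
        have veq: "v x = zu x" using True t(2)[of j] by (intro vzu) linarith
        have "grad_sq (\<xi> j) x \<le> 2 * (4 / t j)\<^sup>2" using grad_sq_le[of "\<xi> j" x "4 / t j"] xb(3) by simp
        also have "\<dots> = 128 * (1 / (4 * (t j)\<^sup>2))" by (simp add: power_divide)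
        also have "\<dots> \<le> 128 * wt x" using wlow[OF d _ that] True by simp
        finally have "grad_sq (\<xi> j) x * (cmod (zu x))\<^sup>2 \<le> 128 * wt x * (cmod (zu x))\<^sup>2" by (rule mult_right_mono) simp
        then show ?thesis by (simp add: g_def veq mult.assoc)
      next
        case False
        then show ?thesis using a wm(3)[of x] by simp
      qed
    qed
    \<comment> \<open>The open layers are disjoint, so at most one summand is nonzero at each point
      and the bound for a single layer serves for the sum.\<close>
    have gsum: "(\<Sum>j\<in>{n..<2 * n}. g j x) \<le> 128 * (wt x * (cmod (v x))\<^sup>2)" for x
    proof (cases "\<exists>j\<in>{n..<2 * n}. g j x \<noteq> 0")
      case True
      then obtain j where j: "j \<in> {n..<2 * n}" "g j x \<noteq> 0" by blast
      have other: "g i x = 0" if "i \<in> {n..<2 * n}" "i \<noteq> j" for i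
      proof (rule ccontr)
        assume "g i x \<noteq> 0"
        then have 1: "t (Suc i) < infdist x \<omega>" "infdist x \<omega> < t i" using gpt(2)[of i x] that by auto
        have 2: "t (Suc j) < infdist x \<omega>" "infdist x \<omega> < t j" using gpt(2)[of j x] j by auto
        consider "i < j" | "j < i" using \<open>i \<noteq> j\<close> by linarith
        then show False
        proof cases
          case 1
          then have "t j \<le> t (Suc i)" by (intro tanti) simp
          then show False using \<open>t (Suc i) < infdist x \<omega>\<close> 2 by linarith
        next
          case 2
          then have "t i \<le> t (Suc j)" by (intro tanti) simp
          then show False using \<open>t (Suc j) < infdist x \<omega>\<close> 1 by linarith
        qed
      qed
      have "(\<Sum>i\<in>{n..<2 * n}. g i x) = (\<Sum>i\<in>{j}. g i x)"
        by (rule sum.mono_neutral_right) (use j other in auto)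
      then show ?thesis using gpt(1)[of j x] j by simp
    next
      case False
      then have "(\<Sum>j\<in>{n..<2 * n}. g j x) = 0" by (intro sum.neutral) blast
      then show ?thesis using wm(3)[of x] by simp
    qed
    \<comment> \<open>The pigeonhole step: there are \<open>n\<close> layers, and together they cost
      at most 128 Hardy integrals.\<close>
    have "\<exists>j\<in>{n..<2 * n}. (LINT x|lborel. g j x) \<le> 128 * C2 * N / real n"
    proof (rule ccontr)
      assume "\<not> ?thesis"
      then have "(\<Sum>j\<in>{n..<2 * n}. 128 * C2 * N / real n) < (\<Sum>j\<in>{n..<2 * n}. LINT x|lborel. g j x)"
        using n by (intro sum_strict_mono) (auto simp: not_le)
      also have "\<dots> = (LINT x|lborel. (\<Sum>j\<in>{n..<2 * n}. g j x))"
        using gi by (intro Bochner_Integration.integral_sum[symmetric]) auto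
      also have "\<dots> \<le> (LINT x|lborel. 128 * (wt x * (cmod (v x))\<^sup>2))"
        using gi wi gsum by (intro integral_mono Bochner_Integration.integrable_sum integrable_mult_right) auto
      also have "\<dots> = 128 * X" unfolding X_def by (rule integral_mult_right_zero)
      also have "\<dots> \<le> 128 * C2 * N" using X by simp
      finally show False using n by simp
    qed
    then obtain j where j: "j \<in> {n..<2 * n}" and gj: "(LINT x|lborel. g j x) \<le> 128 * C2 * N / real n" by blast
    have j2: "j \<le> 2 * n" "n \<le> j" using j by auto
    define w where "w = cut (\<xi> j) zu"
    define Gw where "Gw = cut_grad (\<xi> j) zu zG"
    note ww = cutoff_outer[OF xi[of j] t(1)[of j] u, folded zu_def zG_def, folded w_def Gw_def]
    have Y2: "(1 + 1 / \<kappa>) * (128 * C2) / real n \<le> \<epsilon> / 2" "b\<^sup>2 * C2 / real n \<le> \<epsilon> / 2"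
    proof -
      have "(1 + 1 / \<kappa>) * (128 * C2) / real n \<le> Y / real n" "b\<^sup>2 * C2 / real n \<le> Y / real n"
        using Y1 n by (intro divide_right_mono; simp add: Y_def)+
      then show "(1 + 1 / \<kappa>) * (128 * C2) / real n \<le> \<epsilon> / 2" "b\<^sup>2 * C2 / real n \<le> \<epsilon> / 2" using Yn by linarith+
    qed
    have Ew: "(LINT x|lborel. mdens (A \<Omega> \<Phi>) w Gw x) \<le> E + \<epsilon> * N"
    proof -
      have pt: "mdens (A \<Omega> \<Phi>) w Gw x \<le> (1 + \<kappa>) * mdens (A \<Omega> \<Phi>) zu zG x + (1 + 1 / \<kappa>) * g j x" for x
        unfolding w_def Gw_def g_def by (rule mdens_cut[OF \<kappa>(1)]) (use xb(1,2)[of j x] in simp)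
      have i: "integrable lborel (\<lambda>x. (1 + \<kappa>) * mdens (A \<Omega> \<Phi>) zu zG x + (1 + 1 / \<kappa>) * g j x)"
        using Ei gi by (intro Bochner_Integration.integrable_add integrable_mult_right)
      have m0: "0 \<le> mdens (A \<Omega> \<Phi>) w Gw x" for x by (simp add: mdens_def sum_nonneg)
      have wi: "integrable lborel (mdens (A \<Omega> \<Phi>) w Gw)"
      proof (rule Bochner_Integration.integrable_bound[OF i])
        show "mdens (A \<Omega> \<Phi>) w Gw \<in> borel_measurable lborel" using mdens_measurable[OF ww(4,5)] by simp
        show "AE x in lborel. norm (mdens (A \<Omega> \<Phi>) w Gw x) \<le> norm ((1 + \<kappa>) * mdens (A \<Omega> \<Phi>) zu zG x + (1 + 1 / \<kappa>) * g j x)"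
          using pt m0 by (intro AE_I2) (simp add: order_trans[OF pt abs_ge_self])
      qed
      have "(LINT x|lborel. mdens (A \<Omega> \<Phi>) w Gw x) \<le> (LINT x|lborel. (1 + \<kappa>) * mdens (A \<Omega> \<Phi>) zu zG x + (1 + 1 / \<kappa>) * g j x)"
        by (rule integral_mono[OF wi i pt])
      also have "\<dots> = (1 + \<kappa>) * E + (1 + 1 / \<kappa>) * (LINT x|lborel. g j x)"
        unfolding E_def by (simp only: Bochner_Integration.integral_add[OF integrable_mult_right[OF Ei] integrable_mult_right[OF gi]] integral_mult_right_zero)
      also have "\<dots> \<le> (1 + \<kappa>) * E + (1 + 1 / \<kappa>) * (128 * C2 * N / real n)"
        using gj \<kappa> by (intro add_left_mono mult_left_mono) auto
      also have "(1 + 1 / \<kappa>) * (128 * C2 * N / real n) = (1 + 1 / \<kappa>) * (128 * C2) / real n * N" by simp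
      also have "(1 + \<kappa>) * E + (1 + 1 / \<kappa>) * (128 * C2) / real n * N \<le> (E + \<epsilon> / 2 * N) + \<epsilon> / 2 * N"
      proof (rule add_mono)
        have "\<kappa> * E \<le> \<kappa> * (M * N)" using EM \<kappa> by (intro mult_left_mono) auto
        also have "\<dots> \<le> \<epsilon> / 2 * N" using mult_right_mono[OF \<kappa>(2) N0] by (simp add: mult.assoc)
        finally show "(1 + \<kappa>) * E \<le> E + \<epsilon> / 2 * N" by (simp add: distrib_right)
        show "(1 + 1 / \<kappa>) * (128 * C2) / real n * N \<le> \<epsilon> / 2 * N" by (rule mult_right_mono[OF Y2(1) N0])
      qed
      also have "\<dots> = E + \<epsilon> * N" by (simp add: field_simps)
      finally show ?thesis .
    qed
    have Nw: "(1 - \<epsilon>) * N \<le> (LINT x|lborel. (cmod (w x))\<^sup>2)"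
    proof -
      have iw: "integrable lborel (\<lambda>x. (cmod (w x))\<^sup>2)" using ww(4) by simp
      have mw: "integrable lborel (\<lambda>x. indicator \<omega> x * (cmod (zu x))\<^sup>2)"
        using O_measurable(2) by (intro sq_int_weight_integrable[OF su, where B = 1] borel_measurable_indicator) (auto split: split_indicator)
      \<comment> \<open>Off the frontier there are three cases: beyond distance \<open>t j\<close>
        the competitor equals \<open>u\<close>, inside \<omega> the mass is \<open>m\<close>, and in
        the collar \<open>4 * (t j)\<^sup>2\<close> times the Hardy weight is at least 1.\<close>
      have "AE x in lborel. x \<notin> frontier \<omega>" by (rule AE_not_in[OF C1_jordan_frontier_null[OF J]])
      then have "AE x in lborel. (cmod (zu x))\<^sup>2 \<le> (cmod (w x))\<^sup>2 + indicator \<omega> x * (cmod (zu x))\<^sup>2 + 4 * (t j)\<^sup>2 * (wt x * (cmod (v x))\<^sup>2)"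
      proof eventually_elim
        fix x assume xf: "x \<notin> frontier \<omega>"
        have nn: "0 \<le> (cmod (w x))\<^sup>2" "0 \<le> indicator \<omega> x * (cmod (zu x))\<^sup>2" "0 \<le> 4 * (t j)\<^sup>2 * (wt x * (cmod (v x))\<^sup>2)"
          using wm(3) by auto
        consider "t j \<le> infdist x \<omega>" | "infdist x \<omega> = 0" | "0 < infdist x \<omega>" "infdist x \<omega> < t j"
          using infdist_nonneg[of x \<omega>] by linarith
        then show "(cmod (zu x))\<^sup>2 \<le> (cmod (w x))\<^sup>2 + indicator \<omega> x * (cmod (zu x))\<^sup>2 + 4 * (t j)\<^sup>2 * (wt x * (cmod (v x))\<^sup>2)"
        proof cases
          case 1
          then have "w x = zu x" using xi[of j] by (simp add: w_def cut_def is_cutoff_def)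
          then show ?thesis using nn by simp
        next
          case 2
          then have "x \<in> closure \<omega>" using w_ne by (simp add: in_closure_iff_infdist_zero)
          then have "x \<in> \<omega>" using xf openw by (simp add: frontier_def interior_open)
          then show ?thesis using nn by simp
        next
          case 3
          have vz: "v x = zu x" using 3 t(2)[of j] by (intro vzu) linarith
          have "1 \<le> 4 * (t j)\<^sup>2 * wt x" using wlow[OF 3 j2(1)] t(1)[of j] by (simp add: field_simps)
          from mult_right_mono[OF this, of "(cmod (zu x))\<^sup>2"] have "(cmod (zu x))\<^sup>2 \<le> 4 * (t j)\<^sup>2 * (wt x * (cmod (zu x))\<^sup>2)" by (simp add: mult.assoc)
          then show ?thesis unfolding vz using nn(1,2) by linarith
        qed
      qed
      then have "N \<le> (LINT x|lborel. (cmod (w x))\<^sup>2 + indicator \<omega> x * (cmod (zu x))\<^sup>2 + 4 * (t j)\<^sup>2 * (wt x * (cmod (v x))\<^sup>2))"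
        unfolding N_def by (intro integral_mono_AE iu Bochner_Integration.integrable_add iw mw integrable_mult_right wi)
      also have "\<dots> = (LINT x|lborel. (cmod (w x))\<^sup>2) + m + 4 * (t j)\<^sup>2 * X"
        unfolding m_def X_def
        by (simp only: Bochner_Integration.integral_add[OF Bochner_Integration.integrable_add[OF iw mw] integrable_mult_right[OF wi]]
            Bochner_Integration.integral_add[OF iw mw] integral_mult_right_zero)
      also have "m \<le> \<epsilon> / 2 * N" using mN mult_right_mono[OF \<mu>(3) N0] by linarith
      \<comment> \<open>Here \<open>n \<le> j\<close> pays off: \<open>4 * (t j)\<^sup>2\<close> is
        at most \<open>b\<^sup>2 / 4 ^ n\<close>, hence at most
        \<open>b\<^sup>2 / n\<close>.\<close>
      also have "4 * (t j)\<^sup>2 * X \<le> \<epsilon> / 2 * N"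
      proof -
        have "(t j)\<^sup>2 \<le> (t n)\<^sup>2" using tanti[OF j2(2)] t(1)[of j] by (intro power_mono) auto
        moreover have "4 * (t n)\<^sup>2 = b\<^sup>2 * (1 / 4) ^ n"
        proof -
          have "((2::real) ^ n)\<^sup>2 = 4 ^ n" by (simp add: power2_eq_square flip: power_mult_distrib)
          then show ?thesis by (simp add: t_def power_mult_distrib power_divide)
        qed
        moreover have "(1 / 4 :: real) ^ n \<le> 1 / real n"
        proof -
          have "real n \<le> 4 ^ n"
            using of_nat_less_two_power[of n, where 'a = real] power_mono[of "2::real" 4 n] by simp
          then show ?thesis using n by (simp add: power_one_over frac_le)
        qed
        then have "b\<^sup>2 * (1 / 4) ^ n \<le> b\<^sup>2 * (1 / real n)" by (intro mult_left_mono) auto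
        ultimately have "4 * (t j)\<^sup>2 \<le> b\<^sup>2 / real n" by simp
        moreover have "0 \<le> C2 * N" using C2 N0 by simp
        ultimately have "4 * (t j)\<^sup>2 * (C2 * N) \<le> b\<^sup>2 / real n * (C2 * N)" by (rule mult_right_mono)
        moreover have "4 * (t j)\<^sup>2 * X \<le> 4 * (t j)\<^sup>2 * (C2 * N)" using X by (intro mult_left_mono) auto
        moreover have "b\<^sup>2 / real n * (C2 * N) = b\<^sup>2 * C2 / real n * N" by simp
        moreover have "b\<^sup>2 * C2 / real n * N \<le> \<epsilon> / 2 * N" by (rule mult_right_mono[OF Y2(2) N0])
        ultimately show ?thesis by linarith
      qed
      finally show ?thesis by (simp add: algebra_simps)
    qed
    show "\<exists>w Gw. H1grad \<Omega> w Gw \<and> (\<forall>x. x \<notin> \<Omega>0 \<longrightarrow> w x = 0 \<and> (\<forall>k. Gw k x = 0)) \<and>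
        (LINT x|lborel. mdens (A \<Omega> \<Phi>) w Gw x) \<le> (LINT x|lborel. mdens (A \<Omega> \<Phi>) (zext \<Omega> u) (\<lambda>k. zext \<Omega> (G k)) x) + \<epsilon> * (LINT x|lborel. (cmod (zext \<Omega> u x))\<^sup>2) \<and>
        (1 - \<epsilon>) * (LINT x|lborel. (cmod (zext \<Omega> u x))\<^sup>2) \<le> (LINT x|lborel. (cmod (w x))\<^sup>2)"
      using ww(1,2,3) Ew Nw unfolding E_def N_def zu_def zG_def by blast
  qed
qed

text \<open>One inequality is the inclusion of the sets of quotients. For the other, a
  near-minimiser of the Neumann problem is turned into a Dirichlet competitor; the trial function
  bounds both infima by \<Lambda>, uniformly in \<Phi>.\<close>

lemma lambda_difference_tendsto_0:
  assumes J: "C1_jordan_boundary \<omega>" and ne: "\<Omega> \<noteq> {}"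
  shows "((\<lambda>\<Phi>. lambda_N \<Omega> (potF \<phi>) \<Phi> - lambda_D \<Omega> \<omega> (potF \<phi>) \<Phi>) \<longlongrightarrow> 0) at_top"
proof -
  obtain \<Lambda> where \<Lambda>: "\<Lambda> \<ge> 0" "\<And>\<Phi>. \<Lambda> \<in> set_D \<Phi>" using trial_function[OF ne] by blast
  have sub: "set_D \<Phi> \<subseteq> set_N \<Phi>" for \<Phi> by (rule set_D_subset_set_N[OF C1_jordan_frontier_null[OF J]])
  define lN where "lN \<Phi> = Inf (set_N \<Phi>)" for \<Phi>
  define lD where "lD \<Phi> = Inf (set_D \<Phi>)" for \<Phi>
  have Dne: "set_D \<Phi> \<noteq> {}" for \<Phi> using \<Lambda>(2) by blast
  have Nne: "set_N \<Phi> \<noteq> {}" for \<Phi> using Dne sub by blast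
  have ND: "lN \<Phi> \<le> lD \<Phi>" for \<Phi> unfolding lN_def lD_def by (rule cInf_superset_mono[OF Dne sets_bdd_below(1) sub])
  have DL: "lD \<Phi> \<le> \<Lambda>" for \<Phi> unfolding lD_def by (rule cInf_lower[OF \<Lambda>(2) sets_bdd_below(2)])
  have N0: "0 \<le> lN \<Phi>" for \<Phi> unfolding lN_def by (rule cInf_greatest[OF Nne sets_nonneg(1)])
  \<comment> \<open>From \<open>lD \<Phi> * (1 - \<delta>) \<le> q + \<delta>\<close>,
    \<open>q < lN \<Phi> + \<delta>\<close> and \<open>lD \<Phi> \<le> \<Lambda>\<close> the gap is
    at most \<open>2 * \<delta> + \<delta> * \<Lambda>\<close>, which the stated bound majorises.
    \<open>\<delta> \<le> 1 / 2\<close> keeps the competitor nonzero.\<close>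
  have close: "\<exists>\<Phi>0. \<forall>\<Phi>\<ge>\<Phi>0. lD \<Phi> - lN \<Phi> \<le> \<delta> * (4 + 2 * \<Lambda>)" if \<delta>: "0 < \<delta>" "\<delta> \<le> 1 / 2" for \<delta>
  proof -
    \<comment> \<open>\<open>\<Lambda> + 1\<close> bounds the quotient of every near-minimiser used
      below, as \<open>lN \<Phi> + \<delta> \<le> \<Lambda> + 1\<close>.\<close>
    have "\<Lambda> + 1 \<ge> 0" using \<Lambda>(1) by simp
    from dirichlet_competitor[OF J this \<delta>(1)] obtain \<Phi>0 where key: "\<And>\<Phi> u G. \<Phi> \<ge> \<Phi>0 \<Longrightarrow> H1grad \<Omega> u G \<Longrightarrow>
      integrable lborel (mdens (A \<Omega> \<Phi>) (zext \<Omega> u) (\<lambda>k. zext \<Omega> (G k))) \<Longrightarrow>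
      (LINT x|lborel. mdens (A \<Omega> \<Phi>) (zext \<Omega> u) (\<lambda>k. zext \<Omega> (G k)) x) \<le> (\<Lambda> + 1) * (LINT x|lborel. (cmod (zext \<Omega> u x))\<^sup>2) \<Longrightarrow>
      \<exists>w Gw. H1grad \<Omega> w Gw \<and> (\<forall>x. x \<notin> \<Omega>0 \<longrightarrow> w x = 0 \<and> (\<forall>k. Gw k x = 0)) \<and>
        (LINT x|lborel. mdens (A \<Omega> \<Phi>) w Gw x) \<le> (LINT x|lborel. mdens (A \<Omega> \<Phi>) (zext \<Omega> u) (\<lambda>k. zext \<Omega> (G k)) x) + \<delta> * (LINT x|lborel. (cmod (zext \<Omega> u x))\<^sup>2) \<and>
        (1 - \<delta>) * (LINT x|lborel. (cmod (zext \<Omega> u x))\<^sup>2) \<le> (LINT x|lborel. (cmod (w x))\<^sup>2)"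
      by blast
    have "lD \<Phi> - lN \<Phi> \<le> \<delta> * (4 + 2 * \<Lambda>)" if Phi: "\<Phi> \<ge> \<Phi>0" for \<Phi>
    proof -
      have "lN \<Phi> < lN \<Phi> + \<delta>" using \<delta> by simp
      then obtain q where q: "q \<in> set_N \<Phi>" "q < lN \<Phi> + \<delta>"
        unfolding lN_def by (meson cInf_lessD[OF Nne])
      obtain u G where u: "H1grad \<Omega> u G" and qe: "q = mag_energy \<Omega> \<Phi> (potF \<phi>) u G / L2norm2 \<Omega> u" and pos: "L2norm2 \<Omega> u > 0"
        using q(1) unfolding set_N_def by blast
      let ?D = "mdens (A \<Omega> \<Phi>) (zext \<Omega> u) (\<lambda>k. zext \<Omega> (G k))"
      show ?thesis
      proof (cases "integrable lborel ?D")
        \<comment> \<open>An energy that is 0 by default also occurs in the Dirichlet problem, so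
          \<open>lD \<Phi> \<le> 0 \<le> lN \<Phi>\<close>.\<close>
        case False
        then have "0 \<in> set_D \<Phi>" by (rule zero_in_set_D[OF u])
        then have "lD \<Phi> \<le> 0" unfolding lD_def by (rule cInf_lower[OF _ sets_bdd_below(2)])
        moreover have "0 \<le> \<delta> * (4 + 2 * \<Lambda>)" using \<delta> \<Lambda> by simp
        ultimately show ?thesis using N0[of \<Phi>] by linarith
      next
        case True
        define N where "N = (LINT x|lborel. (cmod (zext \<Omega> u x))\<^sup>2)"
        define E where "E = (LINT x|lborel. ?D x)"
        have N: "N > 0" "L2norm2 \<Omega> u = N" using pos by (simp_all add: N_def L2norm2_zext)
        have EqN: "E = q * N" using N unfolding qe mag_energy_mdens[OF order_refl] E_def[symmetric] by simp
        have "q \<le> \<Lambda> + 1" using q(2) ND[of \<Phi>] DL[of \<Phi>] \<delta> by linarith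
        then have "E \<le> (\<Lambda> + 1) * N" unfolding EqN using N by (intro mult_right_mono) auto
        from key[OF Phi u True this[unfolded E_def N_def], folded E_def N_def]
        obtain w Gw where w: "H1grad \<Omega> w Gw" "\<And>x. x \<notin> \<Omega>0 \<Longrightarrow> w x = 0" "\<And>x k. x \<notin> \<Omega>0 \<Longrightarrow> Gw k x = 0"
          and Ew: "(LINT x|lborel. mdens (A \<Omega> \<Phi>) w Gw x) \<le> E + \<delta> * N"
          and Nw: "(1 - \<delta>) * N \<le> (LINT x|lborel. (cmod (w x))\<^sup>2)" by blast
        define W where "W = (LINT x|lborel. (cmod (w x))\<^sup>2)"
        have Wp: "W > 0" using Nw N \<delta> unfolding W_def[symmetric] by (intro less_le_trans[OF _ Nw[folded W_def]] mult_pos_pos) auto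
        have "lD \<Phi> \<le> (LINT x|lborel. mdens (A \<Omega> \<Phi>) w Gw x) / W"
          unfolding lD_def W_def by (rule cInf_lower[OF admissible_D[OF w Wp[unfolded W_def]] sets_bdd_below(2)])
        then have "lD \<Phi> * W \<le> (LINT x|lborel. mdens (A \<Omega> \<Phi>) w Gw x)" using Wp by (simp add: le_divide_eq)
        moreover have "lD \<Phi> * ((1 - \<delta>) * N) \<le> lD \<Phi> * W"
          using Nw N0[of \<Phi>] ND[of \<Phi>] unfolding W_def by (intro mult_left_mono) auto
        ultimately have "lD \<Phi> * (1 - \<delta>) * N \<le> (q + \<delta>) * N" using Ew unfolding EqN by (simp add: algebra_simps)
        then have "lD \<Phi> * (1 - \<delta>) \<le> q + \<delta>" using N by simp
        then have "lD \<Phi> - lN \<Phi> \<le> 2 * \<delta> + \<delta> * lD \<Phi>" using q(2) by (simp add: algebra_simps)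
        also have "\<dots> \<le> 2 * \<delta> + \<delta> * \<Lambda>" using DL[of \<Phi>] \<delta> by (intro add_left_mono mult_left_mono) auto
        also have "\<dots> \<le> \<delta> * (4 + 2 * \<Lambda>)"
        proof -
          have "0 \<le> \<delta> * \<Lambda>" "0 \<le> \<delta>" using \<delta> \<Lambda> by auto
          moreover have "\<delta> * (4 + 2 * \<Lambda>) = 4 * \<delta> + 2 * (\<delta> * \<Lambda>)" by (simp add: algebra_simps)
          ultimately show ?thesis by linarith
        qed
        finally show ?thesis .
      qed
    qed
    then show ?thesis by blast
  qed
  have "((\<lambda>\<Phi>. lN \<Phi> - lD \<Phi>) \<longlongrightarrow> 0) at_top"
  proof (rule tendstoI)
    fix e :: real assume e: "e > 0"
    define \<delta> where "\<delta> = min (1 / 2) (e / (2 * (4 + 2 * \<Lambda>)))"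
    have p: "4 + 2 * \<Lambda> > 0" using \<Lambda> by simp
    have \<delta>: "0 < \<delta>" "\<delta> \<le> 1 / 2"
      using e p by (simp add: \<delta>_def) (simp only: \<delta>_def min.cobounded1)
    have "\<delta> * (4 + 2 * \<Lambda>) \<le> e / (2 * (4 + 2 * \<Lambda>)) * (4 + 2 * \<Lambda>)" using p by (intro mult_right_mono) (auto simp: \<delta>_def)
    also have "\<dots> = e / 2"
    proof -
      have "e / (2 * P) * P = e / 2" if "P > 0" for P :: real using that by simp
      from this[OF p] show ?thesis .
    qed
    also have "\<dots> < e" using e by simp
    finally have small: "\<delta> * (4 + 2 * \<Lambda>) < e" .
    obtain \<Phi>0 where c: "\<And>\<Phi>. \<Phi> \<ge> \<Phi>0 \<Longrightarrow> lD \<Phi> - lN \<Phi> \<le> \<delta> * (4 + 2 * \<Lambda>)" using close[OF \<delta>] by blast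
    show "\<forall>\<^sub>F \<Phi> in at_top. dist (lN \<Phi> - lD \<Phi>) 0 < e"
      using eventually_ge_at_top[of \<Phi>0]
    proof eventually_elim
      fix \<Phi> assume "\<Phi> \<ge> \<Phi>0"
      then have "lD \<Phi> - lN \<Phi> < e" using c small by fastforce
      then show "dist (lN \<Phi> - lD \<Phi>) 0 < e" using ND[of \<Phi>] by (simp add: dist_real_def)
    qed
  qed
  then show ?thesis unfolding lambda_sets lN_def lD_def .
qed

end

text \<open>The equation for \<phi> enters in weak form because its right-hand side jumps across the
  boundary of \<omega>, so \<phi> is not a classical C2 solution there. Convergence of the
  difference to 0 is the meaning of \<open>o(1)\<close>.\<close>

theorem theorem1p4:
  fixes \<Omega> \<omega> :: "(real^2) set" and \<phi> :: "real^2 \<Rightarrow> real"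
  assumes "smooth_domain \<Omega>" and "smooth_domain \<omega>" and "closure \<omega> \<subseteq> \<Omega>"
    and phi_C1: "\<forall>x\<in>\<Omega>. \<phi> differentiable (at x)" "\<forall>k. continuous_on \<Omega> (pd \<phi> k)"
    and phi_H1: "\<forall>k. set_integrable lborel \<Omega> (\<lambda>x. (pd \<phi> k x)\<^sup>2)"
    and phi_bd: "continuous_on (closure \<Omega>) \<phi>" "\<forall>x\<in>frontier \<Omega>. \<phi> x = 0"
    and phi_eq: "\<forall>\<psi>. test_fun \<Omega> \<psi> \<longrightarrow>
        (LINT x:\<Omega>|lborel. (\<Sum>k\<in>UNIV. pd \<phi> k x * pd \<psi> k x)) =
        2 * pi / measure lborel \<omega> * (LINT x:\<omega>|lborel. \<psi> x)"
  shows "((\<lambda>\<Phi>. lambda_N \<Omega> (potF \<phi>) \<Phi> - lambda_D \<Omega> \<omega> (potF \<phi>) \<Phi>) \<longlongrightarrow> 0) at_top"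
proof -
  interpret flux \<Omega> \<omega> \<phi>
    using assms by unfold_locales (auto simp: smooth_domain_def)
  show ?thesis
    using assms(1,2) by (intro lambda_difference_tendsto_0) (auto simp: smooth_domain_def)
qed

end
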